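(* If $G$ is a cograph, then the acyclic polynomial $A(G,x)$ can be calculated in linear time; that is, there is an algorithm which, given a cograph $G$ as input, outputs $A(G,x)$ in time linear in the size of $G$.
   Context: Graphs are finite, undirected and simple. The acyclic polynomial of a graph $G$ is $A(G,x)=\sum_{i\ge 0} a_i x^i$, where $a_i=|\{S\subseteq V(G): |S|=i \text{ and } G[S] \text{ is acyclic}\}|$ and $G[S]$ is the subgraph of $G$ induced by $S$ (acyclic means containing no cycle; the empty set is acyclic). A cograph is a graph that can be built recursively from single vertices via disjoint union and join operations (the join of two graphs is their disjoint union together with all edges between them); equivalently, a graph with no induced path $P_4$ on $4$ vertices. The size of $G$ is $|V(G)|+|E(G)|$. Cost convention: a bounded number of additions, multiplications, and scalar operations on polynomials is counted as taking constant time. *)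

theory Defs
  imports "HOL-Computational_Algebra.Polynomial"
begin

section \<open>Graphs, the acyclic polynomial, cographs\<close>

text \<open>A graph is given by its vertex set and its set of edges, each edge being a two-element set
  of vertices.\<close>

definition simple_graph :: "'a set \<Rightarrow> 'a set set \<Rightarrow> bool" where
  "simple_graph V E \<longleftrightarrow> finite V \<and> (\<forall>e\<in>E. e \<subseteq> V \<and> card e = 2)"

definition induced_edges :: "'a set set \<Rightarrow> 'a set \<Rightarrow> 'a set set" where
  "induced_edges E S = {e \<in> E. e \<subseteq> S}"

definition is_cycle :: "'a set \<Rightarrow> 'a set set \<Rightarrow> 'a list \<Rightarrow> bool" where
  "is_cycle V E vs \<longleftrightarrow> set vs \<subseteq> V \<and> length vs \<ge> 3 \<and> distinct vs \<and>
     (\<forall>i<length vs. {vs ! i, vs ! (Suc i mod length vs)} \<in> E)"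

definition acyclic_graph :: "'a set \<Rightarrow> 'a set set \<Rightarrow> bool" where
  "acyclic_graph V E \<longleftrightarrow> \<not> (\<exists>vs. is_cycle V E vs)"

definition acyclic_count :: "'a set \<Rightarrow> 'a set set \<Rightarrow> nat \<Rightarrow> nat" where
  "acyclic_count V E i = card {S. S \<subseteq> V \<and> card S = i \<and> acyclic_graph S (induced_edges E S)}"

text \<open>For finite \<open>V\<close> the counts with \<open>i > card V\<close> vanish, so the sum stops at \<open>card V\<close>.\<close>

definition acyclic_poly :: "'a set \<Rightarrow> 'a set set \<Rightarrow> int poly" where
  "acyclic_poly V E = (\<Sum>i\<le>card V. monom (int (acyclic_count V E i)) i)"

definition join_edges :: "'a set \<Rightarrow> 'a set \<Rightarrow> 'a set set" where
  "join_edges V W = {{v, w} | v w. v \<in> V \<and> w \<in> W}"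

inductive cograph :: "'a set \<Rightarrow> 'a set set \<Rightarrow> bool" where
  single: "cograph {v} {}"
| union: "cograph V E \<Longrightarrow> cograph W F \<Longrightarrow> V \<inter> W = {} \<Longrightarrow> cograph (V \<union> W) (E \<union> F)"
| join: "cograph V E \<Longrightarrow> cograph W F \<Longrightarrow> V \<inter> W = {} \<Longrightarrow>
    cograph (V \<union> W) (E \<union> F \<union> join_edges V W)"

lemma cograph_imp_simple_graph: "cograph V E \<Longrightarrow> simple_graph V E"
proof (induction rule: cograph.induct)
  case (join V E W F)
  have "e \<subseteq> V \<union> W \<and> card e = 2" if "e \<in> join_edges V W" for e
  proof -
    from that obtain v w where "e = {v, w}" "v \<in> V" "w \<in> W"
      unfolding join_edges_def by blast
    moreover have "v \<noteq> w" using calculation join.hyps by blast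
    ultimately show ?thesis by simp
  qed
  then show ?case using join.IH unfolding simple_graph_def by blast
qed (auto simp: simple_graph_def)


section \<open>A random access machine with polynomial registers\<close>

text \<open>Programs are structured programs for a random access machine.  A state consists of
  registers and arrays holding natural numbers, and registers and arrays holding integer
  polynomials; a fixed program mentions only finitely many names.  Every instruction and every
  evaluation of a test costs one unit of time.  Two features keep this uniform cost measure honest.

  \<^item> The only arithmetic on natural numbers is increment and (truncated) decrement.  Hence a number
    occurring in a run of \<open>t\<close> steps exceeds the program constants and the input numbers by at most
    \<open>t\<close>, so in a linear time computation all machine words have logarithmic length.

  \<^item> Polynomials can be added, multiplied and scaled at unit cost, but there is no instruction that
    inspects a polynomial: no information flows from polynomials to numbers, tests or addresses.\<close>

type_synonym vname = string

datatype operand = Const nat | Reg vname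

datatype test = Eq operand operand | Less operand operand

datatype com =
    Skip
  | Assign vname operand
  | Incr vname
  | Decr vname
  | Load vname vname operand
  | Store vname operand operand
  | PConst vname int
  | PVar vname
  | PMove vname vname
  | PAdd vname vname vname
  | PMult vname vname vname
  | PSmult vname int vname
  | PSmultReg vname operand vname
  | PLoad vname vname operand
  | PStore vname operand vname
  | Seq com com
  | Cond test com com
  | While test com

record state =
  reg :: "vname \<Rightarrow> nat"
  arr :: "vname \<Rightarrow> nat \<Rightarrow> nat"
  preg :: "vname \<Rightarrow> int poly"
  parr :: "vname \<Rightarrow> nat \<Rightarrow> int poly"

fun opval :: "operand \<Rightarrow> state \<Rightarrow> nat" where
  "opval (Const k) s = k"
| "opval (Reg x) s = reg s x"

fun testval :: "test \<Rightarrow> state \<Rightarrow> bool" where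
  "testval (Eq a b) s \<longleftrightarrow> opval a s = opval b s"
| "testval (Less a b) s \<longleftrightarrow> opval a s < opval b s"

definition set_reg :: "vname \<Rightarrow> nat \<Rightarrow> state \<Rightarrow> state" where
  "set_reg x k s = s\<lparr>reg := (reg s)(x := k)\<rparr>"

definition set_arr :: "vname \<Rightarrow> nat \<Rightarrow> nat \<Rightarrow> state \<Rightarrow> state" where
  "set_arr A i k s = s\<lparr>arr := (arr s)(A := (arr s A)(i := k))\<rparr>"

definition set_preg :: "vname \<Rightarrow> int poly \<Rightarrow> state \<Rightarrow> state" where
  "set_preg p f s = s\<lparr>preg := (preg s)(p := f)\<rparr>"

definition set_parr :: "vname \<Rightarrow> nat \<Rightarrow> int poly \<Rightarrow> state \<Rightarrow> state" where
  "set_parr P i f s = s\<lparr>parr := (parr s)(P := (parr s P)(i := f))\<rparr>"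

text \<open>\<open>exec c s t s'\<close>: started in \<open>s\<close>, the program \<open>c\<close> halts in \<open>s'\<close> after exactly \<open>t\<close> steps.\<close>

inductive exec :: "com \<Rightarrow> state \<Rightarrow> nat \<Rightarrow> state \<Rightarrow> bool" where
  Skip: "exec Skip s 1 s"
| Assign: "exec (Assign x a) s 1 (set_reg x (opval a s) s)"
| Incr: "exec (Incr x) s 1 (set_reg x (reg s x + 1) s)"
| Decr: "exec (Decr x) s 1 (set_reg x (reg s x - 1) s)"
| Load: "exec (Load x A a) s 1 (set_reg x (arr s A (opval a s)) s)"
| Store: "exec (Store A a b) s 1 (set_arr A (opval a s) (opval b s) s)"
| PConst: "exec (PConst p k) s 1 (set_preg p [:k:] s)"
| PVar: "exec (PVar p) s 1 (set_preg p [:0, 1:] s)"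
| PMove: "exec (PMove p q) s 1 (set_preg p (preg s q) s)"
| PAdd: "exec (PAdd p q r) s 1 (set_preg p (preg s q + preg s r) s)"
| PMult: "exec (PMult p q r) s 1 (set_preg p (preg s q * preg s r) s)"
| PSmult: "exec (PSmult p k q) s 1 (set_preg p (smult k (preg s q)) s)"
| PSmultReg: "exec (PSmultReg p a q) s 1 (set_preg p (smult (int (opval a s)) (preg s q)) s)"
| PLoad: "exec (PLoad p P a) s 1 (set_preg p (parr s P (opval a s)) s)"
| PStore: "exec (PStore P a p) s 1 (set_parr P (opval a s) (preg s p) s)"
| Seq: "exec c1 s t1 s' \<Longrightarrow> exec c2 s' t2 s'' \<Longrightarrow> exec (Seq c1 c2) s (t1 + t2) s''"
| CondTrue: "testval b s \<Longrightarrow> exec c1 s t s' \<Longrightarrow> exec (Cond b c1 c2) s (1 + t) s'"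
| CondFalse: "\<not> testval b s \<Longrightarrow> exec c2 s t s' \<Longrightarrow> exec (Cond b c1 c2) s (1 + t) s'"
| WhileFalse: "\<not> testval b s \<Longrightarrow> exec (While b c) s 1 s"
| WhileTrue: "testval b s \<Longrightarrow> exec c s t1 s' \<Longrightarrow> exec (While b c) s' t2 s'' \<Longrightarrow>
    exec (While b c) s (1 + t1 + t2) s''"

inductive_cases exec_SeqE: "exec (Seq c1 c2) s t s'"
inductive_cases exec_CondE: "exec (Cond b c1 c2) s t s'"
inductive_cases exec_WhileE: "exec (While b c) s t s'"

lemma exec_deterministic:
  "exec c s t s' \<Longrightarrow> exec c s u s'' \<Longrightarrow> u = t \<and> s'' = s'"
proof (induction arbitrary: u s'' rule: exec.induct)
  case (Seq c1 s t1 s' c2 t2 s2)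
  from Seq.prems obtain u1 u2 r where "u = u1 + u2" "exec c1 s u1 r" "exec c2 r u2 s''"
    by (rule exec_SeqE)
  with Seq.IH show ?case by metis
next
  case (CondTrue b s c1 t s' c2)
  from CondTrue.prems obtain u1 where "u = 1 + u1" "exec c1 s u1 s''"
    by (rule exec_CondE) (use CondTrue.hyps in simp_all)
  with CondTrue.IH show ?case by metis
next
  case (CondFalse b s c2 t s' c1)
  from CondFalse.prems obtain u1 where "u = 1 + u1" "exec c2 s u1 s''"
    by (rule exec_CondE) (use CondFalse.hyps in simp_all)
  with CondFalse.IH show ?case by metis
next
  case (WhileFalse b s c)
  from WhileFalse.prems show ?case
    by (rule exec_WhileE) (use WhileFalse.hyps in simp_all)
next
  case (WhileTrue b s c t1 s' t2 s2)
  from WhileTrue.prems obtain u1 u2 r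
    where "u = 1 + u1 + u2" "exec c s u1 r" "exec (While b c) r u2 s''"
    by (rule exec_WhileE) (use WhileTrue.hyps in simp_all)
  with WhileTrue.IH show ?case by metis
qed (erule exec.cases; simp; fail)+


section \<open>Input by adjacency lists\<close>

definition adjacency_lists :: "nat set \<Rightarrow> nat set set \<Rightarrow> nat list list \<Rightarrow> bool" where
  "adjacency_lists V E adj \<longleftrightarrow> V = {..<length adj} \<and>
     (\<forall>v<length adj. distinct (adj ! v) \<and> set (adj ! v) = {u. {u, v} \<in> E})"

text \<open>The neighbours of \<open>v\<close> are stored, in the order of \<open>adj ! v\<close>, in the cells of array \<open>adj\<close>
  from index \<open>off v\<close> (inclusive) to \<open>off (v + 1)\<close> (exclusive); the last entry \<open>off n\<close> is the total
  length of all adjacency lists.  All other cells are zero.\<close>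

definition input_state :: "nat list list \<Rightarrow> state" where
  "input_state adj = \<lparr>
     reg = (\<lambda>_. 0)(''n'' := length adj),
     arr = (\<lambda>_ _. 0)
       (''off'' := (\<lambda>v. if v \<le> length adj then length (concat (take v adj)) else 0),
        ''adj'' := (\<lambda>i. if i < length (concat adj) then concat adj ! i else 0)),
     preg = (\<lambda>_. 0),
     parr = (\<lambda>_ _. 0)\<rparr>"

definition output_poly :: "state \<Rightarrow> int poly" where
  "output_poly s = preg s ''result''"

definition graph_size :: "'a set \<Rightarrow> 'a set set \<Rightarrow> nat" where
  "graph_size V E = card V + card E"

end

theory Submission
  imports Defs
begin

text \<open>Disjoint union and join determine the acyclic polynomial.  In a disjoint union the induced
  forests of the two parts are chosen independently.  An induced forest of a join that meets both
  sides consists of a single vertex of one side and an independent set of the other: an edge on one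
  side forms a triangle with any vertex of the other, and two vertices on each side form a cycle of
  length four.  So if the induced forests, the independent sets and the vertices of a graph are
  counted by three polynomials, then those of a union or a join are polynomial expressions in those of
  the parts (\<open>polys_union\<close>, \<open>polys_join\<close>), and one pass over a cotree from the leaves to the root
  yields the result.  The empty set is left out of the counts; then the empty graph has the
  polynomials \<open>0\<close>, which is what an unused cell of the machine contains.

  The problem is to find the cotree in linear time.  The program inserts the vertices one by one, in
  the manner of Corneil, Perl and Stewart, and may spend on a vertex \<open>x\<close> a time proportional to
  its degree.  Call a node of the current tree full if all leaves below it are neighbours of \<open>x\<close>, and
  mixed if some are and some are not.  The full nodes are found from the neighbours of \<open>x\<close> upwards, by
  counting the full children of every node that has one; as inner nodes have at least two
  children, there are at most twice as many full nodes as neighbours (\<open>card_full\<close>).  Since a cograph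
  has no induced path on four vertices, all siblings of a mixed node are full if the parent is a join
  node, and contain no neighbour of \<open>x\<close> if it is a union node (\<open>mixed_siblings\<close>).  Hence the mixed nodes
  lie on one path that starts at the root, \<open>x\<close> is attached to everything beside this path exactly as the
  cotree prescribes, and only the lowest node \<open>u\<close> of the path has to be changed.

  The path is never walked.  Its join nodes show up because they have full children; union nodes above
  \<open>u\<close> do not.  As labels alternate, \<open>u\<close> is the only mixed node with a full child that is neither the parent nor
  the grandparent of another mixed node with a full child (\<open>unflagged_bottom\<close>, \<open>exists_unflagged\<close>).  The
  children of \<open>u\<close> are separated into the full ones, \<open>F\<close>, and the remaining ones, \<open>R\<close>.  If \<open>u\<close> is a union
  node, \<open>x\<close> has to be joined with the part \<open>F\<close>; if it is a join node, \<open>x\<close> is put beside the part \<open>R\<close> by a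
  union.  In both cases it is \<open>F\<close> that is moved to a new node, at the cost of its size
  (\<open>graftable_split_union\<close>, \<open>graftable_split_join\<close>).

  A single step resists this accounting: if \<open>R\<close> has one element, this element has to be
  found, although nothing points to it.  Every node therefore keeps a stack of all the children it ever
  received, and the search skips the entries that have moved elsewhere.  A node whose stack has been
  searched leaves the tree, so the total length of the stacks of the nodes in the tree is a
  potential that pays for all searches (\<open>potential\<close>).\<close>

section \<open>Cographs have no induced path on four vertices\<close>

definition P4_free :: "'a set \<Rightarrow> 'a set set \<Rightarrow> bool" where
  "P4_free V E \<longleftrightarrow> (\<forall>a\<in>V. \<forall>b\<in>V. \<forall>c\<in>V. \<forall>d\<in>V.
     {a, b} \<in> E \<longrightarrow> {b, c} \<in> E \<longrightarrow> {c, d} \<in> E \<longrightarrow> a \<noteq> c \<longrightarrow> a \<noteq> d \<longrightarrow> b \<noteq> d \<longrightarrow>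
     {a, c} \<in> E \<or> {b, d} \<in> E \<or> {a, d} \<in> E)"

lemma join_edges_iff:
  "{a, b} \<in> join_edges V W \<longleftrightarrow> a \<in> V \<and> b \<in> W \<or> b \<in> V \<and> a \<in> W"
  unfolding join_edges_def by (auto simp: doubleton_eq_iff)

lemma simple_graph_edgeD:
  assumes "simple_graph V E" "{a, b} \<in> E" shows "a \<in> V" "b \<in> V" "a \<noteq> b"
proof -
  have "{a, b} \<subseteq> V" "card {a, b} = 2"
    using assms unfolding simple_graph_def by blast+
  then show "a \<in> V" "b \<in> V" "a \<noteq> b" by (auto split: if_splits)
qed

text \<open>The three non-edges of the path \<open>a b c d\<close> are again a path, \<open>b d a c\<close>.  In a union the
  edges keep the four vertices on one side, in a join the non-edges do.\<close>

lemma cograph_P4_free: "cograph V E \<Longrightarrow> P4_free V E"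
proof (induction rule: cograph.induct)
  case (single v)
  show ?case by (simp add: P4_free_def)
next
  case (union V E W F)
  have E: "a \<in> V \<and> b \<in> V" if "{a, b} \<in> E" for a b
    using simple_graph_edgeD[OF cograph_imp_simple_graph[OF union.hyps(1)] that] by blast
  have F: "a \<in> W \<and> b \<in> W" if "{a, b} \<in> F" for a b
    using simple_graph_edgeD[OF cograph_imp_simple_graph[OF union.hyps(2)] that] by blast
  show ?case
    unfolding P4_free_def
  proof (intro ballI impI)
    fix a b c d
    assume *: "{a, b} \<in> E \<union> F" "{b, c} \<in> E \<union> F" "{c, d} \<in> E \<union> F" "a \<noteq> c" "a \<noteq> d" "b \<noteq> d"
    show "{a, c} \<in> E \<union> F \<or> {b, d} \<in> E \<union> F \<or> {a, d} \<in> E \<union> F"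
    proof (cases "b \<in> V")
      case True
      then have "{a, b} \<in> E" "{b, c} \<in> E" using * F union.hyps(3) by blast+
      moreover from this have "{c, d} \<in> E" using * E F union.hyps(3) by blast
      ultimately show ?thesis using * E union.IH(1) unfolding P4_free_def by blast
    next
      case False
      then have "{a, b} \<in> F" "{b, c} \<in> F" using * E by blast+
      moreover from this have "{c, d} \<in> F" using * E F union.hyps(3) by blast
      ultimately show ?thesis using * F union.IH(2) unfolding P4_free_def by blast
    qed
  qed
next
  case (join V E W F)
  have E: "a \<in> V \<and> b \<in> V" if "{a, b} \<in> E" for a b
    using simple_graph_edgeD[OF cograph_imp_simple_graph[OF join.hyps(1)] that] by blast
  have F: "a \<in> W \<and> b \<in> W" if "{a, b} \<in> F" for a b
    using simple_graph_edgeD[OF cograph_imp_simple_graph[OF join.hyps(2)] that] by blast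
  let ?J = "E \<union> F \<union> join_edges V W"
  show ?case
    unfolding P4_free_def
  proof (intro ballI impI)
    fix a b c d
    assume V: "a \<in> V \<union> W" "b \<in> V \<union> W" "c \<in> V \<union> W" "d \<in> V \<union> W"
      and *: "{a, b} \<in> ?J" "{b, c} \<in> ?J" "{c, d} \<in> ?J" "a \<noteq> c" "a \<noteq> d" "b \<noteq> d"
    show "{a, c} \<in> ?J \<or> {b, d} \<in> ?J \<or> {a, d} \<in> ?J"
    proof (rule ccontr)
      assume n: "\<not> ?thesis"
      have s: "p \<in> V \<longleftrightarrow> q \<in> V" if "{p, q} \<notin> ?J" "p \<in> V \<union> W" "q \<in> V \<union> W" for p q
        using that join.hyps(3) by (auto simp: join_edges_iff)
      have eq: "a \<in> V \<longleftrightarrow> c \<in> V" "b \<in> V \<longleftrightarrow> d \<in> V" "a \<in> V \<longleftrightarrow> d \<in> V"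
        by (rule s; use n V in blast)+
      show False
      proof (cases "a \<in> V")
        case True
        then have "a \<in> V" "b \<in> V" "c \<in> V" "d \<in> V" using eq by auto
        moreover from this have "{a, b} \<in> E" "{b, c} \<in> E" "{c, d} \<in> E"
          using * F join.hyps(3) by (auto simp: join_edges_iff)
        ultimately show False using * n join.IH(1) unfolding P4_free_def by blast
      next
        case False
        then have "a \<in> W" "b \<in> W" "c \<in> W" "d \<in> W" using eq V by auto
        moreover from this have "{a, b} \<in> F" "{b, c} \<in> F" "{c, d} \<in> F"
          using * E join.hyps(3) by (auto simp: join_edges_iff)
        ultimately show False using * n join.IH(2) unfolding P4_free_def by blast
      qed
    qed
  qed
qed

section \<open>Counting induced forests and independent sets\<close>

definition gen_poly :: "'a set set \<Rightarrow> int poly" where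
  "gen_poly \<F> = (\<Sum>T\<in>\<F>. monom 1 (card T))"

definition acyc :: "'a set set \<Rightarrow> 'a set \<Rightarrow> bool" where
  "acyc E T \<longleftrightarrow> acyclic_graph T (induced_edges E T)"

definition indep :: "'a set set \<Rightarrow> 'a set \<Rightarrow> bool" where
  "indep E T \<longleftrightarrow> (\<forall>a\<in>T. \<forall>b\<in>T. {a, b} \<notin> E)"

text \<open>The sets counted are nonempty, so that the empty graph has the polynomials \<open>0\<close>.\<close>

definition acyc_poly :: "'a set set \<Rightarrow> 'a set \<Rightarrow> int poly" where
  "acyc_poly E S = gen_poly {T. T \<subseteq> S \<and> T \<noteq> {} \<and> acyc E T}"

definition indep_poly :: "'a set set \<Rightarrow> 'a set \<Rightarrow> int poly" where
  "indep_poly E S = gen_poly {T. T \<subseteq> S \<and> T \<noteq> {} \<and> indep E T}"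

text \<open>This is the number of vertices times the indeterminate.\<close>

definition single_poly :: "'a set \<Rightarrow> int poly" where
  "single_poly S = gen_poly {T. T \<subseteq> S \<and> card T = 1}"

lemma gen_poly_Un:
  "finite \<F> \<Longrightarrow> finite \<G> \<Longrightarrow> \<F> \<inter> \<G> = {} \<Longrightarrow> gen_poly (\<F> \<union> \<G>) = gen_poly \<F> + gen_poly \<G>"
  unfolding gen_poly_def by (rule sum.union_disjoint)

text \<open>A union of a set on either side determines its two parts, and cardinalities add up.\<close>

lemma gen_poly_product:
  assumes "\<And>T. T \<in> \<F> \<Longrightarrow> T \<subseteq> S" "\<And>T. T \<in> \<G> \<Longrightarrow> T \<subseteq> S'" "S \<inter> S' = {}" "finite S" "finite S'"
  shows "gen_poly {T1 \<union> T2 | T1 T2. T1 \<in> \<F> \<and> T2 \<in> \<G>} = gen_poly \<F> * gen_poly \<G>"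
proof -
  have inj: "inj_on (\<lambda>(T1, T2). T1 \<union> T2) (\<F> \<times> \<G>)"
  proof (rule inj_onI, clarify)
    fix T1 T2 T1' T2'
    assume *: "T1 \<in> \<F>" "T2 \<in> \<G>" "T1' \<in> \<F>" "T2' \<in> \<G>" "T1 \<union> T2 = T1' \<union> T2'"
    have "T1 = (T1 \<union> T2) \<inter> S" "T1' = (T1' \<union> T2') \<inter> S" "T2 = (T1 \<union> T2) \<inter> S'" "T2' = (T1' \<union> T2') \<inter> S'"
      using *(1-4) assms(1-3) by blast+
    then show "T1 = T1' \<and> T2 = T2'" using *(5) by metis
  qed
  have eq: "{T1 \<union> T2 | T1 T2. T1 \<in> \<F> \<and> T2 \<in> \<G>} = (\<lambda>(T1, T2). T1 \<union> T2) ` (\<F> \<times> \<G>)"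
    by auto
  have "gen_poly {T1 \<union> T2 | T1 T2. T1 \<in> \<F> \<and> T2 \<in> \<G>} = (\<Sum>(T1, T2)\<in>\<F> \<times> \<G>. monom 1 (card (T1 \<union> T2)))"
    unfolding gen_poly_def eq sum.reindex[OF inj] by (simp add: case_prod_unfold)
  also have "\<dots> = (\<Sum>(T1, T2)\<in>\<F> \<times> \<G>. monom 1 (card T1) * monom (1::int) (card T2))"
  proof (rule sum.cong, simp, clarify)
    fix T1 T2 assume "T1 \<in> \<F>" "T2 \<in> \<G>"
    then have "T1 \<subseteq> S" "T2 \<subseteq> S'" using assms by auto
    then have "finite T1" "finite T2" "T1 \<inter> T2 = {}"
      using assms(3-5) by (auto intro: finite_subset)
    then show "monom 1 (card (T1 \<union> T2)) = monom 1 (card T1) * monom (1::int) (card T2)"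
      by (simp add: card_Un_disjoint mult_monom)
  qed
  also have "\<dots> = gen_poly \<F> * gen_poly \<G>"
    by (simp add: gen_poly_def sum_product sum.cartesian_product)
  finally show ?thesis .
qed

subsection \<open>Empty and singleton sets\<close>

lemma acyc_small:
  assumes "finite T" "card T \<le> 2" shows "acyc E T"
proof -
  have False if "is_cycle T (induced_edges E T) vs" for vs
  proof -
    have "card (set vs) \<le> card T"
      using that assms(1) by (intro card_mono) (auto simp: is_cycle_def)
    moreover have "card (set vs) = length vs" "length vs \<ge> 3"
      using that by (auto simp: is_cycle_def distinct_card)
    ultimately
    show False using assms(2) by simp
  qed
  then show ?thesis unfolding acyc_def acyclic_graph_def by blast
qed

lemma polys_empty:
  fixes E :: "'a set set"
  shows "acyc_poly E {} = 0" "indep_poly E {} = 0" "single_poly ({} :: 'a set) = 0"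
proof -
  have "{T::'a set. T = {} \<and> card T = Suc 0} = {}" by auto
  then show "acyc_poly E {} = 0" "indep_poly E {} = 0" "single_poly ({} :: 'a set) = 0"
    unfolding acyc_poly_def indep_poly_def single_poly_def gen_poly_def by simp_all
qed

lemma polys_singleton:
  assumes "{v} \<notin> E"
  shows "acyc_poly E {v} = [:0, 1:]" "indep_poly E {v} = [:0, 1:]" "single_poly {v} = [:0, 1:]"
proof -
  have "{T. T \<subseteq> {v} \<and> T \<noteq> {} \<and> acyc E T} = {{v}}"
    using acyc_small[of "{v}" E] by (auto simp: subset_singleton_iff)
  moreover have "{T. T \<subseteq> {v} \<and> T \<noteq> {} \<and> indep E T} = {{v}}"
    using assms by (auto simp: indep_def subset_singleton_iff)
  moreover have "{T. T \<subseteq> {v} \<and> card T = 1} = {{v}}"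
    by (auto simp: subset_singleton_iff)
  moreover have "monom (1::int) 1 = [:0, 1:]" by (simp add: monom_altdef)
  ultimately show "acyc_poly E {v} = [:0, 1:]" "indep_poly E {v} = [:0, 1:]" "single_poly {v} = [:0, 1:]"
    unfolding acyc_poly_def indep_poly_def single_poly_def gen_poly_def by simp_all
qed

subsection \<open>Disjoint unions\<close>

lemma cycle_stays:
  assumes "is_cycle T (induced_edges E T) vs" "vs ! 0 \<in> S"
    and sep: "\<And>a b. a \<in> S \<Longrightarrow> b \<in> T \<Longrightarrow> {a, b} \<in> E \<Longrightarrow> b \<in> S"
  shows "set vs \<subseteq> S"
proof -
  have "i < length vs \<Longrightarrow> vs ! i \<in> S" for i
  proof (induction i)
    case (Suc i)
    then have "vs ! i \<in> S" by simp
    moreover have "{vs ! i, vs ! Suc i} \<in> E" "vs ! Suc i \<in> T"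
      using assms(1) Suc.prems
      by (auto simp: is_cycle_def induced_edges_def dest!: spec[of _ i])
    ultimately show ?case using sep by blast
  qed (use assms in simp)
  then show ?thesis by (auto simp: in_set_conv_nth)
qed

lemma cycle_mono:
  assumes "is_cycle T (induced_edges E T) vs" "set vs \<subseteq> S"
  shows "is_cycle S (induced_edges E S) vs"
proof -
  have "vs ! i \<in> S" "vs ! (Suc i mod length vs) \<in> S" if "i < length vs" for i
  proof -
    have "Suc i mod length vs < length vs" using that by (intro mod_less_divisor) linarith
    then show "vs ! i \<in> S" "vs ! (Suc i mod length vs) \<in> S"
      using that assms(2) nth_mem by blast+
  qed
  then show ?thesis
    using assms unfolding is_cycle_def induced_edges_def by simp
qed

lemma acyc_Un:
  assumes sep: "\<And>a b. a \<in> S \<Longrightarrow> b \<in> S' \<Longrightarrow> {a, b} \<notin> E" and T: "T \<subseteq> S" "T' \<subseteq> S'"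
  shows "acyc E (T \<union> T') \<longleftrightarrow> acyc E T \<and> acyc E T'"
proof
  assume "acyc E (T \<union> T')"
  moreover have "is_cycle (T \<union> T') (induced_edges E (T \<union> T')) vs"
    if "is_cycle T (induced_edges E T) vs \<or> is_cycle T' (induced_edges E T') vs" for vs
    using that cycle_mono[of T E vs "T \<union> T'"] cycle_mono[of T' E vs "T \<union> T'"]
    by (auto simp: is_cycle_def)
  ultimately show "acyc E T \<and> acyc E T'" unfolding acyc_def acyclic_graph_def by blast
next
  assume *: "acyc E T \<and> acyc E T'"
  have False if c: "is_cycle (T \<union> T') (induced_edges E (T \<union> T')) vs" for vs
  proof -
    have "vs ! 0 \<in> set vs" using c by (intro nth_mem) (auto simp: is_cycle_def)
    then have "vs ! 0 \<in> T \<or> vs ! 0 \<in> T'" using c by (auto simp: is_cycle_def)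
    then have "set vs \<subseteq> T \<or> set vs \<subseteq> T'"
    proof
      assume "vs ! 0 \<in> T"
      then have "set vs \<subseteq> T" by (rule cycle_stays[OF c]) (use sep T in blast)
      then show ?thesis ..
    next
      assume "vs ! 0 \<in> T'"
      then have "set vs \<subseteq> T'"
      proof (rule cycle_stays[OF c])
        fix a b assume "a \<in> T'" "b \<in> T \<union> T'" "{a, b} \<in> E"
        then show "b \<in> T'" using sep[of b a] T by (auto simp: insert_commute)
      qed
      then show ?thesis ..
    qed
    then show False using * cycle_mono[OF c] unfolding acyc_def acyclic_graph_def by blast
  qed
  then show "acyc E (T \<union> T')" unfolding acyc_def acyclic_graph_def by blast
qed

text \<open>Common frame for union and join: a nonempty set lies on one side, on the other side, or
  meets both, and only the last kind depends on the operation.\<close>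

lemma gen_poly_split:
  assumes fin: "finite S" "finite S'" and "S \<inter> S' = {}"
    and P: "\<And>T T'. T \<subseteq> S \<Longrightarrow> T' \<subseteq> S' \<Longrightarrow> T \<noteq> {} \<Longrightarrow> T' \<noteq> {} \<Longrightarrow> P (T \<union> T') \<longleftrightarrow> (T, T') \<in> R"
  shows "gen_poly {T. T \<subseteq> S \<union> S' \<and> T \<noteq> {} \<and> P T} =
    gen_poly {T. T \<subseteq> S \<and> T \<noteq> {} \<and> P T} + gen_poly {T. T \<subseteq> S' \<and> T \<noteq> {} \<and> P T} +
    gen_poly {T \<union> T' | T T'. T \<subseteq> S \<and> T' \<subseteq> S' \<and> T \<noteq> {} \<and> T' \<noteq> {} \<and> (T, T') \<in> R}"
proof -
  let ?A = "{T. T \<subseteq> S \<and> T \<noteq> {} \<and> P T}" and ?B = "{T. T \<subseteq> S' \<and> T \<noteq> {} \<and> P T}"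
  let ?C = "{T \<union> T' | T T'. T \<subseteq> S \<and> T' \<subseteq> S' \<and> T \<noteq> {} \<and> T' \<noteq> {} \<and> (T, T') \<in> R}"
  have "finite (Pow (S \<union> S'))" using fin by simp
  then have f: "finite ?A" "finite ?B" "finite ?C"
    by (rule finite_subset[rotated]; blast)+
  have "{T. T \<subseteq> S \<union> S' \<and> T \<noteq> {} \<and> P T} = (?A \<union> ?B) \<union> ?C"
  proof (intro set_eqI iffI)
    fix T assume T: "T \<in> {T. T \<subseteq> S \<union> S' \<and> T \<noteq> {} \<and> P T}"
    have d: "T = (T \<inter> S) \<union> (T \<inter> S')" using T by blast
    show "T \<in> (?A \<union> ?B) \<union> ?C"
    proof (cases "T \<inter> S = {} \<or> T \<inter> S' = {}")
      case True
      then show ?thesis using T by blast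
    next
      case False
      then have "(T \<inter> S, T \<inter> S') \<in> R" using P[of "T \<inter> S" "T \<inter> S'"] T d by auto
      then have "T \<in> ?C" using False d by blast
      then show ?thesis by simp
    qed
  next
    fix T assume "T \<in> (?A \<union> ?B) \<union> ?C"
    then show "T \<in> {T. T \<subseteq> S \<union> S' \<and> T \<noteq> {} \<and> P T}" using P by auto
  qed
  moreover have "?A \<inter> ?B = {}" "(?A \<union> ?B) \<inter> ?C = {}" using assms(3) by blast+
  ultimately show ?thesis using f by (simp add: gen_poly_Un)
qed

lemma single_poly_Un:
  assumes "finite S" "finite S'" "S \<inter> S' = {}"
  shows "single_poly (S \<union> S') = single_poly S + single_poly S'"
proof -
  have "{T. T \<subseteq> S \<union> S' \<and> card T = 1} = {T. T \<subseteq> S \<and> card T = 1} \<union> {T. T \<subseteq> S' \<and> card T = 1}"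
    by (auto simp: card_1_singleton_iff)
  moreover have "{T. T \<subseteq> S \<and> card T = 1} \<inter> {T. T \<subseteq> S' \<and> card T = 1} = {}"
    using assms(3) by (auto simp: card_1_singleton_iff)
  moreover have "finite {T. T \<subseteq> S \<and> card T = 1}" "finite {T. T \<subseteq> S' \<and> card T = 1}"
    using assms by auto
  ultimately show ?thesis unfolding single_poly_def by (simp add: gen_poly_Un)
qed

lemma polys_union:
  assumes fin: "finite S" "finite S'" and dis: "S \<inter> S' = {}"
    and sep: "\<And>a b. a \<in> S \<Longrightarrow> b \<in> S' \<Longrightarrow> {a, b} \<notin> E"
  shows "acyc_poly E (S \<union> S') = acyc_poly E S + acyc_poly E S' + acyc_poly E S * acyc_poly E S'"
    and "indep_poly E (S \<union> S') = indep_poly E S + indep_poly E S' + indep_poly E S * indep_poly E S'"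
proof -
  let ?A = "\<lambda>S. {T. T \<subseteq> S \<and> T \<noteq> {} \<and> acyc E T}"
  have "gen_poly {T \<union> T' | T T'. T \<in> ?A S \<and> T' \<in> ?A S'} = gen_poly (?A S) * gen_poly (?A S')"
    using gen_poly_product[of "?A S" S "?A S'" S'] fin dis by blast
  moreover have "{T \<union> T' | T T'. T \<in> ?A S \<and> T' \<in> ?A S'} = {T \<union> T' | T T'. T \<subseteq> S \<and> T' \<subseteq> S' \<and>
      T \<noteq> {} \<and> T' \<noteq> {} \<and> (T, T') \<in> {(T, T'). acyc E T \<and> acyc E T'}}"
    by auto
  ultimately show "acyc_poly E (S \<union> S') = acyc_poly E S + acyc_poly E S' + acyc_poly E S * acyc_poly E S'"
    unfolding acyc_poly_def
    using gen_poly_split[OF fin dis, of "acyc E" "{(T, T'). acyc E T \<and> acyc E T'}"]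
      acyc_Un[OF sep] by simp
  let ?A = "\<lambda>S. {T. T \<subseteq> S \<and> T \<noteq> {} \<and> indep E T}"
  have "gen_poly {T \<union> T' | T T'. T \<in> ?A S \<and> T' \<in> ?A S'} = gen_poly (?A S) * gen_poly (?A S')"
    using gen_poly_product[of "?A S" S "?A S'" S'] fin dis by blast
  moreover have "{T \<union> T' | T T'. T \<in> ?A S \<and> T' \<in> ?A S'} = {T \<union> T' | T T'. T \<subseteq> S \<and> T' \<subseteq> S' \<and>
      T \<noteq> {} \<and> T' \<noteq> {} \<and> (T, T') \<in> {(T, T'). indep E T \<and> indep E T'}}"
    by auto
  moreover have "indep E (T \<union> T') \<longleftrightarrow> indep E T \<and> indep E T'" if "T \<subseteq> S" "T' \<subseteq> S'" for T T'
  proof -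
    have "{a, b} \<notin> E" "{b, a} \<notin> E" if "a \<in> T" "b \<in> T'" for a b
      using sep[of a b] that \<open>T \<subseteq> S\<close> \<open>T' \<subseteq> S'\<close> by (auto simp: insert_commute)
    then show ?thesis unfolding indep_def by blast
  qed
  ultimately show "indep_poly E (S \<union> S') = indep_poly E S + indep_poly E S' + indep_poly E S * indep_poly E S'"
    unfolding indep_poly_def
    using gen_poly_split[OF fin dis, of "indep E" "{(T, T'). indep E T \<and> indep E T'}"]
    by simp
qed

subsection \<open>Joins\<close>

lemma is_cycle_triangle:
  assumes "a \<in> T" "b \<in> T" "c \<in> T" "a \<noteq> b" "b \<noteq> c" "a \<noteq> c" "{a, b} \<in> E" "{b, c} \<in> E" "{c, a} \<in> E"
  shows "is_cycle T (induced_edges E T) [a, b, c]"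
  using assms by (simp add: is_cycle_def induced_edges_def All_less_Suc)

lemma is_cycle_square:
  assumes "a \<in> T" "b \<in> T" "c \<in> T" "d \<in> T" "distinct [a, b, c, d]"
    "{a, b} \<in> E" "{b, c} \<in> E" "{c, d} \<in> E" "{d, a} \<in> E"
  shows "is_cycle T (induced_edges E T) [a, b, c, d]"
  using assms by (simp add: is_cycle_def induced_edges_def All_less_Suc)

text \<open>The edges of a cycle have no common vertex: two consecutive ones share only one vertex, and the
  third one avoids it.\<close>

lemma acyc_star:
  assumes star: "\<And>b c. b \<in> T \<Longrightarrow> c \<in> T \<Longrightarrow> {b, c} \<in> E \<Longrightarrow> b = a \<or> c = a"
  shows "acyc E T"
proof -
  have False if c: "is_cycle T (induced_edges E T) vs" for vs
  proof -
    let ?n = "length vs"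
    have n: "?n \<ge> 3" "distinct vs" using c by (auto simp: is_cycle_def)
    have e: "vs ! i = a \<or> vs ! (Suc i mod ?n) = a" if "i < ?n" for i
    proof (rule star)
      show "{vs ! i, vs ! (Suc i mod ?n)} \<in> E"
        using c that by (auto simp: is_cycle_def induced_edges_def)
      show "vs ! i \<in> T" "vs ! (Suc i mod ?n) \<in> T"
        using c that by (auto simp: is_cycle_def induced_edges_def)
    qed
    define k where "k = 3 mod ?n"
    have k: "k \<noteq> 1" "k < ?n"
    proof -
      have "?n = 3 \<or> ?n > 3" using n by linarith
      then show "k \<noteq> 1" "k < ?n" unfolding k_def by auto
    qed
    have lt: "0 < ?n" "1 < ?n" "2 < ?n" using n by linarith+
    have "Suc 0 mod ?n = 1" "Suc 1 mod ?n = 2" "Suc 2 mod ?n = k"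
      unfolding k_def using lt by simp_all
    then have a: "vs ! 0 = a \<or> vs ! 1 = a" "vs ! 1 = a \<or> vs ! 2 = a" "vs ! 2 = a \<or> vs ! k = a"
      using e[OF lt(1)] e[OF lt(2)] e[OF lt(3)] by (simp_all only:)
    have "vs ! 0 \<noteq> vs ! 2" "vs ! 1 \<noteq> vs ! 2" "vs ! 1 \<noteq> vs ! k"
      using nth_eq_iff_index_eq[OF n(2)] lt k by simp_all
    then show False using a by metis
  qed
  then show ?thesis unfolding acyc_def acyclic_graph_def by blast
qed

lemma acyc_join:
  assumes J: "\<And>a b. a \<in> S \<Longrightarrow> b \<in> S' \<Longrightarrow> {a, b} \<in> E" and dis: "S \<inter> S' = {}"
    and loop: "\<And>a. {a} \<notin> E"
    and T: "T \<subseteq> S" "T' \<subseteq> S'" "T \<noteq> {}" "T' \<noteq> {}" "finite T" "finite T'"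
  shows "acyc E (T \<union> T') \<longleftrightarrow> card T = 1 \<and> indep E T' \<or> card T' = 1 \<and> indep E T"
proof
  assume ac: "acyc E (T \<union> T')"
  then have nc: "\<not> is_cycle (T \<union> T') (induced_edges E (T \<union> T')) vs" for vs
    unfolding acyc_def acyclic_graph_def by blast
  have J': "{b, a} \<in> E" if "a \<in> S" "b \<in> S'" for a b using J[OF that] by (simp add: insert_commute)
  have "indep E T"
    unfolding indep_def
  proof (intro ballI notI)
    fix a b assume ab: "a \<in> T" "b \<in> T" "{a, b} \<in> E"
    obtain c where c: "c \<in> T'" using T by blast
    have "a \<noteq> b" using loop ab by auto
    then show False
      using is_cycle_triangle[of a "T \<union> T'" b c E] nc ab c J[of b c] J'[of a c] T dis by auto
  qed
  moreover have "indep E T'"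
    unfolding indep_def
  proof (intro ballI notI)
    fix a b assume ab: "a \<in> T'" "b \<in> T'" "{a, b} \<in> E"
    obtain c where c: "c \<in> T" using T by blast
    have "a \<noteq> b" using loop ab by auto
    then show False
      using is_cycle_triangle[of a "T \<union> T'" b c E] nc ab c J[of c a] J'[of c b] T dis by auto
  qed
  moreover have "card T = 1 \<or> card T' = 1"
  proof (rule ccontr)
    assume n: "\<not> ?thesis"
    have two: "\<exists>a b. a \<in> W \<and> b \<in> W \<and> a \<noteq> b" if "W \<noteq> {}" "card W \<noteq> 1" for W :: "'a set"
      using that by (metis is_singletonI' is_singleton_altdef)
    obtain a b where ab: "a \<in> T" "b \<in> T" "a \<noteq> b" using two[of T] n T by blast
    obtain c d where cd: "c \<in> T'" "d \<in> T'" "c \<noteq> d" using two[of T'] n T by blast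
    have "distinct [a, c, b, d]" using ab cd T dis by auto
    then show False
      using is_cycle_square[of a "T \<union> T'" c b d E] nc ab cd J[of a c] J[of b d] J'[of a d] J'[of b c] T
      by auto
  qed
  ultimately show "card T = 1 \<and> indep E T' \<or> card T' = 1 \<and> indep E T" by blast
next
  assume "card T = 1 \<and> indep E T' \<or> card T' = 1 \<and> indep E T"
  then show "acyc E (T \<union> T')"
  proof
    assume *: "card T = 1 \<and> indep E T'"
    then obtain a where "T = {a}" by (auto simp: card_1_singleton_iff)
    with * show ?thesis by (intro acyc_star[of _ _ a]) (auto simp: indep_def)
  next
    assume *: "card T' = 1 \<and> indep E T"
    then obtain a where "T' = {a}" by (auto simp: card_1_singleton_iff)
    with * show ?thesis by (intro acyc_star[of _ _ a]) (auto simp: indep_def)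
  qed
qed

text \<open>The forests that meet both sides are counted by inclusion and exclusion: a vertex on the left
  with an independent set on the right, or the other way round, where a pair of vertices is of both
  kinds.\<close>

lemma polys_join:
  assumes fin: "finite S" "finite S'" and dis: "S \<inter> S' = {}"
    and J: "\<And>a b. a \<in> S \<Longrightarrow> b \<in> S' \<Longrightarrow> {a, b} \<in> E" and loop: "\<And>a. {a} \<notin> E"
  shows "acyc_poly E (S \<union> S') = acyc_poly E S + acyc_poly E S' + single_poly S * indep_poly E S' +
      single_poly S' * indep_poly E S - single_poly S * single_poly S'" (is ?acyc)
    and "indep_poly E (S \<union> S') = indep_poly E S + indep_poly E S'" (is ?indep)
proof -
  let ?I = "\<lambda>S. {T. T \<subseteq> S \<and> T \<noteq> {} \<and> indep E T}" and ?N = "\<lambda>S. {T::'a set. T \<subseteq> S \<and> card T = 1}"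
  let ?P = "\<lambda>\<F> \<G>. {T \<union> T' | T T'. T \<in> \<F> \<and> T' \<in> \<G>}"
  let ?R = "{(T, T'). card T = 1 \<and> indep E T' \<or> card T' = 1 \<and> indep E T}"
  let ?C = "{T \<union> T' | T T'. T \<subseteq> S \<and> T' \<subseteq> S' \<and> T \<noteq> {} \<and> T' \<noteq> {} \<and> (T, T') \<in> ?R}"
  have prod: "gen_poly (?P \<F> \<G>) = gen_poly \<F> * gen_poly \<G>"
    if "\<And>T. T \<in> \<F> \<Longrightarrow> T \<subseteq> S" "\<And>T. T \<in> \<G> \<Longrightarrow> T \<subseteq> S'" for \<F> \<G>
    using gen_poly_product[OF that dis fin] by simp
  have one: "indep E T \<and> T \<noteq> {}" if "card T = 1" for T
    using that loop by (auto simp: card_1_singleton_iff indep_def)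
  have finP: "finite (?P \<F> \<G>)" if "\<And>T. T \<in> \<F> \<Longrightarrow> T \<subseteq> S" "\<And>T. T \<in> \<G> \<Longrightarrow> T \<subseteq> S'" for \<F> \<G>
  proof (rule finite_subset)
    show "?P \<F> \<G> \<subseteq> Pow (S \<union> S')" using that by blast
  qed (use fin in simp)
  have C: "?C = ?P (?N S) (?I S') \<union> ?P (?I S) (?N S')"
  proof (intro set_eqI iffI)
    fix T assume "T \<in> ?C"
    then show "T \<in> ?P (?N S) (?I S') \<union> ?P (?I S) (?N S')" by blast
  next
    fix T assume "T \<in> ?P (?N S) (?I S') \<union> ?P (?I S) (?N S')"
    then obtain T1 T2 where T: "T = T1 \<union> T2" "T1 \<subseteq> S" "T2 \<subseteq> S'"
      "card T1 = 1 \<and> T2 \<noteq> {} \<and> indep E T2 \<or> card T2 = 1 \<and> T1 \<noteq> {} \<and> indep E T1" by blast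
    moreover from this have "T1 \<noteq> {}" "T2 \<noteq> {}" using one by metis+
    ultimately show "T \<in> ?C" by blast
  qed
  have N: "?P (?N S) (?I S') \<inter> ?P (?I S) (?N S') = ?P (?N S) (?N S')"
  proof (intro set_eqI iffI)
    fix T assume "T \<in> ?P (?N S) (?I S') \<inter> ?P (?I S) (?N S')"
    then obtain T1 T2 T3 T4 where T: "T = T1 \<union> T2" "T1 \<in> ?N S" "T2 \<in> ?I S'"
      "T = T3 \<union> T4" "T3 \<in> ?I S" "T4 \<in> ?N S'" by blast
    then have "T2 = T \<inter> S'" "T4 = T \<inter> S'" using dis by blast+
    then show "T \<in> ?P (?N S) (?N S')" using T by blast
  next
    fix T assume "T \<in> ?P (?N S) (?N S')"
    then obtain T1 T2 where T: "T = T1 \<union> T2" "T1 \<in> ?N S" "T2 \<in> ?N S'" by blast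
    moreover from this have "T1 \<in> ?I S" "T2 \<in> ?I S'" using one by simp_all
    ultimately show "T \<in> ?P (?N S) (?I S') \<inter> ?P (?I S) (?N S')" by blast
  qed
  have gC: "gen_poly ?C = gen_poly (?P (?N S) (?I S')) + gen_poly (?P (?I S) (?N S')) - gen_poly (?P (?N S) (?N S'))"
  proof -
    have "finite (?P (?N S) (?I S'))" by (rule finP) auto
    moreover have "finite (?P (?I S) (?N S'))" by (rule finP) auto
    ultimately have "gen_poly (?P (?N S) (?I S') \<union> ?P (?I S) (?N S')) + gen_poly (?P (?N S) (?I S') \<inter> ?P (?I S) (?N S'))
      = gen_poly (?P (?N S) (?I S')) + gen_poly (?P (?I S) (?N S'))"
      unfolding gen_poly_def by (rule sum.union_inter)
    then show ?thesis unfolding C N by (simp add: algebra_simps)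
  qed
  have p1: "gen_poly (?P (?N S) (?I S')) = gen_poly (?N S) * gen_poly (?I S')" by (rule prod) auto
  have p2: "gen_poly (?P (?I S) (?N S')) = gen_poly (?I S) * gen_poly (?N S')" by (rule prod) auto
  have p3: "gen_poly (?P (?N S) (?N S')) = gen_poly (?N S) * gen_poly (?N S')" by (rule prod) auto
  have a: "acyc E (T \<union> T') \<longleftrightarrow> (T, T') \<in> ?R" if "T \<subseteq> S" "T' \<subseteq> S'" "T \<noteq> {}" "T' \<noteq> {}" for T T'
    using acyc_join[OF J dis loop that] that fin finite_subset by auto
  show ?acyc
    using gen_poly_split[OF fin dis a] gC p1 p2 p3
    unfolding acyc_poly_def indep_poly_def single_poly_def by (simp add: algebra_simps)
  have i: "indep E (T \<union> T') \<longleftrightarrow> (T, T') \<in> {}" if TT: "T \<subseteq> S" "T' \<subseteq> S'" "T \<noteq> {}" "T' \<noteq> {}" for T T'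
  proof -
    obtain a b where "a \<in> T" "b \<in> T'" using TT by blast
    then show ?thesis using J TT unfolding indep_def by blast
  qed
  show ?indep
    using gen_poly_split[OF fin dis i] unfolding indep_poly_def by (simp add: gen_poly_def)
qed

lemma acyclic_poly_eq:
  assumes "simple_graph V E"
  shows "acyclic_poly V E = 1 + acyc_poly E V"
proof -
  have fin: "finite V" using assms by (simp add: simple_graph_def)
  let ?\<F> = "{T. T \<subseteq> V \<and> acyc E T}"
  have finF: "finite ?\<F>" using fin by auto
  have "acyclic_poly V E = (\<Sum>i\<le>card V. \<Sum>T\<in>{T\<in>?\<F>. card T = i}. monom 1 i)"
  proof -
    have "{T. T \<subseteq> V \<and> card T = i \<and> acyclic_graph T (induced_edges E T)} = {T \<in> ?\<F>. card T = i}" for i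
      unfolding acyc_def by blast
    then show ?thesis
      unfolding acyclic_poly_def acyclic_count_def by (simp add: of_nat_poly smult_monom)
  qed
  also have "\<dots> = (\<Sum>i\<le>card V. \<Sum>T\<in>{T\<in>?\<F>. card T = i}. monom 1 (card T))"
    by (intro sum.cong refl) auto
  also have "\<dots> = gen_poly ?\<F>"
    unfolding gen_poly_def using finF fin by (intro sum.group) (auto intro: card_mono)
  also have "?\<F> = {{}} \<union> {T. T \<subseteq> V \<and> T \<noteq> {} \<and> acyc E T}"
    using acyc_small[of "{}" E] by auto
  also have "gen_poly \<dots> = gen_poly {{} :: 'a set} + acyc_poly E V"
    unfolding acyc_poly_def by (rule gen_poly_Un) (use fin in auto)
  finally show ?thesis by (simp add: gen_poly_def)
qed

section \<open>Cotrees stored as parent pointers\<close>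

abbreviation kids :: "(nat \<Rightarrow> nat) \<Rightarrow> nat \<Rightarrow> nat set" where
  "kids par p \<equiv> {c. par c = p}"

text \<open>The tree is represented as in the memory of the machine: \<open>par\<close> gives the parent, \<open>lab\<close> is \<open>1\<close> for
  union nodes and \<open>2\<close> for join nodes, and each vertex is its own leaf.  The set \<open>L u\<close> of the leaves
  below \<open>u\<close> exists in the proof only; it turns statements about paths into statements about sets.  \<open>U\<close> is
  the set of nodes.  The root has the parent \<open>S\<close>, which is no node; this allows the
  program to treat the root like any other child.  Pointers of numbers that are no nodes may be
  arbitrary as long as they do not point to an inner node (\<open>kid\<close>).  While the tree is rebuilt there may
  be nodes with a single child and nodes with the same label as their parent; \<open>cotree\<close> below
  excludes both.\<close>

locale wtree =
  fixes E :: "nat set set" and X :: "nat set" and S :: nat and U :: "nat set"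
    and par :: "nat \<Rightarrow> nat" and lab :: "nat \<Rightarrow> nat" and L :: "nat \<Rightarrow> nat set" and r :: nat
  assumes finU: "finite U" and SU: "S \<notin> U" and XU: "X \<subseteq> U"
    and leaf: "v \<in> X \<Longrightarrow> L v = {v}"
    and lab: "u \<in> U - X \<Longrightarrow> lab u = 1 \<or> lab u = 2"
    and Lne: "u \<in> U \<Longrightarrow> L u \<noteq> {}" and LX: "u \<in> U \<Longrightarrow> L u \<subseteq> X"
    and rootU: "r \<in> U" and rootS: "par r = S" and rootL: "L r = X"
    and parU: "c \<in> U \<Longrightarrow> c \<noteq> r \<Longrightarrow> par c \<in> U - X"
    and kid: "par c \<in> U - X \<Longrightarrow> c \<in> U"
    and inner: "u \<in> U - X \<Longrightarrow> L u = (\<Union>c\<in>kids par u. L c)"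
    and disj: "par c \<in> U - X \<Longrightarrow> par c' = par c \<Longrightarrow> c \<noteq> c' \<Longrightarrow> L c \<inter> L c' = {}"
    and edge: "par c \<in> U - X \<Longrightarrow> par c' = par c \<Longrightarrow> c \<noteq> c' \<Longrightarrow> a \<in> L c \<Longrightarrow> b \<in> L c' \<Longrightarrow>
      {a, b} \<in> E \<longleftrightarrow> lab (par c) = 2"

text \<open>\<open>Z\<close> is the set of nodes on the path from \<open>z\<close> to the root.  It is described by local conditions
  because those are easy to maintain when nodes on the path are replaced.\<close>

definition branch :: "nat set \<Rightarrow> (nat \<Rightarrow> nat) \<Rightarrow> nat \<Rightarrow> nat \<Rightarrow> nat set \<Rightarrow> bool" where
  "branch U par r z Z \<longleftrightarrow> z \<in> Z \<and> Z \<subseteq> U \<and> r \<in> Z \<and>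
     (\<forall>c\<in>Z. c \<noteq> r \<longrightarrow> par c \<in> Z \<and> par c \<noteq> z) \<and>
     (\<forall>p\<in>Z. p \<noteq> z \<longrightarrow> (\<exists>c\<in>Z. c \<noteq> r \<and> par c = p)) \<and>
     (\<forall>c\<in>Z. \<forall>c'\<in>Z. par c = par c' \<longrightarrow> c = c')"

text \<open>Everything beside the path \<open>Z\<close> is adjacent to \<open>x\<close> or not as the label on the path says.  This is the
  condition for adding \<open>x\<close> below the bottom of the path.\<close>

definition attaches :: "nat set set \<Rightarrow> nat \<Rightarrow> (nat \<Rightarrow> nat) \<Rightarrow> (nat \<Rightarrow> nat) \<Rightarrow> (nat \<Rightarrow> nat set) \<Rightarrow> nat \<Rightarrow> nat set \<Rightarrow> bool" where
  "attaches E r par lab L x Z \<longleftrightarrow>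
     (\<forall>c\<in>Z. \<forall>c'. c \<noteq> r \<longrightarrow> par c' = par c \<longrightarrow> c' \<noteq> c \<longrightarrow> (\<forall>a\<in>L c'. {a, x} \<in> E \<longleftrightarrow> lab (par c) = 2))"

definition two_kids :: "(nat \<Rightarrow> nat) \<Rightarrow> nat \<Rightarrow> bool" where
  "two_kids par p \<longleftrightarrow> (\<exists>c c'. par c = p \<and> par c' = p \<and> c \<noteq> c')"

locale cotree = wtree +
  assumes two: "u \<in> U - X \<Longrightarrow> two_kids par u"
    and alt: "c \<in> U - X \<Longrightarrow> c \<noteq> r \<Longrightarrow> lab c \<noteq> lab (par c)"

subsection \<open>Elementary changes of the tree\<close>

context wtree
begin

lemma L_sub_par: "c \<in> U \<Longrightarrow> c \<noteq> r \<Longrightarrow> L c \<subseteq> L (par c)"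
  using inner[OF parU] by blast

lemma kids_sub: "p \<in> U - X \<Longrightarrow> kids par p \<subseteq> U"
  using kid by blast

lemma kids_ne: "p \<in> U - X \<Longrightarrow> kids par p \<noteq> {}"
  using inner[of p] Lne[of p] by auto

text \<open>The map \<open>f\<close> sends the new node to \<open>z\<close>, whose place it takes among the siblings; so the conditions on
  siblings carry over from the old tree.\<close>

lemma subdivide:
  assumes z: "z \<in> U" and w: "w \<notin> U" "w \<noteq> S" "\<And>c. par c \<noteq> w" "l = 1 \<or> l = 2"
  shows "wtree E X S (insert w U) (par(w := par z, z := w)) (lab(w := l)) (L(w := L z))
    (if z = r then w else r)" (is "wtree E X S ?U ?par ?lab ?L ?r")
proof -
  have wX: "w \<notin> X" using w XU by blast
  have wz: "w \<noteq> z" using w z by blast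
  define f where "f c = (if c = w then z else c)" for c
  have f: "?par c = par (f c)" "?L c = L (f c)" if "c \<noteq> z" for c
    using that wz by (auto simp: f_def)
  have finj: "f c = f c' \<Longrightarrow> c = c'" if "c \<noteq> z" "c' \<noteq> z" for c c'
    using that by (auto simp: f_def split: if_splits)
  have parw: "?par c = w \<longleftrightarrow> c = z" for c using w(3) wz by auto
  have pU: "p \<in> U - X" if "p \<in> ?U - X" "p \<noteq> w" for p using that by blast
  show ?thesis
  proof
    fix u assume u: "u \<in> ?U - X"
    show "?L u = (\<Union>c\<in>kids ?par u. ?L c)"
    proof (cases "u = w")
      case True
      then have "kids ?par u = {z}" using parw by auto
      then show ?thesis using True by simp
    next
      case False
      then have u': "u \<in> U - X" using u by blast
      have "(\<Union>c\<in>kids ?par u. ?L c) = (\<Union>c\<in>kids par u. L c)"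
      proof (intro equalityI subsetI)
        fix a assume "a \<in> (\<Union>c\<in>kids ?par u. ?L c)"
        then obtain c where c: "?par c = u" "a \<in> ?L c" by blast
        then have "c \<noteq> z" using False wz by auto
        then have "par (f c) = u" "a \<in> L (f c)" using c f by simp_all
        then show "a \<in> (\<Union>c\<in>kids par u. L c)" by blast
      next
        fix a assume "a \<in> (\<Union>c\<in>kids par u. L c)"
        then obtain c where c: "par c = u" "a \<in> L c" by blast
        then have "c \<noteq> w" using w kid u' by blast
        show "a \<in> (\<Union>c\<in>kids ?par u. ?L c)"
        proof (cases "c = z")
          case True
          then have "?par w = u" "a \<in> ?L w" using c wz by auto
          then show ?thesis by blast
        next
          case False
          then have "?par c = u" "a \<in> ?L c" using c \<open>c \<noteq> w\<close> by auto
          then show ?thesis by blast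
        qed
      qed
      then show ?thesis using False inner[OF u'] by simp
    qed
  next
    fix c c' assume *: "?par c \<in> ?U - X" "?par c' = ?par c" "c \<noteq> c'"
    then have "?par c \<noteq> w" using parw by metis
    then have "c \<noteq> z" "c' \<noteq> z" using * parw by metis+
    then show "?L c \<inter> ?L c' = {}"
      using * f finj disj[of "f c" "f c'"] \<open>?par c \<noteq> w\<close> pU by metis
  next
    fix c c' a b assume *: "?par c \<in> ?U - X" "?par c' = ?par c" "c \<noteq> c'" "a \<in> ?L c" "b \<in> ?L c'"
    then have "?par c \<noteq> w" using parw by metis
    then have "c \<noteq> z" "c' \<noteq> z" using * parw by metis+
    moreover have "?lab (?par c) = lab (?par c)" using \<open>?par c \<noteq> w\<close> by simp
    ultimately show "{a, b} \<in> E \<longleftrightarrow> ?lab (?par c) = 2"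
      using * f finj edge[of "f c" "f c'" a b] \<open>?par c \<noteq> w\<close> pU by metis
  next
    fix c assume "c \<in> ?U" "c \<noteq> ?r"
    then show "?par c \<in> ?U - X" using parU[of c] parU[of z] z wX by (auto split: if_splits)
  next
    fix c assume "c \<in> ?U"
    then show "?L c \<subseteq> X" using LX[of c] LX[OF z] w(1) by auto
  next
    fix c assume "?par c \<in> ?U - X"
    then show "c \<in> ?U" using kid[of c] w(3) z by (auto split: if_splits)
  qed (use finU SU XU leaf lab Lne rootU rootS rootL z w wX in \<open>auto split: if_splits\<close>)
qed

text \<open>Children may move up to a parent with the same label, because the label decides adjacency
  in the same way there.\<close>

lemma promote:
  assumes u: "u \<in> U - X" "u \<noteq> r" and l: "lab (par u) = lab u"
    and F: "F \<subseteq> kids par u" "F \<noteq> kids par u" and pu: "par u \<noteq> u" "u \<notin> F"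
  shows "wtree E X S U (\<lambda>c. if c \<in> F then par u else par c) lab (L(u := \<Union>c\<in>kids par u - F. L c)) r"
    (is "wtree E X S U ?par lab ?L r")
proof -
  have pU: "par u \<in> U - X" by (rule parU) (use u in auto)
  have FU: "F \<subseteq> U" using F(1) kids_sub[OF u(1)] by (rule order_trans)
  have Lu: "L u = ?L u \<union> (\<Union>c\<in>F. L c)"
    using inner[OF u(1)] F unfolding fun_upd_same by blast
  have Lsub: "?L c \<subseteq> L c" for c using Lu by auto
  have kidu: "par c = u \<Longrightarrow> c \<noteq> u" for c using pu by blast
  have rF: "r \<notin> F" using F rootS u SU by auto
  show ?thesis
  proof
    fix p assume p: "p \<in> U - X"
    show "?L p = (\<Union>c\<in>kids ?par p. ?L c)"
    proof (cases "p = u")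
      case True
      then have "kids ?par p = kids par u - F" using pu by auto
      moreover have "(\<Union>c\<in>kids par u - F. ?L c) = (\<Union>c\<in>kids par u - F. L c)"
        using kidu by (intro SUP_cong) auto
      ultimately show ?thesis using True by simp
    next
      case False
      note pnu = this
      show ?thesis
      proof (cases "p = par u")
        case True
        then have k: "kids ?par p = kids par p \<union> F" using F pu by auto
        have "(\<Union>c\<in>kids par p \<union> F. ?L c) = (\<Union>c\<in>kids par p - {u}. ?L c) \<union> ?L u \<union> (\<Union>c\<in>F. ?L c)"
          using True by auto
        also have "\<dots> = (\<Union>c\<in>kids par p - {u}. L c) \<union> (?L u \<union> (\<Union>c\<in>F. L c))"
          using pu by (auto split: if_splits)
        also have "\<dots> = (\<Union>c\<in>kids par p. L c)" using Lu True by auto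
        finally show ?thesis using False inner[OF p] k by simp
      next
        case False
        then have "kids ?par p = kids par p" using pnu F by auto
        moreover have "(\<Union>c\<in>kids par p. ?L c) = (\<Union>c\<in>kids par p. L c)"
          using False by (intro SUP_cong) auto
        ultimately show ?thesis using pnu inner[OF p] by simp
      qed
    qed
  next
    fix c c' assume *: "?par c \<in> U - X" "?par c' = ?par c" "c \<noteq> c'"
    consider "c \<in> F" "c' \<in> F" | "c \<in> F" "c' \<notin> F" | "c \<notin> F" "c' \<in> F" | "c \<notin> F" "c' \<notin> F" by blast
    then show "?L c \<inter> ?L c' = {}"
    proof cases
      case 1
      then have "par c = u" "par c' = u" using F by auto
      then have "L c \<inter> L c' = {}" using disj[of c c'] u * by simp
      then show ?thesis using Lsub by blast
    next
      case 2
      then have p: "par c = u" "par c' = par u" using F * by auto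
      show ?thesis
      proof (cases "c' = u")
        case True
        have "L c \<inter> L d = {}" if "d \<in> kids par u - F" for d
          using disj[of c d] that 2 p u by auto
        then show ?thesis using True 2 pu by auto
      next
        case False
        then have "L u \<inter> L c' = {}" using disj[of u c'] p pU by auto
        moreover have "L c \<subseteq> L u" using p inner[OF u(1)] by blast
        ultimately show ?thesis using Lsub by blast
      qed
    next
      case 3
      then have p: "par c' = u" "par c = par u" using F * by auto
      show ?thesis
      proof (cases "c = u")
        case True
        have "L c' \<inter> L d = {}" if "d \<in> kids par u - F" for d
          using disj[of c' d] that 3 p u by auto
        then show ?thesis using True 3 pu by auto
      next
        case False
        then have "L u \<inter> L c = {}" using disj[of u c] p pU by auto
        moreover have "L c' \<subseteq> L u" using p inner[OF u(1)] by blast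
        ultimately show ?thesis using Lsub by blast
      qed
    next
      case 4
      then have "L c \<inter> L c' = {}" using disj[of c c'] * by simp
      then show ?thesis using Lsub by blast
    qed
  next
    fix c c' a b assume *: "?par c \<in> U - X" "?par c' = ?par c" "c \<noteq> c'" "a \<in> ?L c" "b \<in> ?L c'"
    consider "c \<in> F" "c' \<in> F" | "c \<in> F" "c' \<notin> F" | "c \<notin> F" "c' \<in> F" | "c \<notin> F" "c' \<notin> F" by blast
    then show "{a, b} \<in> E \<longleftrightarrow> lab (?par c) = 2"
    proof cases
      case 1
      then have p: "par c = u" "par c' = u" using F by auto
      have "a \<in> L c" "b \<in> L c'" using * Lsub by blast+
      then have "{a, b} \<in> E \<longleftrightarrow> lab u = 2" using edge[of c c' a b] u p *(3) by simp
      then show ?thesis using l 1 by simp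
    next
      case 2
      then have p: "par c = u" "par c' = par u" using F * by auto
      have ac: "a \<in> L c" using * Lsub by blast
      show ?thesis
      proof (cases "c' = u")
        case True
        then obtain d where "d \<in> kids par u - F" "b \<in> L d" using * by auto
        moreover from this have "c \<noteq> d" using 2 by blast
        ultimately show ?thesis using edge[of c d a b] 2 p u ac l by simp
      next
        case False
        have "L c \<subseteq> L u" using p(1) inner[OF u(1)] by blast
        then have "a \<in> L u" using ac by blast
        moreover have "b \<in> L c'" using *(5) Lsub by blast
        ultimately have "{a, b} \<in> E \<longleftrightarrow> lab (par u) = 2" using edge[OF pU p(2)] False by blast
        then show ?thesis using 2 by simp
      qed
    next
      case 3
      then have p: "par c' = u" "par c = par u" using F * by auto
      have bc: "b \<in> L c'" using * Lsub by blast
      show ?thesis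
      proof (cases "c = u")
        case True
        then obtain d where "d \<in> kids par u - F" "a \<in> L d" using * by auto
        moreover from this have "d \<noteq> c'" using 3 by blast
        ultimately show ?thesis using edge[of d c' a b] 3 p u bc l by simp
      next
        case False
        have "L c' \<subseteq> L u" using p(1) inner[OF u(1)] by blast
        then have "b \<in> L u" using bc by blast
        moreover have "a \<in> L c" using *(4) Lsub by blast
        moreover have "par c \<in> U - X" "par u = par c" using p(2) pU by simp_all
        ultimately have "{a, b} \<in> E \<longleftrightarrow> lab (par c) = 2" using False edge by blast
        then show ?thesis using 3 by simp
      qed
    next
      case 4
      then have eq: "?par c = par c" "?par c' = par c'" by simp_all
      have "a \<in> L c" "b \<in> L c'" using Lsub * by blast+
      then show ?thesis using edge[of c c' a b] *(1-3) unfolding eq by blast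
    qed
  next
    fix c assume "c \<in> U" "c \<noteq> r"
    then show "?par c \<in> U - X" using pU parU by auto
  next
    fix c assume "?par c \<in> U - X"
    then show "c \<in> U" using kid FU by (auto split: if_splits)
  next
    fix c assume c: "c \<in> U"
    show "?L c \<noteq> {}"
    proof (cases "c = u")
      case True
      obtain d where d: "d \<in> kids par u - F" using F by blast
      then have "L d \<noteq> {}" using Lne kid u by blast
      then show ?thesis using True d by auto
    qed (use c Lne in simp)
    show "?L c \<subseteq> X" using LX[OF c] Lsub by blast
  qed (use finU SU XU leaf lab rootU rootS rootL u rF in auto)
qed

text \<open>In this way the part of a union node that \<open>x\<close> is going to be joined with becomes a node of its own.\<close>

lemma split_below:
  assumes u: "u \<in> U - X" and v: "v \<notin> U" "v \<noteq> S" "\<And>c. par c \<noteq> v"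
    and F: "F \<subseteq> kids par u" "F \<noteq> {}" and pu: "u \<notin> F"
  shows "wtree E X S (insert v U) (\<lambda>c. if c \<in> F then v else if c = v then u else par c)
    (lab(v := lab u)) (L(v := \<Union>c\<in>F. L c)) r" (is "wtree E X S ?U ?par ?lab ?L r")
proof -
  have FU: "F \<subseteq> U" using F(1) kids_sub[OF u] by (rule order_trans)
  have vF: "v \<notin> F" using FU v by blast
  have vX: "v \<notin> X" using XU v by blast
  have vu: "v \<noteq> u" using u v by blast
  have rF: "r \<notin> F" "r \<noteq> v" using F rootS rootU u SU v by auto
  have Lv: "?L v \<subseteq> L u" using inner[OF u] F by auto
  have parv: "?par c = v \<longleftrightarrow> c \<in> F" for c using v(3) vu by auto
  have LcU: "?L c = L c" if "c \<noteq> v" for c using that by simp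
  have parc: "?par c = par c" if "c \<notin> F" "c \<noteq> v" for c using that by simp
  show ?thesis
  proof
    fix p assume p: "p \<in> ?U - X"
    show "?L p = (\<Union>c\<in>kids ?par p. ?L c)"
    proof (cases "p = v")
      case True
      then have "kids ?par p = F" using parv by auto
      moreover have "(\<Union>c\<in>F. ?L c) = (\<Union>c\<in>F. L c)" using vF by (intro SUP_cong) auto
      ultimately show ?thesis using True by simp
    next
      case False
      then have p': "p \<in> U - X" using p by blast
      show ?thesis
      proof (cases "p = u")
        case True
        then have "kids ?par p = insert v (kids par u - F)"
          using vu vF v kid[of v] u by auto
        moreover have "(\<Union>c\<in>insert v (kids par u - F). ?L c) = (\<Union>c\<in>F. L c) \<union> (\<Union>c\<in>kids par u - F. L c)"
          using v kid[of v] u by (auto split: if_splits)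
        moreover have "\<dots> = (\<Union>c\<in>kids par u. L c)" using F by auto
        ultimately show ?thesis using True False inner[OF u] by simp
      next
        case pu: False
        have "kids ?par p = kids par p"
          using False pu F v kid[of v] p' by (auto split: if_splits)
        moreover have "v \<notin> kids par p" using kid[of v] p' v by auto
        ultimately show ?thesis using False inner[OF p'] by auto
      qed
    qed
  next
    fix c c' assume *: "?par c \<in> ?U - X" "?par c' = ?par c" "c \<noteq> c'"
    consider "c \<in> F" "c' \<in> F" | "c = v" "c' \<noteq> v" "c' \<notin> F" "par c' = u" | "c' = v" "c \<noteq> v" "c \<notin> F" "par c = u"
      | "c \<noteq> v" "c' \<noteq> v" "c \<notin> F" "c' \<notin> F"
      using * parv vF vu v(3) by metis
    then show "?L c \<inter> ?L c' = {}"
    proof cases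
      case 1
      then show ?thesis using disj[of c c'] F u * vF by (auto split: if_splits)
    next
      case 2
      have "L c' \<inter> L d = {}" if "d \<in> F" for d using disj[of c' d] 2 u F that by auto
      then show ?thesis using 2 by auto
    next
      case 3
      have "L c \<inter> L d = {}" if "d \<in> F" for d using disj[of c d] 3 u F that by auto
      then show ?thesis using 3 by auto
    next
      case 4
      then show ?thesis using disj[of c c'] * v(3) by auto
    qed
  next
    fix c c' a b assume *: "?par c \<in> ?U - X" "?par c' = ?par c" "c \<noteq> c'" "a \<in> ?L c" "b \<in> ?L c'"
    consider "c \<in> F" "c' \<in> F" | "c = v" "c' \<noteq> v" "c' \<notin> F" "par c' = u" | "c' = v" "c \<noteq> v" "c \<notin> F" "par c = u"
      | "c \<noteq> v" "c' \<noteq> v" "c \<notin> F" "c' \<notin> F"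
      using * parv vF vu v(3) by metis
    then show "{a, b} \<in> E \<longleftrightarrow> ?lab (?par c) = 2"
    proof cases
      case 1
      then have "c \<noteq> v" "c' \<noteq> v" using vF by auto
      then show ?thesis using edge[of c c' a b] F u * 1 by auto
    next
      case 2
      then obtain d where d: "d \<in> F" "a \<in> L d" using * by auto
      have d': "par d = u" "d \<noteq> c'" using d F 2 by blast+
      have "b \<in> L c'" using 2 * by simp
      then have "{a, b} \<in> E \<longleftrightarrow> lab u = 2" using edge[of d c' a b] d d' 2 u by simp
      moreover have "?lab (?par c) = lab u" using 2 vu vF by simp
      ultimately show ?thesis by simp
    next
      case 3
      then obtain d where d: "d \<in> F" "b \<in> L d" using * by auto
      have d': "par d = u" "d \<noteq> c" using d F 3 by blast+
      have "a \<in> L c" using 3 * by simp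
      then have "{a, b} \<in> E \<longleftrightarrow> lab u = 2" using edge[of c d a b] d d' 3 u by simp
      moreover have "?lab (?par c) = lab u" using 3 vu vF by simp
      ultimately show ?thesis by simp
    next
      case 4
      then show ?thesis using edge[of c c' a b] * v(3) by auto
    qed
  next
    fix c assume "c \<in> ?U" "c \<noteq> r"
    then show "?par c \<in> ?U - X" using parU[of c] u vX by auto
  next
    fix c assume "?par c \<in> ?U - X"
    then show "c \<in> ?U" using kid[of c] FU v(3) by (auto split: if_splits)
  next
    fix c assume c: "c \<in> ?U"
    show "?L c \<noteq> {}"
    proof (cases "c = v")
      case True
      obtain d where d: "d \<in> F" using F by blast
      then have "L d \<noteq> {}" using Lne FU by blast
      then show ?thesis using True d by auto
    qed (use c Lne in simp)
    show "?L c \<subseteq> X" using LX[of c] LX[of u] u c Lv by (cases "c = v") auto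
  qed (use finU SU XU leaf lab rootU rootS rootL u rF v vF vX in auto)
qed

text \<open>The inverse of \<open>subdivide\<close>.  The pointer of the deleted node is set to a leaf \<open>o'\<close>, so that it no
  longer counts as a child of an inner node.\<close>

lemma unwrap:
  assumes A: "A \<in> U - X" "A \<noteq> r" "kids par A = {z}" "z \<noteq> A" and o: "o' \<in> X"
  shows "wtree E X S (U - {A}) (par(A := o', z := par A)) lab L r" (is "wtree E X S ?U ?par lab L r")
proof -
  have pA: "par A \<in> U - X" by (rule parU) (use A in auto)
  have pz: "par z = A" using A(3) by blast
  then have zU: "z \<in> U" using A(1) kid[of z] by blast
  have pAA: "par A \<noteq> A" using A by auto
  have LA: "L A = L z" using inner[OF A(1)] A(3) by simp
  have kz: "par c = A \<longleftrightarrow> c = z" for c using A(3) by auto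
  have zr: "z \<noteq> r" using pz A rootS SU by auto
  have oX: "o' \<notin> ?U - X" using o by blast
  define f where "f c = (if c = z then A else c)" for c
  have f: "?par c = par (f c)" "L c = L (f c)" if "c \<noteq> A" for c
    using that LA A(4) by (auto simp: f_def)
  have finj: "f c = f c' \<Longrightarrow> c = c'" if "c \<noteq> A" "c' \<noteq> A" for c c'
    using that by (auto simp: f_def split: if_splits)
  have notA: "c \<noteq> A" if "?par c \<in> ?U - X" for c
    using that o A(4) by (auto split: if_splits)
  have pU: "p \<in> U - X" if "p \<in> ?U - X" for p using that by blast
  show ?thesis
  proof
    fix u assume u: "u \<in> ?U - X"
    have u': "u \<in> U - X" using u by blast
    have "(\<Union>c\<in>kids ?par u. L c) = (\<Union>c\<in>kids par u. L c)"
    proof (intro equalityI subsetI)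
      fix a assume "a \<in> (\<Union>c\<in>kids ?par u. L c)"
      then obtain c where c: "?par c = u" "a \<in> L c" by blast
      then have "c \<noteq> A" using notA u by blast
      then have "par (f c) = u" "a \<in> L (f c)" using c f by auto
      then show "a \<in> (\<Union>c\<in>kids par u. L c)" by blast
    next
      fix a assume "a \<in> (\<Union>c\<in>kids par u. L c)"
      then obtain c where c: "par c = u" "a \<in> L c" by blast
      show "a \<in> (\<Union>c\<in>kids ?par u. L c)"
      proof (cases "c = A")
        case True
        then have "?par z = u" "a \<in> L z" using c LA by auto
        then show ?thesis by blast
      next
        case False
        moreover have "c \<noteq> z" using c u pz by auto
        ultimately have "?par c = u" "a \<in> L c" using c by auto
        then show ?thesis by blast
      qed
    qed
    then show "L u = (\<Union>c\<in>kids ?par u. L c)" using inner[OF u'] by simp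
  next
    fix c c' assume *: "?par c \<in> ?U - X" "?par c' = ?par c" "c \<noteq> c'"
    then have "c \<noteq> A" "c' \<noteq> A" using notA by metis+
    then show "L c \<inter> L c' = {}" using * f finj disj[of "f c" "f c'"] pU by metis
  next
    fix c c' a b assume *: "?par c \<in> ?U - X" "?par c' = ?par c" "c \<noteq> c'" "a \<in> L c" "b \<in> L c'"
    then have "c \<noteq> A" "c' \<noteq> A" using notA by metis+
    then show "{a, b} \<in> E \<longleftrightarrow> lab (?par c) = 2"
      using * f finj edge[of "f c" "f c'" a b] pU by metis
  next
    fix c assume c: "c \<in> ?U" "c \<noteq> r"
    show "?par c \<in> ?U - X"
    proof (cases "c = z")
      case True
      then show ?thesis using pA pAA by auto
    next
      case False
      then show ?thesis using c parU[of c] kz[of c] by auto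
    qed
  next
    fix c assume "?par c \<in> ?U - X"
    then show "c \<in> ?U" using kid[of c] notA[of c] zU by (auto split: if_splits)
  qed (use finU SU XU leaf lab Lne LX rootU rootS rootL A zr in auto)
qed

text \<open>The leaf sets along the path to the root grow by \<open>x\<close>.  By \<open>attaches\<close>, the labels on the path are
  right about the new pairs of leaves.\<close>

lemma add_leaf:
  assumes x: "x \<notin> U" "x \<noteq> S" "\<And>c. par c \<noteq> x" and z: "z \<in> U - X" and br: "branch U par r z Z"
    and at: "attaches E r par lab L x Z" and zx: "\<And>a. a \<in> L z \<Longrightarrow> {a, x} \<in> E \<longleftrightarrow> lab z = 2"
  shows "wtree E (insert x X) S (insert x U) (par(x := z)) lab
    (\<lambda>c. if c = x then {x} else if c \<in> Z then insert x (L c) else L c) r"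
    (is "wtree E ?X S ?U ?par lab ?L r")
proof -
  have ZU: "Z \<subseteq> U" "z \<in> Z" "r \<in> Z" using br by (auto simp: branch_def)
  have xZ: "x \<notin> Z" "x \<noteq> z" "x \<noteq> r" using x ZU rootU z by auto
  have Zpar: "par c \<in> Z \<and> par c \<noteq> z" if "c \<in> Z" "c \<noteq> r" for c using br that by (auto simp: branch_def)
  have Zkid: "\<exists>c\<in>Z. c \<noteq> r \<and> par c = p" if "p \<in> Z" "p \<noteq> z" for p
    using br that unfolding branch_def by blast
  have Zuniq: "c = c'" if "c \<in> Z" "c' \<in> Z" "par c = par c'" for c c' using br that by (auto simp: branch_def)
  have xL: "x \<notin> L c" if "c \<in> U" for c using LX[OF that] XU x by blast
  have innerU: "p \<in> ?U - ?X \<longleftrightarrow> p \<in> U - X" for p using x XU by auto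
  have Lz: "L c \<subseteq> L z" if "par c = z" for c using inner[OF z] that by blast
  show ?thesis
  proof
    fix p assume "p \<in> ?U - ?X"
    then have p: "p \<in> U - X" using innerU by blast
    then have px: "p \<noteq> x" using x by blast
    have kx: "x \<notin> kids par p" using kid[of x] x p by auto
    show "?L p = (\<Union>c\<in>kids ?par p. ?L c)"
    proof (cases "p = z")
      case True
      then have k: "kids ?par p = insert x (kids par p)" using kx by auto
      have "c \<notin> Z" if "c \<in> kids par p" for c
      proof
        assume "c \<in> Z"
        then have "c = r" using Zpar[of c] that True by auto
        then show False using that p rootS SU by auto
      qed
      moreover have "c \<noteq> x" if "c \<in> kids par p" for c using that kx by blast
      ultimately have "(\<Union>c\<in>kids par p. ?L c) = (\<Union>c\<in>kids par p. L c)"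
        by (intro SUP_cong refl) simp
      then have "(\<Union>c\<in>insert x (kids par p). ?L c) = insert x (\<Union>c\<in>kids par p. L c)"
        by (simp only: UN_insert if_True) simp
      then show ?thesis using True k ZU inner[OF p] px by simp
    next
      case False
      then have k: "kids ?par p = kids par p" using kx by auto
      show ?thesis
      proof (cases "p \<in> Z")
        case True
        then obtain c where c: "c \<in> Z" "par c = p" using False Zkid by blast
        have "(\<Union>c\<in>kids par p. ?L c) = insert x (\<Union>c\<in>kids par p. L c)"
        proof (intro equalityI subsetI)
          fix a assume "a \<in> (\<Union>c\<in>kids par p. ?L c)"
          then obtain d where "par d = p" "a \<in> ?L d" by blast
          moreover have "d \<noteq> x" using kx calculation by blast
          ultimately have "a = x \<or> a \<in> L d" by (simp split: if_splits)
          then show "a \<in> insert x (\<Union>c\<in>kids par p. L c)" using \<open>par d = p\<close> by blast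
        next
          fix a assume "a \<in> insert x (\<Union>c\<in>kids par p. L c)"
          then consider "a = x" | d where "par d = p" "a \<in> L d" by blast
          then show "a \<in> (\<Union>c\<in>kids par p. ?L c)"
          proof cases
            case 1
            then have "a \<in> ?L c" using c by simp
            then show ?thesis using c by blast
          next
            case 2
            then have "a \<in> ?L d" using kx by auto
            then show ?thesis using 2 by blast
          qed
        qed
        then show ?thesis using True k inner[OF p] px by simp
      next
        case False
        have "c \<notin> Z" if "c \<in> kids par p" for c
          using Zpar[of c] that False rootS SU p by auto
        moreover have "c \<noteq> x" if "c \<in> kids par p" for c using that kx by blast
        ultimately have "(\<Union>c\<in>kids par p. ?L c) = (\<Union>c\<in>kids par p. L c)"
          by (intro SUP_cong refl) simp
        then show ?thesis using False k inner[OF p] px by simp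
      qed
    qed
  next
    fix c c' assume *: "?par c \<in> ?U - ?X" "?par c' = ?par c" "c \<noteq> c'"
    have p: "?par c \<in> U - X" using * innerU by blast
    consider "c = x" "c' \<noteq> x" "par c' = z" | "c' = x" "c \<noteq> x" "par c = z" | "c \<noteq> x" "c' \<noteq> x" "par c' = par c"
      using * by (auto split: if_splits)
    then show "?L c \<inter> ?L c' = {}"
    proof cases
      case 1
      have "c' \<notin> Z" using Zpar[of c'] 1 rootS SU z by auto
      moreover have "c' \<in> U" using 1 kid z by blast
      ultimately show ?thesis using 1 xL by auto
    next
      case 2
      have "c \<notin> Z" using Zpar[of c] 2 rootS SU z by auto
      moreover have "c \<in> U" using 2 kid z by blast
      ultimately show ?thesis using 2 xL by auto
    next
      case 3
      then have d: "L c \<inter> L c' = {}" using p * disj[of c c'] by auto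
      have "c \<in> U" "c' \<in> U" using kid 3 p by auto
      then show ?thesis using d Zuniq[of c c'] 3 * xL by auto
    qed
  next
    fix c c' a b assume *: "?par c \<in> ?U - ?X" "?par c' = ?par c" "c \<noteq> c'" "a \<in> ?L c" "b \<in> ?L c'"
    have p: "?par c \<in> U - X" using * innerU by blast
    consider "c = x" "c' \<noteq> x" "par c' = z" | "c' = x" "c \<noteq> x" "par c = z" | "c \<noteq> x" "c' \<noteq> x" "par c' = par c"
      using * by (auto split: if_splits)
    then show "{a, b} \<in> E \<longleftrightarrow> lab (?par c) = 2"
    proof cases
      case 1
      have "c' \<notin> Z" using Zpar[of c'] 1 rootS SU z by auto
      then have "a = x" "b \<in> L z" using 1 * Lz by auto
      then show ?thesis using zx 1 by (simp add: insert_commute)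
    next
      case 2
      have "c \<notin> Z" using Zpar[of c] 2 rootS SU z by auto
      then have "b = x" "a \<in> L z" using 2 * Lz by auto
      then show ?thesis using zx 2 by simp
    next
      case 3
      have cU: "c \<in> U" "c' \<in> U" using kid 3 p by auto
      have cr: "c \<noteq> r" "c' \<noteq> r" using 3 p rootS SU by auto
      have e: "par c \<in> U - X" using 3 p by simp
      have nz: "\<not> (c \<in> Z \<and> c' \<in> Z)" using Zuniq 3 * by blast
      consider "a = x" "c \<in> Z" | "b = x" "c' \<in> Z" | "a \<in> L c" "b \<in> L c'"
        using * 3 by (auto split: if_splits)
      then show ?thesis
      proof cases
        case 1
        then have "b \<in> L c'" using nz * 3 by auto
        then show ?thesis using at 1 cr 3 * unfolding attaches_def
          by (simp add: insert_commute)
      next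
        case 2
        then have "a \<in> L c" using nz * 3 by auto
        moreover have "par c = par c'" using 3 by simp
        ultimately show ?thesis using at 2 cr 3 * unfolding attaches_def by simp
      next
        case ab: 3
        then show ?thesis using edge[of c c' a b] e 3 * by simp
      qed
    qed
  next
    fix c assume c: "c \<in> ?U" "c \<noteq> r"
    then show "?par c \<in> ?U - ?X" using parU[of c] z x(1,3) by (auto simp: innerU xZ)
  next
    fix c assume "?par c \<in> ?U - ?X"
    then show "c \<in> ?U" using kid[of c] by (auto split: if_splits)
  next
    fix c assume c: "c \<in> ?U"
    show "?L c \<noteq> {}" using c Lne by auto
    show "?L c \<subseteq> ?X" using c LX by (auto split: if_splits)
  next
    fix v assume v: "v \<in> ?X"
    have "v \<notin> Z" if vX: "v \<in> X" "v \<in> Z"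
    proof (cases "v = z")
      case False
      then obtain c where "c \<in> Z" "c \<noteq> r" "par c = v" using Zkid[of v] vX by blast
      then show ?thesis using parU[of c] ZU vX by blast
    qed (use z vX in blast)
    then show "?L v = {v}" using v leaf by auto
  qed (use finU SU XU lab rootU rootS rootL x xZ ZU innerU in auto)
qed

end

subsection \<open>Proper cotrees\<close>

context cotree
begin

text \<open>A node has a sibling, and its leaves are missing below the node.  This strict growth towards the
  root replaces an explicit well-foundedness condition on the parent pointers.\<close>

lemma L_psub_par:
  assumes "c \<in> U" "c \<noteq> r" shows "L c \<subset> L (par c)"
proof -
  have p: "par c \<in> U - X" using parU assms by simp
  obtain d where d: "par d = par c" "d \<noteq> c" using two[OF p] unfolding two_kids_def by metis
  have "d \<in> U" using kid d p by simp
  then have "L d \<noteq> {}" "L c \<inter> L d = {}" using Lne disj[OF p, of d] d by auto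
  moreover have "L d \<subseteq> L (par c)" using inner[OF p] d by blast
  ultimately show ?thesis using L_sub_par[OF assms] by blast
qed

lemma finL: "c \<in> U \<Longrightarrow> finite (L c)"
  using LX XU finU by (meson finite_subset)

lemma card_L_par: "c \<in> U \<Longrightarrow> c \<noteq> r \<Longrightarrow> card (L c) < card (L (par c))"
  using L_psub_par finL parU by (intro psubset_card_mono) auto

lemma par_ne: "c \<in> U \<Longrightarrow> par c \<noteq> c"
  using L_psub_par[of c] rootS SU by (cases "c = r") auto

lemma two_card:
  assumes "p \<in> U - X" shows "2 \<le> card (kids par p)"
proof -
  obtain c c' where "par c = p" "par c' = p" "c \<noteq> c'" using two[OF assms] unfolding two_kids_def by blast
  then have "card {c, c'} \<le> card (kids par p)"
    by (intro card_mono finite_subset[OF kids_sub[OF assms] finU]) auto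
  then show ?thesis using \<open>c \<noteq> c'\<close> by simp
qed

text \<open>This is why no full node is missed: the final queue \<open>Q\<close> satisfies both conditions.\<close>

lemma marks_closed:
  assumes leaves: "N \<subseteq> Q" and up: "\<And>p. p \<in> U - X \<Longrightarrow> kids par p \<subseteq> Q \<Longrightarrow> p \<in> Q"
    and c: "c \<in> U" "L c \<subseteq> N"
  shows "c \<in> Q"
  using c
proof (induction "card (L c)" arbitrary: c rule: less_induct)
  case less
  show ?case
  proof (cases "c \<in> X")
    case True
    then show ?thesis using leaf less.prems leaves by auto
  next
    case False
    then have cU: "c \<in> U - X" using less.prems by blast
    have "d \<in> Q" if "par d = c" for d
    proof (rule less.hyps)
      show dU: "d \<in> U" using kid cU that by simp
      have "d \<noteq> r" using that rootS SU cU by auto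
      then show "card (L d) < card (L c)" using card_L_par dU that by blast
      show "L d \<subseteq> N" using inner[OF cU] that less.prems by blast
    qed
    then show ?thesis using up[OF cU] by blast
  qed
qed

text \<open>Full inner nodes have at least two children each, all of which are full; so they are at most half
  of the full nodes.\<close>

lemma card_full:
  assumes N: "N \<subseteq> X"
  shows "card {c \<in> U. L c \<subseteq> N} \<le> 2 * card N"
proof -
  let ?F = "{c \<in> U. L c \<subseteq> N}"
  have finX: "finite X" using XU finU finite_subset by blast
  have fin: "finite ?F" using finU by simp
  have F: "?F = (?F - X) \<union> N" "(?F - X) \<inter> N = {}" using N XU leaf by auto
  have "2 * card (?F - X) \<le> (\<Sum>p\<in>?F - X. card (kids par p))"
    using sum_mono[of "?F - X" "\<lambda>_. 2" "\<lambda>p. card (kids par p)"] two_card by auto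
  also have "\<dots> = card (\<Union>p\<in>?F - X. kids par p)"
  proof (rule card_UN_disjoint[symmetric])
    show "\<forall>i\<in>?F - X. finite (kids par i)" using kids_sub finU finite_subset by blast
  qed (use fin in auto)
  also have "\<dots> \<le> card ?F"
  proof (rule card_mono[OF fin], rule subsetI)
    fix c assume "c \<in> (\<Union>p\<in>?F - X. kids par p)"
    then obtain p where p: "p \<in> U - X" "L p \<subseteq> N" "par c = p" by blast
    then show "c \<in> ?F" using kid[of c] inner[of p] by blast
  qed
  also have "card ?F = card (?F - X) + card N"
    using card_Un_disjoint[OF _ _ F(2)] fin finite_subset[OF N finX] F(1) by simp
  finally show ?thesis using \<open>card ?F = card (?F - X) + card N\<close> by linarith
qed

end

definition mixed :: "nat set set \<Rightarrow> nat \<Rightarrow> nat set \<Rightarrow> bool" where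
  "mixed E x A \<longleftrightarrow> (\<exists>a\<in>A. {a, x} \<in> E) \<and> (\<exists>b\<in>A. {b, x} \<notin> E)"

locale cotree_insert = cotree +
  fixes V :: "nat set" and x :: nat
  assumes P4: "P4_free V E" and XV: "insert x X \<subseteq> V" and xX: "x \<notin> X"
begin

text \<open>Below the mixed node \<open>c\<close>, two different children contain a neighbour \<open>a\<close> and a non-neighbour
  \<open>b\<close> of \<open>x\<close>.  The pair \<open>a b\<close> is decided by the label of \<open>c\<close>, the pairs of \<open>z\<close> with \<open>a\<close> and \<open>b\<close> by the other
  label.  If the sibling leaf \<open>z\<close> did not follow the label of the parent, \<open>x a z b\<close> or \<open>z x a b\<close> would
  be an induced path.\<close>

lemma mixed_siblings:
  assumes m: "mixed E x (L c)" and c: "c \<in> U" "c \<noteq> r" and c': "par c' = par c" "c' \<noteq> c" and z: "z \<in> L c'"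
  shows "{z, x} \<in> E \<longleftrightarrow> lab (par c) = 2"
proof -
  have cX: "c \<in> U - X" using m leaf c by (auto simp: mixed_def)
  have p: "par c \<in> U - X" using parU c by simp
  obtain a0 b0 where ab0: "a0 \<in> L c" "{a0, x} \<in> E" "b0 \<in> L c" "{b0, x} \<notin> E"
    using m unfolding mixed_def by blast
  have "\<exists>a b e e'. par e = c \<and> par e' = c \<and> e \<noteq> e' \<and> a \<in> L e \<and> b \<in> L e' \<and> {a, x} \<in> E \<and> {b, x} \<notin> E"
  proof -
    obtain e e' where e: "par e = c" "a0 \<in> L e" "par e' = c" "b0 \<in> L e'"
      using ab0 inner[OF cX] by blast
    show ?thesis
    proof (cases "e = e'")
      case True
      obtain f where f: "par f = c" "f \<noteq> e" using two[OF cX] unfolding two_kids_def by metis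
      then obtain g where g: "g \<in> L f" using Lne kid cX by blast
      then show ?thesis using e f ab0 True by (cases "{g, x} \<in> E") metis+
    qed (use e ab0 in blast)
  qed
  then obtain a b e e' where e: "par e = c" "par e' = c" "e \<noteq> e'" "a \<in> L e" "b \<in> L e'"
    and ab: "{a, x} \<in> E" "{b, x} \<notin> E" by blast
  have Lc: "a \<in> L c" "b \<in> L c" using e inner[OF cX] by blast+
  have eab: "{a, b} \<in> E \<longleftrightarrow> lab c = 2" using edge[of e e' a b] e cX by simp
  have ez: "{y, z} \<in> E \<longleftrightarrow> lab (par c) = 2" if "y \<in> L c" for y
    using edge[OF p c'(1)] c'(2) that z by blast
  have labs: "lab c = 1 \<or> lab c = 2" "lab (par c) = 1 \<or> lab (par c) = 2" "lab c \<noteq> lab (par c)"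
    using lab cX p alt c by auto
  have "c' \<in> U" using kid c' p by simp
  then have inX: "a \<in> X" "b \<in> X" "z \<in> X" using Lc LX z c by blast+
  then have inV: "a \<in> V" "b \<in> V" "z \<in> V" "x \<in> V" using XV by blast+
  have ne: "a \<noteq> b" "z \<noteq> x" "a \<noteq> x" "b \<noteq> x" using ab inX xX by auto
  have "a \<noteq> z" "b \<noteq> z" using disj[OF p c'(1)] c'(2) Lc z by blast+
  note ne = ne this
  show ?thesis
  proof (cases "lab (par c) = 2")
    case True
    then have "{a, b} \<notin> E" "{a, z} \<in> E" "{b, z} \<in> E" using eab ez Lc labs by auto
    then have "{x, z} \<in> E \<or> {a, b} \<in> E \<or> {x, b} \<in> E"
      using P4[unfolded P4_free_def, rule_format, of x a z b] inV ne ab by (simp add: insert_commute)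
    then show ?thesis using True \<open>{a, b} \<notin> E\<close> ab by (simp add: insert_commute)
  next
    case False
    then have *: "{a, b} \<in> E" "{a, z} \<notin> E" "{b, z} \<notin> E" using eab ez Lc labs by auto
    have "{z, x} \<notin> E"
    proof
      assume "{z, x} \<in> E"
      then have "{z, a} \<in> E \<or> {x, b} \<in> E \<or> {z, b} \<in> E"
        using P4[unfolded P4_free_def, rule_format, of z x a b] inV ne ab * by (simp add: insert_commute)
      then show False using * ab by (simp add: insert_commute)
    qed
    then show ?thesis using False by simp
  qed
qed

abbreviation nbrs :: "nat set" where "nbrs \<equiv> {a \<in> X. {a, x} \<in> E}"

text \<open>The program looks only at parents of full nodes.  These are the ones that are not full themselves;
  they are mixed (\<open>touched_inner\<close>).\<close>

abbreviation touched :: "nat set" where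
  "touched \<equiv> {p \<in> U. \<not> L p \<subseteq> nbrs \<and> (\<exists>c\<in>U. par c = p \<and> L c \<subseteq> nbrs)}"

abbreviation flagged :: "nat set" where "flagged \<equiv> par ` touched \<union> (par \<circ> par) ` touched"

lemma full_iff: "c \<in> U \<Longrightarrow> L c \<subseteq> nbrs \<longleftrightarrow> (\<forall>a\<in>L c. {a, x} \<in> E)"
  using LX by blast

lemma touched_inner: assumes "p \<in> touched" shows "p \<in> U - X" "mixed E x (L p)"
proof -
  obtain c where c: "c \<in> U" "par c = p" "L c \<subseteq> nbrs" and p: "p \<in> U" "\<not> L p \<subseteq> nbrs" using assms by blast
  have cr: "c \<noteq> r" using c p rootS SU by auto
  then show "p \<in> U - X" using parU c by blast
  then have "L c \<subseteq> L p" using L_sub_par c cr by blast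
  then show "mixed E x (L p)" using Lne[OF c(1)] c p LX[OF p(1)] unfolding mixed_def by blast
qed

lemma mixed_par: "mixed E x (L c) \<Longrightarrow> c \<in> U \<Longrightarrow> c \<noteq> r \<Longrightarrow> mixed E x (L (par c))"
  using L_sub_par unfolding mixed_def by blast

text \<open>By \<open>mixed_siblings\<close>, all siblings of the mixed child \<open>c\<close> are full.\<close>

lemma join_touched:
  assumes m: "mixed E x (L c)" and c: "c \<in> U" "c \<noteq> r" and l: "lab (par c) = 2"
  shows "par c \<in> touched"
proof -
  have p: "par c \<in> U - X" using parU c by simp
  obtain d where d: "par d = par c" "d \<noteq> c" using two[OF p] unfolding two_kids_def by metis
  then have dU: "d \<in> U" using kid p by simp
  have "L d \<subseteq> nbrs" using mixed_siblings[OF m c d] l dU full_iff by blast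
  moreover have "\<not> L (par c) \<subseteq> nbrs" using mixed_par[OF m c] p full_iff unfolding mixed_def by blast
  ultimately show ?thesis using p dU d by blast
qed

lemma bottom_touched:
  assumes m: "mixed E x (L u)" and u: "u \<in> U" and b: "\<And>c. par c = u \<Longrightarrow> \<not> mixed E x (L c)"
  shows "u \<in> touched"
proof -
  have uX: "u \<in> U - X" using m leaf u by (auto simp: mixed_def)
  obtain a where "a \<in> L u" "{a, x} \<in> E" using m unfolding mixed_def by blast
  then obtain c where c: "par c = u" "a \<in> L c" using inner[OF uX] by blast
  then have cU: "c \<in> U" using kid uX by simp
  then have "L c \<subseteq> nbrs" using b[OF c(1)] c(2) \<open>{a, x} \<in> E\<close> full_iff unfolding mixed_def by blast
  moreover have "\<not> L u \<subseteq> nbrs" using m u full_iff unfolding mixed_def by blast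
  ultimately show ?thesis using u c cU by blast
qed

text \<open>If \<open>u\<close> had a mixed child \<open>c\<close>, either \<open>c\<close> would be touched, and \<open>u\<close> flagged as its parent, or \<open>c\<close>
  would be a union node with a mixed child \<open>e\<close>.  Then \<open>e\<close> is a join node, hence touched: by its own
  mixed child, or as the bottom of the path.  So \<open>u\<close> would be flagged as the grandparent of \<open>e\<close>.\<close>

lemma unflagged_bottom:
  assumes u: "u \<in> touched - flagged" and c: "par c = u"
  shows "\<not> mixed E x (L c)"
proof
  assume m: "mixed E x (L c)"
  have uX: "u \<in> U - X" using touched_inner u by blast
  have cU: "c \<in> U" using kid c uX by simp
  have cr: "c \<noteq> r" using c rootS SU uX by auto
  have cX: "c \<in> U - X" using m leaf cU by (auto simp: mixed_def)
  have "c \<notin> touched" using u c by blast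
  then obtain e where e: "par e = c" "mixed E x (L e)" using bottom_touched[OF m cU] by blast
  have eU: "e \<in> U" using kid e cX by simp
  have er: "e \<noteq> r" using e rootS SU cU by auto
  have "lab c \<noteq> 2" using join_touched[OF e(2) eU er] e \<open>c \<notin> touched\<close> by blast
  then have lc: "lab c = 1" using lab cX by blast
  have eX: "e \<in> U - X" using e leaf eU by (auto simp: mixed_def)
  then have le: "lab e = 2" using alt[OF eX er] lc e lab[OF eX] by auto
  have "e \<in> touched"
  proof (cases "\<exists>f. par f = e \<and> mixed E x (L f)")
    case True
    then obtain f where f: "par f = e" "mixed E x (L f)" by blast
    have "f \<in> U" using kid f eX by simp
    moreover have "f \<noteq> r" using f rootS SU eU by auto
    ultimately show ?thesis using join_touched[OF f(2)] f le by blast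
  qed (use bottom_touched[OF e(2) eU] in blast)
  then have "par (par e) \<in> flagged" by auto
  then show False using u e c by simp
qed

text \<open>A mixed node with as few leaves as possible is touched, and flagged nodes have more leaves than
  the touched nodes that they are flagged for.\<close>

lemma exists_unflagged:
  assumes m: "mixed E x X" and SS: "par S = S"
  shows "touched - flagged \<noteq> {}"
proof -
  let ?M = "{c \<in> U. mixed E x (L c)}"
  have "r \<in> ?M" using m rootU rootL by simp
  then obtain u where u: "u \<in> ?M" "\<And>c. c \<in> ?M \<Longrightarrow> card (L u) \<le> card (L c)"
    by (metis (no_types, lifting) ex_has_least_nat[of "\<lambda>c. c \<in> ?M" r "\<lambda>c. card (L c)"])
  have uX: "u \<in> U - X" using u leaf by (auto simp: mixed_def)
  have "u \<in> touched"
  proof (rule bottom_touched)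
    fix c assume c: "par c = u"
    then have cU: "c \<in> U" using kid uX by simp
    have "c \<noteq> r" using c rootS SU uX by auto
    then have "card (L c) < card (L u)" using card_L_par cU c by blast
    then show "\<not> mixed E x (L c)" using u(2)[of c] cU by auto
  qed (use u in auto)
  moreover have "u \<noteq> par w \<and> u \<noteq> par (par w)" if w: "w \<in> touched" for w
  proof -
    have wU: "w \<in> U" and wm: "w \<in> ?M" using touched_inner[OF w] by auto
    have le: "card (L u) \<le> card (L w)" using u(2) wm by blast
    have "u \<noteq> S" using u SU by blast
    show ?thesis
    proof (cases "w = r")
      case True
      then show ?thesis using rootS SS \<open>u \<noteq> S\<close> by simp
    next
      case False
      then have l: "card (L w) < card (L (par w))" "par w \<in> U" using card_L_par parU wU by auto
      then show ?thesis
      proof (cases "par w = r")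
        case True
        then show ?thesis using rootS \<open>u \<noteq> S\<close> l le by auto
      next
        case False
        then have "card (L (par w)) < card (L (par (par w)))" using card_L_par l by blast
        then show ?thesis using l le by auto
      qed
    qed
  qed
  ultimately have "u \<in> touched" "u \<notin> par ` touched" "u \<notin> (par \<circ> par) ` touched"
    unfolding image_iff comp_apply by blast+
  then show ?thesis by blast
qed

definition ancestors :: "nat \<Rightarrow> nat set" where
  "ancestors u = {c. (u, c) \<in> {(c, par c) | c. c \<in> U \<and> c \<noteq> r}\<^sup>*}"

lemma ancestor_props:
  assumes u: "u \<in> U" and c: "c \<in> ancestors u"
  shows "c \<in> U" "L u \<subseteq> L c" "c = u \<or> card (L u) < card (L c)"
proof -
  have "(u, c) \<in> {(c, par c) | c. c \<in> U \<and> c \<noteq> r}\<^sup>*" using c by (simp add: ancestors_def)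
  then have "c \<in> U \<and> L u \<subseteq> L c \<and> (c = u \<or> card (L u) < card (L c))"
  proof (induction rule: rtrancl_induct)
    case (step y z)
    then have "y \<in> U" "y \<noteq> r" "z = par y" by auto
    then show ?case using step.IH L_sub_par[of y] card_L_par[of y] parU[of y] by auto
  qed (use u in simp)
  then show "c \<in> U" "L u \<subseteq> L c" "c = u \<or> card (L u) < card (L c)" by auto
qed

lemma ancestors_step: "c \<in> ancestors u \<Longrightarrow> c \<in> U \<Longrightarrow> c \<noteq> r \<Longrightarrow> par c \<in> ancestors u"
  unfolding ancestors_def by (auto intro: rtrancl_into_rtrancl)

lemma branch_ancestors:
  assumes u: "u \<in> U" shows "branch U par r u (ancestors u)"
  unfolding branch_def
proof (intro conjI ballI impI)
  show "u \<in> ancestors u" by (simp add: ancestors_def)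
  show sub: "ancestors u \<subseteq> U" using ancestor_props[OF u] by blast
  have finX: "finite X" using XU finU finite_subset by blast
  have "\<forall>c. c \<in> ancestors u \<longrightarrow> card (L c) < Suc (card X)"
  proof (intro allI impI)
    fix c assume "c \<in> ancestors u"
    then have "L c \<subseteq> X" by (intro LX) (use sub in blast)
    then show "card (L c) < Suc (card X)" using card_mono[OF finX] by (simp add: less_Suc_eq_le)
  qed
  with \<open>u \<in> ancestors u\<close> have "\<exists>m. m \<in> ancestors u \<and> (\<forall>c. c \<in> ancestors u \<longrightarrow> card (L c) \<le> card (L m))"
    by (rule ex_has_greatest_nat)
  then obtain m where m: "m \<in> ancestors u" "\<And>c. c \<in> ancestors u \<Longrightarrow> card (L c) \<le> card (L m)"
    by auto
  have "m = r"
  proof (rule ccontr)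
    assume "m \<noteq> r"
    moreover have "m \<in> U" using m sub by blast
    ultimately show False using m(2)[OF ancestors_step[OF m(1)]] card_L_par[of m] by simp
  qed
  then show "r \<in> ancestors u" using m by simp
next
  fix c assume c: "c \<in> ancestors u" "c \<noteq> r"
  then have cU: "c \<in> U" using ancestor_props[OF u] by blast
  show "par c \<in> ancestors u" using ancestors_step c cU by blast
  show "par c \<noteq> u" using card_L_par[OF cU c(2)] ancestor_props(3)[OF u c(1)] by auto
next
  fix p assume p: "p \<in> ancestors u" "p \<noteq> u"
  then have "(u, p) \<in> {(c, par c) | c. c \<in> U \<and> c \<noteq> r}\<^sup>*" by (simp add: ancestors_def)
  then show "\<exists>c\<in>ancestors u. c \<noteq> r \<and> par c = p"
  proof (cases rule: rtranclE)
    case (step y)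
    then show ?thesis unfolding ancestors_def by auto
  qed (use p in simp)
next
  fix c c' assume c: "c \<in> ancestors u" "c' \<in> ancestors u" "par c = par c'"
  have U: "c \<in> U" "c' \<in> U" using c ancestor_props[OF u] by blast+
  show "c = c'"
  proof (cases "c = r")
    case True
    then show ?thesis using c rootS parU[of c'] U SU by auto
  next
    case False
    have p: "par c \<in> U - X" by (rule parU[OF U(1) False])
    have "L u \<subseteq> L c" "L u \<subseteq> L c'" "L u \<noteq> {}" using c ancestor_props[OF u] Lne[OF u] by blast+
    then have "L c \<inter> L c' \<noteq> {}" by blast
    then show ?thesis using disj[OF p c(3)[symmetric]] by blast
  qed
qed

lemma attaches_ancestors:
  assumes u: "u \<in> U" "mixed E x (L u)"
  shows "attaches E r par lab L x (ancestors u)"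
proof -
  have "mixed E x (L c)" if "c \<in> ancestors u" for c
    using ancestor_props(2)[OF u(1) that] u(2) unfolding mixed_def by blast
  then show ?thesis unfolding attaches_def
    using mixed_siblings ancestor_props(1)[OF u(1)] by blast
qed

end

section \<open>Grafting a new leaf\<close>

text \<open>The situation before \<open>x\<close> is combined with the part of the graph below \<open>z\<close>, by a union
  (\<open>oper = 1\<close>) or a join (\<open>oper = 2\<close>).  The node \<open>z\<close> is exempt from the conditions of a proper cotree: it
  may be left over from splitting a node, with a single child or with the label of its parent.\<close>

locale graftable = wtree +
  fixes z x oper :: nat and Z :: "nat set"
  assumes zZ: "branch U par r z Z" and att: "attaches E r par lab L x Z"
    and zx: "a \<in> L z \<Longrightarrow> {a, x} \<in> E \<longleftrightarrow> oper = 2"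
    and oper: "oper = 1 \<or> oper = 2" and oper_ne: "z \<noteq> r \<Longrightarrow> lab (par z) \<noteq> oper"
    and two': "p \<in> U - X \<Longrightarrow> p \<noteq> z \<Longrightarrow> two_kids par p"
    and alt': "c \<in> U - X \<Longrightarrow> c \<noteq> r \<Longrightarrow> c \<noteq> z \<Longrightarrow> lab c \<noteq> lab (par c)"

lemma branchD:
  assumes "branch U par r z Z"
  shows "z \<in> Z" "Z \<subseteq> U" "r \<in> Z" "\<And>c. c \<in> Z \<Longrightarrow> c \<noteq> r \<Longrightarrow> par c \<in> Z" "\<And>c. c \<in> Z \<Longrightarrow> c \<noteq> r \<Longrightarrow> par c \<noteq> z"
    "\<And>p. p \<in> Z \<Longrightarrow> p \<noteq> z \<Longrightarrow> \<exists>c\<in>Z. c \<noteq> r \<and> par c = p"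
    "\<And>c c'. c \<in> Z \<Longrightarrow> c' \<in> Z \<Longrightarrow> par c = par c' \<Longrightarrow> c = c'"
  using assms unfolding branch_def by blast+

lemma branchI:
  assumes "z \<in> Z" "Z \<subseteq> U" "r \<in> Z" "\<And>c. c \<in> Z \<Longrightarrow> c \<noteq> r \<Longrightarrow> par c \<in> Z" "\<And>c. c \<in> Z \<Longrightarrow> c \<noteq> r \<Longrightarrow> par c \<noteq> z"
    "\<And>p. p \<in> Z \<Longrightarrow> p \<noteq> z \<Longrightarrow> \<exists>c\<in>Z. c \<noteq> r \<and> par c = p"
    "\<And>c c'. c \<in> Z \<Longrightarrow> c' \<in> Z \<Longrightarrow> par c = par c' \<Longrightarrow> c = c'"
  shows "branch U par r z Z"
  using assms unfolding branch_def by blast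

context graftable
begin

lemma z_in: "z \<in> U" using branchD[OF zZ] by blast

text \<open>If splitting has left \<open>z\<close> with a single child, this child takes its place.  By alternation of the
  original labels, the child does not have the label of its new parent.\<close>

lemma unwrap_graftable:
  assumes z: "z \<in> U - X" "z \<noteq> r" "kids par z = {y}" "lab y \<noteq> lab z \<or> y \<in> X" "lab z = lab (par z)"
    and y: "y \<noteq> z" and o: "o' \<in> X"
  shows "graftable E X S (U - {z}) (par(z := o', y := par z)) lab L r y x oper (insert y (Z - {z}))"
    (is "graftable E X S ?U ?par lab L r y x oper ?Z")
proof -
  note b = branchD[OF zZ]
  have py: "par c = z \<longleftrightarrow> c = y" for c using z(3) by auto
  have yU: "y \<in> U" using py[of y] kid[of y] z(1) by simp
  have yr: "y \<noteq> r" using py[of y] rootS SU z(1) by auto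
  have yZ: "y \<notin> Z" using b(5)[of y] py yr by blast
  have pz: "par z \<in> U - X" using parU z by blast
  have pzz: "par z \<noteq> z" using b(5)[of z] b(1) z(2) by blast
  have pzy: "par z \<noteq> y" using b(4)[of z] b(1) z(2) yZ by auto
  have Ly: "L y = L z" using inner[OF z(1)] z(3) by simp
  have oz: "o' \<notin> U - X" using o by blast
  interpret w: wtree E X S ?U ?par lab L r
    using unwrap[OF z(1,2,3) y o] .
  show ?thesis
  proof
    show "branch ?U ?par r y ?Z"
    proof (rule branchI)
      fix c assume c: "c \<in> ?Z" "c \<noteq> r"
      show "?par c \<in> ?Z" using c b(4)[of c] b(4)[OF b(1) z(2)] pzz py[of c] by auto
      show "?par c \<noteq> y" using c b(4)[of c] b(1) yZ pzy z(2) by auto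
    next
      fix p assume p: "p \<in> ?Z" "p \<noteq> y"
      then obtain c where c: "c \<in> Z" "c \<noteq> r" "par c = p" using b(6)[of p] by auto
      show "\<exists>c\<in>?Z. c \<noteq> r \<and> ?par c = p"
      proof (cases "c = z")
        case True
        then show ?thesis using c yr y by (intro bexI[of _ y]) auto
      next
        case False
        then show ?thesis using c yZ by (intro bexI[of _ c]) auto
      qed
    next
      fix c c' assume c: "c \<in> ?Z" "c' \<in> ?Z" "?par c = ?par c'"
      define f where "f d = (if d = y then z else d)" for d
      have f: "?par d = par (f d) \<and> f d \<in> Z" if "d \<in> ?Z" for d
        using that b(1) y by (cases "d = y") (simp_all add: f_def)
      have "f c = f c'" using f[OF c(1)] f[OF c(2)] c(3) b(7) by metis
      then show "c = c'" using c(1,2) y unfolding f_def by (metis Diff_iff insert_iff)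
    qed (use b y yZ yU z in auto)
    show "attaches E r ?par lab L x ?Z"
      unfolding attaches_def
    proof (intro ballI allI impI)
      fix c c' a assume c: "c \<in> ?Z" "c \<noteq> r" "?par c' = ?par c" "c' \<noteq> c" "a \<in> L c'"
      have c'z: "c' \<noteq> z"
      proof
        assume "c' = z"
        then have "?par c = o'" using c y by auto
        moreover have "?par c \<in> U - X" using c parU[of c] b(2) pz by (auto split: if_splits)
        ultimately show False using o by simp
      qed
      define g where "g d = (if d = y then z else d)" for d
      have "par (g c') = par (g c)" "g c \<in> Z" "g c \<noteq> r" "g c' \<noteq> g c" "a \<in> L (g c')" "?par c = par (g c)"
        using c c'z b(1) z(2) Ly y yZ by (auto simp: g_def split: if_splits)
      then show "{a, x} \<in> E \<longleftrightarrow> lab (?par c) = 2" using att unfolding attaches_def by metis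
    qed
    show "{a, x} \<in> E \<longleftrightarrow> oper = 2" if "a \<in> L y" for a using zx that Ly by simp
    show "oper = 1 \<or> oper = 2" using oper .
    show "lab (?par y) \<noteq> oper" using oper_ne z by simp
    show "two_kids ?par p" if p: "p \<in> ?U - X" "p \<noteq> y" for p
    proof -
      obtain c c' where c: "par c = p" "par c' = p" "c \<noteq> c'" using two'[of p] p unfolding two_kids_def by blast
      define g where "g d = (if d = z then y else d)" for d
      have g: "?par (g d) = p \<and> d \<noteq> y" if "par d = p" for d
      proof -
        have "d \<noteq> y" using py[of d] that p by blast
        then show ?thesis using that y by (cases "d = z") (simp_all add: g_def)
      qed
      have "g c \<noteq> g c'" using g[OF c(1)] g[OF c(2)] c(3) unfolding g_def by metis
      then have "g c \<noteq> g c'" "?par (g c) = p" "?par (g c') = p" using g c by blast+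
      then show ?thesis unfolding two_kids_def by blast
    qed
    show "lab c \<noteq> lab (?par c)" if c: "c \<in> ?U - X" "c \<noteq> r" "c \<noteq> y" for c
      using alt'[of c] c by auto
  qed
qed

end

text \<open>A node that already has the label \<open>oper\<close> takes \<open>x\<close> as a further child; a new node would
  violate alternation.\<close>

lemma (in graftable) graft_here:
  assumes z: "z \<in> U - X" "lab z = oper" and x: "x \<notin> U" "x \<noteq> S" "\<And>c. par c \<noteq> x"
    and alt_z: "z \<noteq> r \<Longrightarrow> lab z \<noteq> lab (par z)"
  shows "cotree E (insert x X) S (insert x U) (par(x := z)) lab
    (\<lambda>c. if c = x then {x} else if c \<in> Z then insert x (L c) else L c) r"
proof -
  interpret w: wtree E "insert x X" S "insert x U" "par(x := z)" lab
    "\<lambda>c. if c = x then {x} else if c \<in> Z then insert x (L c) else L c" r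
    using add_leaf[OF x z(1) zZ att] zx z(2) by simp
  have kx: "c \<noteq> x" if "par c = p" "p \<in> U - X" for c p using kid x that by blast
  show ?thesis
  proof
    fix u assume u: "u \<in> insert x U - insert x X"
    then have uU: "u \<in> U - X" by blast
    show "two_kids (par(x := z)) u"
    proof (cases "u = z")
      case True
      obtain c where c: "par c = z" using kids_ne[OF z(1)] by blast
      then have "(par(x := z)) x = u" "(par(x := z)) c = u" "c \<noteq> x" using True kx z by auto
      then show ?thesis unfolding two_kids_def by blast
    next
      case False
      then obtain c c' where "par c = u" "par c' = u" "c \<noteq> c'" using two' uU unfolding two_kids_def by blast
      then show ?thesis using kx[of c u] kx[of c' u] uU unfolding two_kids_def by (metis fun_upd_other)
    qed
  next
    fix c assume "c \<in> insert x U - insert x X" "c \<noteq> r"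
    then show "lab c \<noteq> lab ((par(x := z)) c)" using alt'[of c] alt_z by auto
  qed
qed

lemma (in graftable) graft_new:
  assumes z: "z \<in> X \<or> two_kids par z" "lab z \<noteq> oper" and x: "x \<notin> U" "x \<noteq> S" "\<And>c. par c \<noteq> x"
    and w: "w \<notin> U" "w \<noteq> S" "\<And>c. par c \<noteq> w" "w \<noteq> x"
  shows "cotree E (insert x X) S (insert x (insert w U)) (par(w := par z, z := w, x := w)) (lab(w := oper))
    (\<lambda>c. if c = x then {x} else if c \<in> insert w (Z - {z}) then insert x ((L(w := L z)) c) else (L(w := L z)) c)
    (if z = r then w else r)"
proof -
  note b = branchD[OF zZ]
  let ?par = "par(w := par z, z := w)" and ?lab = "lab(w := oper)" and ?L = "L(w := L z)"
  let ?r = "if z = r then w else r" and ?Z = "insert w (Z - {z})" and ?U = "insert w U"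
  have zU: "z \<in> U" and wz: "w \<noteq> z" using z_in w by blast+
  have wX: "w \<notin> X" using w XU by blast
  have wZ: "w \<notin> Z" using b w by blast
  have parw: "?par c = w \<longleftrightarrow> c = z" for c using w(3) wz by auto
  interpret w: wtree E X S ?U ?par ?lab ?L ?r
    using subdivide[OF zU w(1-3) oper] .
  have two: "two_kids ?par p" if p: "p \<in> ?U - X" "p \<noteq> w" for p
  proof -
    have "two_kids par p" using two'[of p] z(1) p by blast
    then obtain c c' where c: "par c = p" "par c' = p" "c \<noteq> c'"
      unfolding two_kids_def by blast
    define g where "g d = (if d = z then w else d)" for d
    have pU: "p \<in> U - X" using p by blast
    have g: "?par (g d) = p \<and> d \<noteq> w" if "par d = p" for d
    proof -
      have "d \<noteq> w" using kid[of d] that pU w(1) by blast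
      then show ?thesis using that wz by (cases "d = z") (simp_all add: g_def)
    qed
    have "g c \<noteq> g c'" using g[OF c(1)] g[OF c(2)] c(3) unfolding g_def by metis
    then have "g c \<noteq> g c'" "?par (g c) = p" "?par (g c') = p" using g c by blast+
    then show ?thesis unfolding two_kids_def by blast
  qed
  interpret g: graftable E X S ?U ?par ?lab ?L ?r w x oper ?Z
  proof
    show "branch ?U ?par ?r w ?Z"
    proof (rule branchI)
      fix c assume c: "c \<in> ?Z" "c \<noteq> ?r"
      show "?par c \<in> ?Z" using c b(4)[of c] b(4)[OF b(1)] b(5)[of c] b(5)[OF b(1)] wz by (auto split: if_splits)
      show "?par c \<noteq> w" using c parw wz by auto
    next
      fix p assume p: "p \<in> ?Z" "p \<noteq> w"
      then obtain c where c: "c \<in> Z" "c \<noteq> r" "par c = p" using b(6)[of p] by auto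
      then have "c \<noteq> w" using wZ by blast
      show "\<exists>c\<in>?Z. c \<noteq> ?r \<and> ?par c = p"
      proof (cases "c = z")
        case True
        moreover have "w \<noteq> r" using w(1) rootU by blast
        ultimately show ?thesis using c wz by (intro bexI[of _ w]) auto
      next
        case False
        then show ?thesis using c \<open>c \<noteq> w\<close> by (intro bexI[of _ c]) auto
      qed
    next
      fix c c' assume c: "c \<in> ?Z" "c' \<in> ?Z" "?par c = ?par c'"
      define f where "f d = (if d = w then z else d)" for d
      have f: "?par d = par (f d) \<and> f d \<in> Z" if "d \<in> ?Z" for d
        using that b(1) wz by (cases "d = w") (simp_all add: f_def)
      have "f c = f c'" using f[OF c(1)] f[OF c(2)] c(3) b(7) by metis
      then show "c = c'" using c(1,2) wz unfolding f_def by (metis Diff_iff insert_iff)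
    qed (use b wz w in auto)
    show "attaches E ?r ?par ?lab ?L x ?Z"
      unfolding attaches_def
    proof (intro ballI allI impI)
      fix c c' a assume c: "c \<in> ?Z" "c \<noteq> ?r" "?par c' = ?par c" "c' \<noteq> c" "a \<in> ?L c'"
      have cz: "c \<noteq> z" using c wz by auto
      have pcw: "?par c \<noteq> w" using parw cz by blast
      then have c'z: "c' \<noteq> z" using c parw by metis
      define f where "f d = (if d = w then z else d)" for d
      have "par (f c') = par (f c)" "f c \<in> Z" "f c \<noteq> r" "f c' \<noteq> f c" "a \<in> L (f c')" "?par c = par (f c)"
        using c c'z cz b(1) wz wZ by (auto simp: f_def split: if_splits)
      then show "{a, x} \<in> E \<longleftrightarrow> ?lab (?par c) = 2" using att pcw unfolding attaches_def by (metis fun_upd_other)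
    qed
    show "{a, x} \<in> E \<longleftrightarrow> oper = 2" if "a \<in> ?L w" for a using zx that by simp
    show "?lab (?par w) \<noteq> oper" if "w \<noteq> ?r" using oper_ne that wz w(3)[of z] by (auto split: if_splits)
    show "?lab c \<noteq> ?lab (?par c)" if c: "c \<in> ?U - X" "c \<noteq> ?r" "c \<noteq> w" for c
      using alt'[of c] c z(2) w(3)[of c] by (auto split: if_splits)
  qed (use oper two in auto)
  have "x \<noteq> w" using w by blast
  have "?par c \<noteq> x" for c using x(3) w(4) by auto
  moreover have "?lab w \<noteq> ?lab (?par w)" if "w \<noteq> ?r"
    using oper_ne that wz w(3)[of z] by (auto split: if_splits)
  ultimately show ?thesis
    using g.graft_here[of] wX x w by simp
qed

context cotree
begin

lemma graftable_root:
  assumes "oper = 1 \<or> oper = 2" "\<And>a. a \<in> X \<Longrightarrow> {a, x} \<in> E \<longleftrightarrow> oper = 2"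
  shows "graftable E X S U par lab L r r x oper {r}"
proof
  show "branch U par r r {r}" using rootU by (intro branchI) auto
  show "attaches E r par lab L x {r}" by (simp add: attaches_def)
qed (use assms rootL two alt in auto)

end

context cotree_insert
begin

text \<open>Below a union node, \<open>x\<close> is joined with the full children \<open>F\<close>, which move to a new child \<open>v\<close>.
  The other children remain at \<open>u\<close>; none of their leaves is adjacent to \<open>x\<close>, as the label says.\<close>

lemma graftable_split_union:
  assumes u: "u \<in> U - X" "mixed E x (L u)" and bot: "\<And>c. par c = u \<Longrightarrow> \<not> mixed E x (L c)"
    and F: "F = {c. par c = u \<and> L c \<subseteq> nbrs}" and lu: "lab u = 1"
    and v: "v \<notin> U" "v \<noteq> S" "\<And>c. par c \<noteq> v"
  shows "graftable E X S (insert v U) (\<lambda>c. if c \<in> F then v else if c = v then u else par c)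
    (lab(v := lab u)) (L(v := \<Union>c\<in>F. L c)) r v x 2 (insert v (ancestors u))"
    (is "graftable E X S ?U ?par ?lab ?L r v x 2 ?Z")
proof -
  have uU: "u \<in> U" using u by blast
  note b = branchD[OF branch_ancestors[OF uU]]
  have vX: "v \<notin> X" using XU v by blast
  have full: "L c \<subseteq> nbrs \<longleftrightarrow> (\<exists>a\<in>L c. {a, x} \<in> E)" if "par c = u" for c
  proof -
    have cU: "c \<in> U" using kid that u by simp
    show ?thesis using bot[OF that] full_iff[OF cU] Lne[OF cU] unfolding mixed_def by blast
  qed
  obtain a0 b0 where ab: "a0 \<in> L u" "{a0, x} \<in> E" "b0 \<in> L u" "{b0, x} \<notin> E" using u unfolding mixed_def by blast
  obtain c1 where c1: "par c1 = u" "a0 \<in> L c1" using inner[OF u(1)] ab by blast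
  obtain c2 where c2: "par c2 = u" "b0 \<in> L c2" using inner[OF u(1)] ab by blast
  have c1F: "c1 \<in> F" using F full c1 ab by blast
  have c2F: "c2 \<notin> F" using F c2 ab by blast
  have uF: "u \<notin> F" using F par_ne uU by blast
  have vF: "v \<notin> F" using F kid[of v] v u by auto
  have FU: "F \<subseteq> U" using F kids_sub[OF u(1)] by auto
  have rF: "r \<notin> F" using F rootS SU uU by auto
  have vu: "v \<noteq> u" using uU v by blast
  have Fanc: "c \<notin> ancestors u" if "c \<in> F" for c
    using b(5)[of c] that F rF by blast
  interpret w: wtree E X S ?U ?par ?lab ?L r
    by (rule split_below[OF u(1) v]) (use F c1F uF in auto)
  have parv: "?par c = v \<longleftrightarrow> c \<in> F" for c using v(3) vu by auto
  have vZ: "v \<notin> ancestors u" using b v by blast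
  have Fne: "F \<noteq> {}" using c1F by blast
  have panc: "?par c = par c" if "c \<in> ancestors u" for c
    using that vZ Fanc by auto
  show ?thesis
  proof
    show "branch ?U ?par r v ?Z"
    proof (rule branchI)
      fix c assume c: "c \<in> ?Z" "c \<noteq> r"
      show "?par c \<in> ?Z"
      proof (cases "c = v")
        case True
        then show ?thesis using vF b(1) by simp
      next
        case False
        then show ?thesis using c b(4)[of c] panc[of c] by simp
      qed
      show "?par c \<noteq> v" using parv[of c] c vF Fanc by auto
    next
      fix p assume p: "p \<in> ?Z" "p \<noteq> v"
      show "\<exists>c\<in>?Z. c \<noteq> r \<and> ?par c = p"
      proof (cases "p = u")
        case True
        have "v \<noteq> r" using v rootU by blast
        then show ?thesis using True vF by (intro bexI[of _ v]) auto
      next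
        case False
        then obtain c where c: "c \<in> ancestors u" "c \<noteq> r" "par c = p" using p b(6)[of p] by auto
        then show ?thesis using panc[of c] by (intro bexI[of _ c]) auto
      qed
    next
      fix c c' assume c: "c \<in> ?Z" "c' \<in> ?Z" "?par c = ?par c'"
      have nu: "?par d \<noteq> u" if "d \<in> ancestors u" for d
      proof (cases "d = r")
        case True
        then show ?thesis using panc[OF that] rootS SU uU by auto
      next
        case False
        then show ?thesis using panc[OF that] b(5)[OF that] by simp
      qed
      have pv: "?par v = u" using vF by simp
      show "c = c'"
        using c b(7)[of c c'] panc[of c] panc[of c'] nu[of c] nu[of c'] pv by auto
    qed (use b v in auto)
    show "attaches E r ?par ?lab ?L x ?Z"
      unfolding attaches_def
    proof (intro ballI allI impI)
      fix c c' a assume c: "c \<in> ?Z" "c \<noteq> r" "?par c' = ?par c" "c' \<noteq> c" "a \<in> ?L c'"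
      show "{a, x} \<in> E \<longleftrightarrow> ?lab (?par c) = 2"
      proof (cases "c = v")
        case True
        then have pc: "?par c = u" using vF by simp
        then have c': "c' \<notin> F" "c' \<noteq> v" "par c' = u" using c True vu by (auto split: if_splits)
        then have "a \<in> L c'" using c by simp
        then have "{a, x} \<notin> E" using c' full[of c'] F by blast
        then show ?thesis using pc lu vu by simp
      next
        case False
        then have ca: "c \<in> ancestors u" using c by simp
        have pcu: "?par c \<noteq> u" using panc[OF ca] b(5)[OF ca c(2)] by simp
        have pcv: "?par c \<noteq> v" using parv Fanc ca by blast
        have "c' \<notin> F" using parv[of c'] c(3) pcv by auto
        moreover have "c' \<noteq> v" using c(3) pcu vF by auto
        ultimately have "par c' = par c" "a \<in> L c'" using c panc[OF ca] by auto
        then have "{a, x} \<in> E \<longleftrightarrow> lab (par c) = 2"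
          using attaches_ancestors[OF uU u(2)] ca c(2,4) unfolding attaches_def by blast
        then show ?thesis using panc[OF ca] pcv by simp
      qed
    qed
    show "{a, x} \<in> E \<longleftrightarrow> (2::nat) = 2" if "a \<in> ?L v" for a
      using that F by auto
    show "?lab (?par v) \<noteq> 2" using lu vF by simp
    show "two_kids ?par p" if p: "p \<in> ?U - X" "p \<noteq> v" for p
    proof (cases "p = u")
      case True
      have "?par v = u" "?par c2 = u" "v \<noteq> c2" using vF c2F c2 v(1) kid[of c2] u by auto
      then show ?thesis using True unfolding two_kids_def by blast
    next
      case False
      have pU: "p \<in> U - X" using p by blast
      obtain c c' where c: "par c = p" "par c' = p" "c \<noteq> c'" using two[OF pU] unfolding two_kids_def by blast
      have "?par d = p" if "par d = p" for d
      proof -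
        have "d \<notin> F" using that False F by auto
        moreover have "d \<noteq> v" using that kid[of v] pU v by auto
        ultimately show ?thesis using that by simp
      qed
      then show ?thesis using c unfolding two_kids_def by blast
    qed
    show "?lab c \<noteq> ?lab (?par c)" if c: "c \<in> ?U - X" "c \<noteq> r" "c \<noteq> v" for c
    proof -
      have "lab c \<noteq> lab (par c)" using alt[of c] c by blast
      moreover have "par c = u" if "c \<in> F" using that F by blast
      ultimately show ?thesis using c v(3)[of c] by auto
    qed
  qed auto
qed

text \<open>Below a join node, \<open>x\<close> is put beside the children that are not full.  These may be too many to be
  moved, so they stay at \<open>u\<close>, and the new node \<open>v\<close> with the full children \<open>F\<close> takes the place of \<open>u\<close> and has \<open>u\<close>
  as a further child.  Formally, \<open>v\<close> subdivides the edge above \<open>u\<close> and then \<open>F\<close> is promoted.\<close>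

lemma graftable_split_join:
  assumes u: "u \<in> U - X" "mixed E x (L u)" and bot: "\<And>c. par c = u \<Longrightarrow> \<not> mixed E x (L c)"
    and F: "F = {c. par c = u \<and> L c \<subseteq> nbrs}" and lu: "lab u = 2"
    and v: "v \<notin> U" "v \<noteq> S" "\<And>c. par c \<noteq> v"
  shows "graftable E X S (insert v U) (\<lambda>c. if c \<in> F then v else (par(v := par u, u := v)) c)
    (lab(v := lab u)) (L(v := L u, u := \<Union>c\<in>kids par u - F. L c)) (if u = r then v else r)
    u x 1 (insert v (ancestors u))"
    (is "graftable E X S ?U ?par ?lab ?L ?r u x 1 ?Z")
proof -
  have uU: "u \<in> U" using u by blast
  note b = branchD[OF branch_ancestors[OF uU]]
  have vX: "v \<notin> X" using XU v by blast
  have full: "L c \<subseteq> nbrs \<longleftrightarrow> (\<exists>a\<in>L c. {a, x} \<in> E)" if "par c = u" for c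
  proof -
    have cU: "c \<in> U" using kid that u by simp
    show ?thesis using bot[OF that] full_iff[OF cU] Lne[OF cU] unfolding mixed_def by blast
  qed
  obtain a0 b0 where ab: "a0 \<in> L u" "{a0, x} \<in> E" "b0 \<in> L u" "{b0, x} \<notin> E" using u unfolding mixed_def by blast
  obtain c1 where c1: "par c1 = u" "a0 \<in> L c1" using inner[OF u(1)] ab by blast
  obtain c2 where c2: "par c2 = u" "b0 \<in> L c2" using inner[OF u(1)] ab by blast
  have c1F: "c1 \<in> F" using F full c1 ab by blast
  have c2F: "c2 \<notin> F" using F c2 ab by blast
  have uF: "u \<notin> F" using F par_ne uU by blast
  have vF: "v \<notin> F" using F kid[of v] v u by auto
  have FU: "F \<subseteq> U" using F kids_sub[OF u(1)] by auto
  have rF: "r \<notin> F" using F rootS SU uU by auto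
  have vu: "v \<noteq> u" using uU v by blast
  have Fanc: "c \<notin> ancestors u" if "c \<in> F" for c
    using b(5)[of c] that F rF by blast
  let ?p1 = "par(v := par u, u := v)"
  have "u \<noteq> par u" using par_ne[OF uU] by simp
  have ku: "kids ?p1 u = kids par u"
    using vu \<open>u \<noteq> par u\<close> kid[of v] v(1) u(1) by (auto split: if_splits)
  interpret s: wtree E X S ?U ?p1 ?lab "L(v := L u)" ?r
    by (rule subdivide[OF uU v]) (use lu in simp)
  have kv: "?p1 u = v" by simp
  have "wtree E X S ?U (\<lambda>c. if c \<in> F then ?p1 u else ?p1 c) ?lab
      ((L(v := L u))(u := \<Union>c\<in>kids ?p1 u - F. (L(v := L u)) c)) ?r"
  proof (rule s.promote)
    show "F \<subseteq> kids ?p1 u" "F \<noteq> kids ?p1 u" using F c2 c2F unfolding ku by auto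
  qed (use u vu uF in auto)
  moreover have "(\<Union>c\<in>kids ?p1 u - F. (L(v := L u)) c) = (\<Union>c\<in>kids par u - F. L c)"
    unfolding ku using kid[of v] v(1) u(1) by (intro SUP_cong) auto
  moreover have "(\<lambda>c. if c \<in> F then ?p1 u else ?p1 c) = ?par"
    unfolding kv ..
  ultimately interpret w: wtree E X S ?U ?par ?lab ?L ?r by (simp only:)
  have vZ: "v \<notin> ancestors u" using b v by blast
  have panc: "?par c = par c" if "c \<in> ancestors u" "c \<noteq> u" for c
    using Fanc that vZ by auto
  have pu: "?par u = v" and pv: "?par v = par u" using uF vF vu by auto
  have parv: "?par c = v \<longleftrightarrow> c \<in> F \<or> c = u" for c using v(3) vF by auto
  have paru: "?par c = u \<longleftrightarrow> par c = u \<and> c \<notin> F" for c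
    using vu \<open>u \<noteq> par u\<close> kid[of v] v(1) u(1) by auto
  have Lv: "?L c = L c" if "c \<noteq> u" "c \<noteq> v" for c using that by simp
  have anc_ne: "par c \<noteq> u" if "c \<in> ancestors u" for c
    using b(5)[OF that] rootS SU uU by (cases "c = r") auto
  show ?thesis
  proof
    show "branch ?U ?par ?r u ?Z"
    proof (rule branchI)
      fix c assume c: "c \<in> ?Z" "c \<noteq> ?r"
      have "par c \<in> ?Z" if "c \<in> ancestors u" "c \<noteq> r" using b(4) that by blast
      then show "?par c \<in> ?Z"
        using c pu pv panc[of c] b(4)[OF b(1)] by (cases "c = v"; cases "c = u") (auto split: if_splits)
      show "?par c \<noteq> u"
        using c paru[of c] anc_ne[of c] kid[of v] v(1) u(1) by auto
    next
      fix p assume p: "p \<in> ?Z" "p \<noteq> u"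
      show "\<exists>c\<in>?Z. c \<noteq> ?r \<and> ?par c = p"
      proof (cases "p = v")
        case True
        then show ?thesis using pu b(1) vu by (intro bexI[of _ u]) auto
      next
        case False
        then obtain c where c: "c \<in> ancestors u" "c \<noteq> r" "par c = p" using p b(6)[of p] by auto
        show ?thesis
        proof (cases "c = u")
          case True
          then show ?thesis using c pv v(1) rootU by (intro bexI[of _ v]) auto
        next
          case cu: False
          have "c \<noteq> v" using c vZ by blast
          then show ?thesis using c panc[OF c(1) cu] by (intro bexI[of _ c]) auto
        qed
      qed
    next
      fix c c' assume c: "c \<in> ?Z" "c' \<in> ?Z" "?par c = ?par c'"
      define f where "f d = (if d = v then u else d)" for d
      have f: "?par d = par (f d) \<and> f d \<in> ancestors u" if "d \<in> ?Z" "d \<noteq> u" for d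
        using that pv panc[of d] b(1) unfolding f_def by (cases "d = v") auto
      have notv: "?par d \<noteq> v" if "d \<in> ?Z" "d \<noteq> u" for d using parv[of d] that vF Fanc by auto
      show "c = c'"
      proof (cases "c = u \<or> c' = u")
        case True
        have "?par c = v \<longleftrightarrow> c = u" "?par c' = v \<longleftrightarrow> c' = u"
          using notv[OF c(1)] notv[OF c(2)] pu by blast+
        then show ?thesis using True c(3) by metis
      next
        case False
        then have "f c = f c'" using f[of c] f[of c'] c b(7)[of "f c" "f c'"] by auto
        then show ?thesis using False by (auto simp: f_def split: if_splits)
      qed
    qed (use b v in auto)
    show "attaches E ?r ?par ?lab ?L x ?Z"
      unfolding attaches_def
    proof (intro ballI allI impI)
      fix c c' a assume c: "c \<in> ?Z" "c \<noteq> ?r" "?par c' = ?par c" "c' \<noteq> c" "a \<in> ?L c'"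
      show "{a, x} \<in> E \<longleftrightarrow> ?lab (?par c) = 2"
      proof (cases "c = u")
        case True
        then have "c' \<in> F" using c parv[of c'] pu by auto
        then have "a \<in> L c'" "L c' \<subseteq> nbrs" using c F Lv[of c'] uF vF by (auto split: if_splits)
        then show ?thesis using True pu lu by auto
      next
        case False
        define f where "f d = (if d = v then u else d)" for d
        have fc: "?par c = par (f c)" "f c \<in> ancestors u" "f c \<noteq> r"
          using c False pv panc[of c] b(1) unfolding f_def by (auto split: if_splits)
        have pcv: "?par c \<noteq> v" using parv[of c] c False vF Fanc by auto
        then have c': "c' \<notin> F" "c' \<noteq> u" using c(3) parv[of c'] by auto
        have "?par c' = par (f c')" using c' pv unfolding f_def by (cases "c' = v") simp_all
        then have fc': "par (f c') = par (f c)" using c(3) fc(1) by (simp only:)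
        have ne: "f c' \<noteq> f c" using c c' False unfolding f_def by auto
        have "a \<in> L (f c')" using c c' vu unfolding f_def by (auto split: if_splits)
        then have "{a, x} \<in> E \<longleftrightarrow> lab (par (f c)) = 2"
          using attaches_ancestors[OF uU u(2)] fc(2,3) fc' ne unfolding attaches_def by blast
        then show ?thesis using fc(1) pcv by simp
      qed
    qed
    show "{a, x} \<in> E \<longleftrightarrow> (1::nat) = 2" if "a \<in> ?L u" for a
      using that F full by auto
    show "?lab (?par u) \<noteq> 1" using lu pu by simp
    show "two_kids ?par p" if p: "p \<in> ?U - X" "p \<noteq> u" for p
    proof (cases "p = v")
      case True
      have "?par u = v" "?par c1 = v" "u \<noteq> c1" using pu c1F uF by auto
      then show ?thesis using True unfolding two_kids_def by blast
    next
      case False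
      have pU: "p \<in> U - X" using p False by blast
      obtain c c' where c: "par c = p" "par c' = p" "c \<noteq> c'" using two[OF pU] unfolding two_kids_def by blast
      define g where "g d = (if d = u then v else d)" for d
      have g: "?par (g d) = p" "d \<noteq> v" if "par d = p" for d
      proof -
        show dv: "d \<noteq> v" using that kid[of v] pU v by auto
        have "d \<notin> F" using that p F by auto
        then show "?par (g d) = p" using that pv dv vF unfolding g_def by (cases "d = u") simp_all
      qed
      have "g c \<noteq> g c'" using g(2)[OF c(1)] g(2)[OF c(2)] c(3) unfolding g_def by metis
      then show ?thesis using g(1)[OF c(1)] g(1)[OF c(2)] unfolding two_kids_def by blast
    qed
    show "?lab c \<noteq> ?lab (?par c)" if c: "c \<in> ?U - X" "c \<noteq> ?r" "c \<noteq> u" for c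
    proof (cases "c = v")
      case True
      then have "u \<noteq> r" using c by auto
      then show ?thesis using True alt[OF u(1)] pv v(3)[of u] vu by auto
    next
      case False
      then have cU: "c \<in> U - X" "c \<noteq> r" using c by (auto split: if_splits)
      have "par c = u" if "c \<in> F" using that F by blast
      then show ?thesis using alt[OF cU] False c v(3)[of c] by auto
    qed
  qed auto
qed

end

section \<open>Reasoning about programs\<close>

text \<open>A weakest precondition for total correctness.  The postcondition also sees a clock, which starts at
  \<open>t\<close> and advances with every step; so time bounds are part of assertions.\<close>

definition wp :: "com \<Rightarrow> (state \<Rightarrow> nat \<Rightarrow> bool) \<Rightarrow> state \<Rightarrow> nat \<Rightarrow> bool" where
  "wp c Q s t \<longleftrightarrow> (\<exists>t' s'. exec c s t' s' \<and> Q s' (t + t'))"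

lemma wp_exec: "exec c s t' s' \<Longrightarrow> wp c Q s t \<longleftrightarrow> Q s' (t + t')"
  unfolding wp_def using exec_deterministic by metis

lemma wp_Seq: "wp (Seq c1 c2) Q s t \<longleftrightarrow> wp c1 (wp c2 Q) s t"
proof
  assume "wp (Seq c1 c2) Q s t"
  then obtain t' s' where *: "exec (Seq c1 c2) s t' s'" "Q s' (t + t')" unfolding wp_def by blast
  from *(1) show "wp c1 (wp c2 Q) s t"
    by (rule exec_SeqE) (use *(2) in \<open>auto simp: wp_def add.assoc\<close>)
next
  assume "wp c1 (wp c2 Q) s t"
  then obtain t1 s1 t2 s2 where "exec c1 s t1 s1" "exec c2 s1 t2 s2" "Q s2 (t + t1 + t2)"
    unfolding wp_def by blast
  then have "exec (Seq c1 c2) s (t1 + t2) s2" "Q s2 (t + (t1 + t2))"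
    by (simp_all add: exec.Seq add.assoc)
  then show "wp (Seq c1 c2) Q s t" unfolding wp_def by blast
qed

lemma wp_Cond: "wp (Cond b c1 c2) Q s t \<longleftrightarrow> (if testval b s then wp c1 Q s (t + 1) else wp c2 Q s (t + 1))"
proof
  assume "wp (Cond b c1 c2) Q s t"
  then obtain t' s' where *: "exec (Cond b c1 c2) s t' s'" "Q s' (t + t')" unfolding wp_def by blast
  from *(1) show "if testval b s then wp c1 Q s (t + 1) else wp c2 Q s (t + 1)"
    by (rule exec_CondE) (use *(2) in \<open>auto simp: wp_def\<close>)
next
  assume a: "if testval b s then wp c1 Q s (t + 1) else wp c2 Q s (t + 1)"
  then obtain t' s' where "exec (if testval b s then c1 else c2) s t' s'" "Q s' (t + 1 + t')"
    unfolding wp_def by (auto split: if_splits)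
  then have "exec (Cond b c1 c2) s (1 + t') s'" "Q s' (t + (1 + t'))"
    using exec.CondTrue[of b s c1 t' s' c2] exec.CondFalse[of b s c2 t' s' c1] by (auto split: if_splits)
  then show "wp (Cond b c1 c2) Q s t" unfolding wp_def by blast
qed

lemma wp_atomic:
  "wp Skip Q s t \<longleftrightarrow> Q s (t + 1)"
  "wp (Assign x a) Q s t \<longleftrightarrow> Q (set_reg x (opval a s) s) (t + 1)"
  "wp (Incr x) Q s t \<longleftrightarrow> Q (set_reg x (reg s x + 1) s) (t + 1)"
  "wp (Decr x) Q s t \<longleftrightarrow> Q (set_reg x (reg s x - 1) s) (t + 1)"
  "wp (Load x A a) Q s t \<longleftrightarrow> Q (set_reg x (arr s A (opval a s)) s) (t + 1)"
  "wp (Store A a b) Q s t \<longleftrightarrow> Q (set_arr A (opval a s) (opval b s) s) (t + 1)"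
  "wp (PConst p k) Q s t \<longleftrightarrow> Q (set_preg p [:k:] s) (t + 1)"
  "wp (PVar p) Q s t \<longleftrightarrow> Q (set_preg p [:0, 1:] s) (t + 1)"
  "wp (PAdd p q r) Q s t \<longleftrightarrow> Q (set_preg p (preg s q + preg s r) s) (t + 1)"
  "wp (PMult p q r) Q s t \<longleftrightarrow> Q (set_preg p (preg s q * preg s r) s) (t + 1)"
  "wp (PSmult p k q) Q s t \<longleftrightarrow> Q (set_preg p (smult k (preg s q)) s) (t + 1)"
  "wp (PLoad p P a) Q s t \<longleftrightarrow> Q (set_preg p (parr s P (opval a s)) s) (t + 1)"
  "wp (PStore P a p) Q s t \<longleftrightarrow> Q (set_parr P (opval a s) (preg s p) s) (t + 1)"
  by (rule wp_exec, rule exec.intros)+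

lemma wp_mono: "wp c Q s t \<Longrightarrow> (\<And>s' t'. Q s' t' \<Longrightarrow> R s' t') \<Longrightarrow> wp c R s t"
  unfolding wp_def by blast

text \<open>Since each iteration advances the clock, a bound on the clock in the invariant
  implies termination.\<close>

lemma wp_While:
  assumes "I s t"
    and body: "\<And>s t. I s t \<Longrightarrow> testval b s \<Longrightarrow> wp c I s (t + 1)"
    and exit: "\<And>s t. I s t \<Longrightarrow> \<not> testval b s \<Longrightarrow> Q s (t + 1)"
    and bound: "\<And>s t. I s t \<Longrightarrow> t \<le> T"
  shows "wp (While b c) Q s t"
  using assms(1)
proof (induction "T - t" arbitrary: s t rule: less_induct)
  case less
  show ?case
  proof (cases "testval b s")
    case True
    then obtain t1 s1 where 1: "exec c s t1 s1" "I s1 (t + 1 + t1)"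
      using body[OF less.prems] unfolding wp_def by blast
    have "T - (t + 1 + t1) < T - t" using bound[OF 1(2)] by simp
    then have "wp (While b c) Q s1 (t + 1 + t1)" using less.hyps 1 by blast
    then obtain t2 s2 where 2: "exec (While b c) s1 t2 s2" "Q s2 (t + 1 + t1 + t2)" unfolding wp_def by blast
    have "exec (While b c) s (1 + t1 + t2) s2" using exec.WhileTrue True 1 2 by blast
    moreover have "Q s2 (t + (1 + t1 + t2))" using 2 by (simp add: add.assoc)
    ultimately show ?thesis unfolding wp_def by blast
  next
    case False
    then show ?thesis using exit[OF less.prems] exec.WhileFalse unfolding wp_def by blast
  qed
qed

lemma state_simps [simp]:
  "reg (set_reg x k s) y = (if y = x then k else reg s y)" "arr (set_reg x k s) = arr s"
  "preg (set_reg x k s) = preg s" "parr (set_reg x k s) = parr s"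
  "reg (set_arr A i k s) = reg s" "arr (set_arr A i k s) B = (if B = A then (arr s A)(i := k) else arr s B)"
  "preg (set_arr A i k s) = preg s" "parr (set_arr A i k s) = parr s"
  "reg (set_preg p f s) = reg s" "arr (set_preg p f s) = arr s"
  "preg (set_preg p f s) q = (if q = p then f else preg s q)" "parr (set_preg p f s) = parr s"
  "reg (set_parr P i f s) = reg s" "arr (set_parr P i f s) = arr s"
  "preg (set_parr P i f s) = preg s" "parr (set_parr P i f s) R = (if R = P then (parr s P)(i := f) else parr s R)"
  by (simp_all add: set_reg_def set_arr_def set_preg_def set_parr_def)

lemmas wp_simps = wp_Seq wp_Cond wp_atomic

definition frame :: "vname set \<Rightarrow> vname set \<Rightarrow> state \<Rightarrow> state \<Rightarrow> bool" where
  "frame R A s s' \<longleftrightarrow> (\<forall>x. x \<notin> R \<longrightarrow> reg s' x = reg s x) \<and> (\<forall>a. a \<notin> A \<longrightarrow> arr s' a = arr s a) \<and>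
     preg s' = preg s \<and> parr s' = parr s"

lemma frame_refl: "frame R A s s"
  by (simp add: frame_def)

lemma frameD:
  assumes "frame R A s s'"
  shows "x \<notin> R \<Longrightarrow> reg s' x = reg s x" "a \<notin> A \<Longrightarrow> arr s' a = arr s a" "preg s' = preg s" "parr s' = parr s"
  using assms by (auto simp: frame_def)

lemma frame_trans: "frame R A s s' \<Longrightarrow> frame R' A' s' s'' \<Longrightarrow> R \<subseteq> R2 \<Longrightarrow> R' \<subseteq> R2 \<Longrightarrow> A \<subseteq> A2 \<Longrightarrow> A' \<subseteq> A2 \<Longrightarrow> frame R2 A2 s s''"
  unfolding frame_def by (metis subsetD)

lemma frame_set_reg: "x \<in> R \<Longrightarrow> frame R A s (set_reg x k s') \<longleftrightarrow> frame R A s s'"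
  and frame_set_arr: "a \<in> A \<Longrightarrow> frame R A s (set_arr a i k s') \<longleftrightarrow> frame R A s s'"
  unfolding frame_def by auto

abbreviation (input) seq :: "com \<Rightarrow> com \<Rightarrow> com" (infixr ";;" 60) where "c1 ;; c2 \<equiv> Seq c1 c2"

lemma map_upt_push: "map (f(m := y)) [0..<Suc m] = map f [0..<m] @ [y]"
  by simp

section \<open>Stacks of children\<close>

text \<open>Stacks are linked lists of cells that are written once.  Cells with numbers from \<open>k\<close> on are unused, so
  writing to a new cell disturbs no existing stack (\<open>stack_push\<close>).  The end of a stack is not marked: a search always succeeds before it gets there.\<close>

fun stack :: "(nat \<Rightarrow> nat) \<Rightarrow> (nat \<Rightarrow> nat) \<Rightarrow> nat \<Rightarrow> nat \<Rightarrow> nat list \<Rightarrow> bool" where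
  "stack nx vl k h [] \<longleftrightarrow> True"
| "stack nx vl k h (c # cs) \<longleftrightarrow> h < k \<and> vl h = c \<and> stack nx vl k (nx h) cs"

lemma stack_push: "stack nx vl k h cs \<Longrightarrow> stack (nx(k := h')) (vl(k := c)) (Suc k) h cs"
  by (induction cs arbitrary: h) auto

definition link :: "vname \<Rightarrow> vname \<Rightarrow> com" where
  "link c p = Store ''par'' (Reg c) (Reg p) ;; Store ''val'' (Reg ''cell'') (Reg c) ;;
     Load ''h'' ''head'' (Reg p) ;; Store ''next'' (Reg ''cell'') (Reg ''h'') ;;
     Store ''head'' (Reg p) (Reg ''cell'') ;; Incr ''cell''"

text \<open>The effect of \<open>link\<close> on the state: \<open>c\<close> becomes a child of \<open>p\<close> and the top of its stack.\<close>

definition linked :: "nat \<Rightarrow> nat \<Rightarrow> state \<Rightarrow> state" where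
  "linked c p s = s\<lparr>
     reg := (reg s)(''h'' := arr s ''head'' p, ''cell'' := Suc (reg s ''cell'')),
     arr := (arr s)(''par'' := (arr s ''par'')(c := p), ''val'' := (arr s ''val'')(reg s ''cell'' := c),
       ''next'' := (arr s ''next'')(reg s ''cell'' := arr s ''head'' p),
       ''head'' := (arr s ''head'')(p := reg s ''cell''))\<rparr>"

lemma linked_simps [simp]:
  "reg (linked c p s) y = (if y = ''h'' then arr s ''head'' p else if y = ''cell'' then Suc (reg s ''cell'') else reg s y)"
  "arr (linked c p s) ''par'' = (arr s ''par'')(c := p)"
  "arr (linked c p s) ''val'' = (arr s ''val'')(reg s ''cell'' := c)"
  "arr (linked c p s) ''next'' = (arr s ''next'')(reg s ''cell'' := arr s ''head'' p)"
  "arr (linked c p s) ''head'' = (arr s ''head'')(p := reg s ''cell'')"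
  "a \<notin> {''par'', ''val'', ''next'', ''head''} \<Longrightarrow> arr (linked c p s) a = arr s a"
  "preg (linked c p s) = preg s" "parr (linked c p s) = parr s"
  by (auto simp: linked_def)

lemma wp_link:
  assumes "c \<noteq> ''h''" "p \<noteq> ''h''" "c \<noteq> ''cell''" "p \<noteq> ''cell''"
  shows "wp (link c p) Q s t \<longleftrightarrow> Q (linked (reg s c) (reg s p) s) (t + 6)"
proof -
  have eq: "set_reg ''cell'' (Suc (reg s ''cell'')) (set_arr ''head'' (reg s p) (reg s ''cell'')
     (set_arr ''next'' (reg s ''cell'') (arr s ''head'' (reg s p))
       (set_reg ''h'' (arr s ''head'' (reg s p))
         (set_arr ''val'' (reg s ''cell'') (reg s c)
           (set_arr ''par'' (reg s c) (reg s p) s))))) = linked (reg s c) (reg s p) s"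
    by (rule state.equality) (auto simp: linked_def set_reg_def set_arr_def fun_eq_iff)
  show ?thesis using assms by (simp add: link_def wp_simps eq numeral_eq_Suc)
qed

text \<open>Every child of a node is on its stack, but entries for children that have moved away stay there.
  Pointers to \<open>0\<close>, which is a leaf, mean that there is no parent, and the stack of the super-root \<open>S\<close> serves
  only to find the root on its top.\<close>

definition stacks :: "state \<Rightarrow> nat \<Rightarrow> (nat \<Rightarrow> nat list) \<Rightarrow> bool" where
  "stacks s S ch \<longleftrightarrow>
     (\<forall>p. stack (arr s ''next'') (arr s ''val'') (reg s ''cell'') (arr s ''head'' p) (ch p)) \<and>
     (\<forall>c. arr s ''par'' c = 0 \<or> arr s ''par'' c = S \<or> c \<in> set (ch (arr s ''par'' c)))"

lemma stacks_cong:
  assumes "arr s' ''next'' = arr s ''next''" "arr s' ''val'' = arr s ''val''" "arr s' ''head'' = arr s ''head''"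
    "arr s' ''par'' = arr s ''par''" "reg s' ''cell'' = reg s ''cell''"
  shows "stacks s' S ch \<longleftrightarrow> stacks s S ch"
  using assms unfolding stacks_def by simp

lemma stacks_linked:
  assumes "stacks s S ch" shows "stacks (linked c p s) S (ch(p := c # ch p))"
  unfolding stacks_def
proof (intro conjI allI)
  fix q
  show "stack (arr (linked c p s) ''next'') (arr (linked c p s) ''val'') (reg (linked c p s) ''cell'')
      (arr (linked c p s) ''head'' q) ((ch(p := c # ch p)) q)"
    using assms unfolding stacks_def by (simp add: stack_push)
next
  fix d
  have "arr s ''par'' d = 0 \<or> arr s ''par'' d = S \<or> d \<in> set (ch (arr s ''par'' d))"
    using assms unfolding stacks_def by blast
  then show "arr (linked c p s) ''par'' d = 0 \<or> arr (linked c p s) ''par'' d = S \<or>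
      d \<in> set ((ch(p := c # ch p)) (arr (linked c p s) ''par'' d))"
    by auto
qed

lemma stacks_new:
  assumes "stacks s S ch" "\<And>c. arr s ''par'' c \<noteq> v" shows "stacks s S (ch(v := []))"
  using assms unfolding stacks_def by auto

lemma stacks_unlink:
  assumes "stacks s S ch" shows "stacks (set_arr ''par'' c 0 s) S ch"
  using assms unfolding stacks_def by auto

section \<open>Finding the place of a new vertex\<close>

subsection \<open>Collecting the earlier neighbours\<close>

definition collect_step :: com where
  "collect_step = Load ''c'' ''adj'' (Reg ''i'') ;;
     Cond (Less (Reg ''c'') (Reg ''x'')) (Store ''queue'' (Reg ''q'') (Reg ''c'') ;; Incr ''q'') Skip ;;
     Incr ''i''"

definition collect :: com where
  "collect = Assign ''q'' (Const 0) ;; Load ''i'' ''off'' (Reg ''x'') ;; Assign ''h'' (Reg ''x'') ;; Incr ''h'' ;;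
     Load ''e'' ''off'' (Reg ''h'') ;;
     While (Less (Reg ''i'') (Reg ''e''))
       collect_step"

lemma wp_collect:
  assumes off: "arr s ''off'' (reg s ''x'') = a" "arr s ''off'' (Suc (reg s ''x'')) = a + length ys"
    and adj: "\<And>j. j < length ys \<Longrightarrow> arr s ''adj'' (a + j) = ys ! j"
  shows "wp collect (\<lambda>s' t'. frame {''q'', ''i'', ''h'', ''e'', ''c''} {''queue''} s s' \<and>
      map (arr s' ''queue'') [0..<reg s' ''q''] = filter (\<lambda>y. y < reg s ''x'') ys \<and>
      t' \<le> t + 6 + 6 * length ys) s t"
proof -
  let ?R = "{''q'', ''i'', ''h'', ''e'', ''c''}" and ?A = "{''queue''}"
  define I where "I s' t' \<longleftrightarrow> (\<exists>j. j \<le> length ys \<and> frame ?R ?A s s' \<and> reg s' ''i'' = a + j \<and>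
      reg s' ''e'' = a + length ys \<and>
      map (arr s' ''queue'') [0..<reg s' ''q''] = filter (\<lambda>y. y < reg s ''x'') (take j ys) \<and>
      t' \<le> t + 5 + 6 * j)" for s' t'
  have "wp (While (Less (Reg ''i'') (Reg ''e''))
       collect_step) (\<lambda>s' t'. frame ?R ?A s s' \<and>
      map (arr s' ''queue'') [0..<reg s' ''q''] = filter (\<lambda>y. y < reg s ''x'') ys \<and>
      t' \<le> t + 6 + 6 * length ys) s1 t1" if "I s1 t1" for s1 t1
  proof (rule wp_While[where I = I and T = "t + 5 + 6 * length ys"])
    fix s1 t1 assume "I s1 t1" "testval (Less (Reg ''i'') (Reg ''e'')) s1"
    then obtain j where j: "j < length ys" and fr: "frame ?R ?A s s1" and i: "reg s1 ''i'' = a + j"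
      "reg s1 ''e'' = a + length ys"
      and q: "map (arr s1 ''queue'') [0..<reg s1 ''q''] = filter (\<lambda>y. y < reg s ''x'') (take j ys)"
      and t1: "t1 \<le> t + 5 + 6 * j"
      unfolding I_def by auto
    have x: "reg s1 ''x'' = reg s ''x''" "arr s1 ''adj'' = arr s ''adj''"
      using frameD(1,2)[OF fr] by simp_all
    have tk: "take (Suc j) ys = take j ys @ [ys ! j]" using j by (simp add: take_Suc_conv_app_nth)
    have "\<exists>j'. j' \<le> length ys \<and> reg s1 ''i'' + 1 = a + j' \<and> j' = Suc j" using j i by simp
    then show "wp collect_step I s1 (t1 + 1)"
      using j fr i q t1 x tk adj
      by (auto simp: collect_step_def wp_simps I_def frame_set_reg frame_set_arr simp del: upt_Suc intro!: exI[of _ "Suc j"])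
        (auto simp: map_upt_push)
  next
    fix s1 t1 assume "I s1 t1" "\<not> testval (Less (Reg ''i'') (Reg ''e'')) s1"
    then show "frame ?R ?A s s1 \<and>
      map (arr s1 ''queue'') [0..<reg s1 ''q''] = filter (\<lambda>y. y < reg s ''x'') ys \<and>
      t1 + 1 \<le> t + 6 + 6 * length ys" unfolding I_def by auto
  qed (use that in \<open>auto simp: I_def\<close>)
  then show ?thesis
    unfolding collect_def using off
    by (auto simp: wp_simps I_def frame_set_reg frame_set_arr frame_refl intro!: exI[of _ 0])
qed

subsection \<open>Marking the full nodes\<close>

context cotree
begin

text \<open>The queue \<open>Q\<close> receives the full nodes, of which the first \<open>i\<close> have been processed; \<open>T\<close> lists the nodes
  that have a processed child, and \<open>cnt\<close> counts the processed children.  The last two conditions say that an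
  inner node is queued exactly when its last child has been processed.  They keep \<open>Q\<close>
  free of repetitions, and make children precede their parents.\<close>

definition marks :: "nat set \<Rightarrow> nat list \<Rightarrow> nat list \<Rightarrow> (nat \<Rightarrow> nat) \<Rightarrow> nat \<Rightarrow> bool" where
  "marks N Q T cnt i \<longleftrightarrow> i \<le> length Q \<and> distinct Q \<and> distinct T \<and>
     set Q \<subseteq> {c \<in> U. L c \<subseteq> N} \<and> N \<subseteq> set Q \<and>
     (\<forall>p. cnt p = card {c \<in> set (take i Q). par c = p}) \<and> set T = par ` set (take i Q) \<and>
     (\<forall>p \<in> U - X. kids par p \<subseteq> set (take i Q) \<longrightarrow> p \<in> set Q) \<and>
     (\<forall>p \<in> set Q - X. kids par p \<subseteq> set (take i Q))"

lemma marks_start: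
  assumes "distinct Q" "set Q = N" "N \<subseteq> X"
  shows "marks N Q [] (\<lambda>_. 0) 0"
proof -
  have "set Q \<subseteq> {c \<in> U. L c \<subseteq> N}" using assms leaf XU by auto
  moreover have "kids par p \<noteq> {}" if "p \<in> U - X" for p using kids_ne that .
  ultimately show ?thesis using assms unfolding marks_def by simp blast
qed

text \<open>The super-root has a single child, but the entry \<open>2\<close> as its number of children, and thus is
  never queued.\<close>

lemma marks_step:
  assumes m: "marks N Q T cnt i" and i: "i < length Q" and c: "c = Q ! i" and p: "p = par c"
    and deg: "\<And>p. p \<in> U - X \<Longrightarrow> deg p = card (kids par p)" and degS: "deg S = 2"
  shows "marks N (if Suc (cnt p) = deg p then Q @ [p] else Q) (if cnt p = 0 then T @ [p] else T)
    (cnt(p := Suc (cnt p))) (Suc i)"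
proof -
  let ?P = "set (take i Q)" and ?P' = "set (take (Suc i) Q)"
  from m have dQ: "distinct Q" and dT: "distinct T" and QF: "set Q \<subseteq> {c \<in> U. L c \<subseteq> N}" and NQ: "N \<subseteq> set Q"
    and cnt: "\<And>p. cnt p = card {c \<in> ?P. par c = p}" and T: "set T = par ` ?P"
    and up: "\<And>p. p \<in> U - X \<Longrightarrow> kids par p \<subseteq> ?P \<Longrightarrow> p \<in> set Q"
    and down: "\<And>p. p \<in> set Q - X \<Longrightarrow> kids par p \<subseteq> ?P"
    unfolding marks_def by blast+
  have tk: "take (Suc i) Q = take i Q @ [c]" using i c by (simp add: take_Suc_conv_app_nth)
  then have P': "?P' = insert c ?P" by simp
  have "distinct (take (Suc i) Q)" using dQ by simp
  then have cP: "c \<notin> ?P" unfolding tk by simp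
  have cQ: "c \<in> set Q" using i c by simp
  then have cU: "c \<in> U" "L c \<subseteq> N" using QF by auto
  have PQ: "?P' \<subseteq> set Q" by (rule set_take_subset)
  have cnt': "(cnt(p := Suc (cnt p))) q = card {c \<in> ?P'. par c = q}" for q
  proof (cases "q = p")
    case True
    then have "{d \<in> ?P'. par d = q} = insert c {d \<in> ?P. par d = q}" using P' p by auto
    then show ?thesis using cP cnt[of p] True by simp
  next
    case False
    then have "{d \<in> ?P'. par d = q} = {d \<in> ?P. par d = q}" using P' p by auto
    then show ?thesis using cnt[of q] False by simp
  qed
  have pS: "p \<in> U - X" if "Suc (cnt p) = deg p"
  proof (rule ccontr)
    assume "p \<notin> U - X"
    then have "c = r" using parU cU p by blast
    then have "p = S" using p rootS by simp
    have "{d \<in> ?P'. par d = p} \<subseteq> {r}"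
      using PQ QF parU SU \<open>p = S\<close> by auto
    then have "card {d \<in> ?P'. par d = p} \<le> card {r}" by (intro card_mono) auto
    then show False using cnt'[of p] that degS \<open>p = S\<close> by simp
  qed
  have allkids: "kids par p \<subseteq> ?P'" if "Suc (cnt p) = deg p"
  proof -
    have fin: "finite (kids par p)" using kids_sub[OF pS[OF that]] finU finite_subset by blast
    have "card {d \<in> ?P'. par d = p} = card (kids par p)" using cnt'[of p] that deg[OF pS[OF that]] by simp
    then have "{d \<in> ?P'. par d = p} = kids par p" by (intro card_subset_eq fin) auto
    then show ?thesis by blast
  qed
  have pnew: "p \<notin> set Q" if "Suc (cnt p) = deg p"
  proof
    assume "p \<in> set Q"
    then have "kids par p \<subseteq> ?P" using down pS that by blast
    then show False using cP p by blast
  qed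
  have pF: "L p \<subseteq> N" if "Suc (cnt p) = deg p"
    using inner[OF pS[OF that]] allkids[OF that] PQ QF by blast
  let ?Q = "if Suc (cnt p) = deg p then Q @ [p] else Q"
  have tk': "take (Suc i) ?Q = take (Suc i) Q" using i by simp
  have up': "q \<in> set ?Q" if q: "q \<in> U - X" "kids par q \<subseteq> ?P'" for q
  proof (cases "q = p")
    case True
    then have "{d \<in> ?P'. par d = p} = kids par p" using q by blast
    then have "Suc (cnt p) = deg p" using cnt'[of p] deg q True by simp
    then show ?thesis using True by simp
  next
    case False
    then have "c \<notin> kids par q" using p by auto
    then have "kids par q \<subseteq> ?P" using q(2) unfolding P' by blast
    then show ?thesis using up q by auto
  qed
  have down': "kids par q \<subseteq> ?P'" if q: "q \<in> set ?Q - X" for q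
  proof (cases "q \<in> set Q")
    case True
    then show ?thesis using down q P' by blast
  next
    case False
    then have "Suc (cnt p) = deg p" "q = p" using q by (auto split: if_splits)
    then show ?thesis using allkids by blast
  qed
  have T': "cnt p = 0 \<longleftrightarrow> p \<notin> set T"
    unfolding cnt T by (auto simp: card_eq_0_iff)
  show ?thesis
    unfolding marks_def tk'
  proof (intro conjI allI ballI impI)
    show "set (if cnt p = 0 then T @ [p] else T) = par ` ?P'" using T' T P' p by auto
    show "set ?Q \<subseteq> {c \<in> U. L c \<subseteq> N}" using QF pF pS by auto
  qed (use i dQ dT pnew T' NQ cnt' up' down' in \<open>auto split: if_splits\<close>)
qed

lemma marks_end:
  assumes m: "marks N Q T cnt (length Q)"
  shows "set Q = {c \<in> U. L c \<subseteq> N}" "\<And>p. cnt p = card {c \<in> {c \<in> U. L c \<subseteq> N}. par c = p}"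
    "set T = par ` {c \<in> U. L c \<subseteq> N}"
proof -
  from m have QF: "set Q \<subseteq> {c \<in> U. L c \<subseteq> N}" and NQ: "N \<subseteq> set Q"
    and up: "\<And>p. p \<in> U - X \<Longrightarrow> kids par p \<subseteq> set Q \<Longrightarrow> p \<in> set Q"
    unfolding marks_def by auto
  show Q: "set Q = {c \<in> U. L c \<subseteq> N}" using marks_closed[OF NQ up] QF by blast
  show "\<And>p. cnt p = card {c \<in> {c \<in> U. L c \<subseteq> N}. par c = p}" "set T = par ` {c \<in> U. L c \<subseteq> N}"
    using m unfolding Q[symmetric] marks_def by auto
qed

end

definition mark_step :: com where
  "mark_step = Load ''c'' ''queue'' (Reg ''i'') ;; Load ''p'' ''par'' (Reg ''c'') ;; Load ''h'' ''cnt'' (Reg ''p'') ;;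
     Cond (Eq (Reg ''h'') (Const 0)) (Store ''touched'' (Reg ''tq'') (Reg ''p'') ;; Incr ''tq'') Skip ;;
     Incr ''h'' ;; Store ''cnt'' (Reg ''p'') (Reg ''h'') ;; Load ''e'' ''deg'' (Reg ''p'') ;;
     Cond (Eq (Reg ''h'') (Reg ''e'')) (Store ''queue'' (Reg ''q'') (Reg ''p'') ;; Incr ''q'') Skip ;;
     Incr ''i''"

definition mark :: com where
  "mark = Assign ''tq'' (Const 0) ;; Assign ''i'' (Const 0) ;; While (Less (Reg ''i'') (Reg ''q'')) mark_step"

abbreviation queue :: "state \<Rightarrow> nat list" where "queue s \<equiv> map (arr s ''queue'') [0..<reg s ''q'']"
abbreviation touched_list :: "state \<Rightarrow> nat list" where "touched_list s \<equiv> map (arr s ''touched'') [0..<reg s ''tq'']"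

abbreviation mark_regs :: "vname set" where "mark_regs \<equiv> {''c'', ''p'', ''h'', ''e'', ''i'', ''q'', ''tq''}"
abbreviation mark_arrs :: "vname set" where "mark_arrs \<equiv> {''cnt'', ''touched'', ''queue''}"

lemma wp_mark_step:
  assumes p: "p = arr s ''par'' (arr s ''queue'' (reg s ''i''))"
    and Q: "\<And>s' t'. frame mark_regs mark_arrs s s' \<Longrightarrow>
      reg s' ''c'' = arr s ''queue'' (reg s ''i'') \<Longrightarrow> reg s' ''p'' = p \<Longrightarrow>
      queue s' = (if Suc (arr s ''cnt'' p) = arr s ''deg'' p then queue s @ [p] else queue s) \<Longrightarrow>
      touched_list s' = (if arr s ''cnt'' p = 0 then touched_list s @ [p] else touched_list s) \<Longrightarrow>
      arr s' ''cnt'' = (arr s ''cnt'')(p := Suc (arr s ''cnt'' p)) \<Longrightarrow>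
      reg s' ''i'' = Suc (reg s ''i'') \<Longrightarrow> t' \<le> t + 13 \<Longrightarrow> Q s' t'"
  shows "wp mark_step Q s t"
  by (cases "arr s ''deg'' p = Suc (arr s ''cnt'' p)"; cases "arr s ''cnt'' p = 0";
      simp add: mark_step_def wp_simps p[symmetric] del: upt_Suc; rule Q;
      simp add: frame_set_reg frame_set_arr frame_refl map_upt_push)

context cotree
begin

lemma wp_mark:
  assumes par: "arr s ''par'' = par"
    and deg: "\<And>p. p \<in> U - X \<Longrightarrow> arr s ''deg'' p = card (kids par p)" and degS: "arr s ''deg'' S = 2"
    and cnt: "arr s ''cnt'' = (\<lambda>_. 0)"
    and q: "distinct (queue s)" "set (queue s) = N" "N \<subseteq> X"
  shows "wp mark (\<lambda>s' t'. frame mark_regs mark_arrs s s' \<and>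
    marks N (queue s') (touched_list s') (arr s' ''cnt'') (length (queue s')) \<and> t' \<le> t + 3 + 14 * card {c \<in> U. L c \<subseteq> N}) s t"
proof -
  define I where "I s' t' \<longleftrightarrow> frame mark_regs mark_arrs s s' \<and>
    marks N (queue s') (touched_list s') (arr s' ''cnt'') (reg s' ''i'') \<and> t' \<le> t + 2 + 14 * reg s' ''i''" for s' t'
  have bound: "i \<le> card {c \<in> U. L c \<subseteq> N}" if "marks N Q T cnt i" for Q T cnt i
  proof -
    have "i \<le> card (set Q)" "set Q \<subseteq> {c \<in> U. L c \<subseteq> N}"
      using that by (auto simp: marks_def distinct_card)
    then show ?thesis using card_mono[of "{c \<in> U. L c \<subseteq> N}" "set Q"] finU by simp
  qed
  have loop: "wp (While (Less (Reg ''i'') (Reg ''q'')) mark_step)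
     (\<lambda>s' t'. frame mark_regs mark_arrs s s' \<and>
    marks N (queue s') (touched_list s') (arr s' ''cnt'') (length (queue s')) \<and> t' \<le> t + 3 + 14 * card {c \<in> U. L c \<subseteq> N}) s1 t1"
    if "I s1 t1" for s1 t1
  proof (rule wp_While[where I = I and T = "t + 2 + 14 * card {c \<in> U. L c \<subseteq> N}"])
    fix s1 t1 assume I: "I s1 t1" and b: "testval (Less (Reg ''i'') (Reg ''q'')) s1"
    then have fr: "frame mark_regs mark_arrs s s1" and m: "marks N (queue s1) (touched_list s1) (arr s1 ''cnt'') (reg s1 ''i'')"
      and t1: "t1 \<le> t + 2 + 14 * reg s1 ''i''" unfolding I_def by auto
    have eq: "arr s1 ''par'' = par" "arr s1 ''deg'' = arr s ''deg''" using frameD(2)[OF fr] par by simp_all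
    have i: "reg s1 ''i'' < length (queue s1)" using b by simp
    then have c: "arr s1 ''queue'' (reg s1 ''i'') = queue s1 ! reg s1 ''i''" by simp
    show "wp mark_step I s1 (t1 + 1)"
    proof (rule wp_mark_step[OF refl])
      fix s2 t2 assume fr2: "frame mark_regs mark_arrs s1 s2" and *:
        "queue s2 = (if Suc (arr s1 ''cnt'' (arr s1 ''par'' (arr s1 ''queue'' (reg s1 ''i'')))) =
           arr s1 ''deg'' (arr s1 ''par'' (arr s1 ''queue'' (reg s1 ''i'')))
           then queue s1 @ [arr s1 ''par'' (arr s1 ''queue'' (reg s1 ''i''))] else queue s1)"
        "touched_list s2 = (if arr s1 ''cnt'' (arr s1 ''par'' (arr s1 ''queue'' (reg s1 ''i''))) = 0
           then touched_list s1 @ [arr s1 ''par'' (arr s1 ''queue'' (reg s1 ''i''))] else touched_list s1)"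
        "arr s2 ''cnt'' = (arr s1 ''cnt'')(arr s1 ''par'' (arr s1 ''queue'' (reg s1 ''i'')) :=
           Suc (arr s1 ''cnt'' (arr s1 ''par'' (arr s1 ''queue'' (reg s1 ''i'')))))"
        "reg s2 ''i'' = Suc (reg s1 ''i'')" "t2 \<le> t1 + 1 + 13"
      have "marks N (queue s2) (touched_list s2) (arr s2 ''cnt'') (Suc (reg s1 ''i''))"
        unfolding * eq by (rule marks_step[OF m i c refl]) (use deg degS in auto)
      then show "I s2 t2" unfolding I_def using frame_trans[OF fr fr2] * t1 by simp
    qed
  next
    fix s1 t1 assume I: "I s1 t1" and b: "\<not> testval (Less (Reg ''i'') (Reg ''q'')) s1"
    then have "reg s1 ''i'' = length (queue s1)" unfolding I_def marks_def by simp
    then show "frame mark_regs mark_arrs s s1 \<and> marks N (queue s1) (touched_list s1) (arr s1 ''cnt'') (length (queue s1)) \<and>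
        t1 + 1 \<le> t + 3 + 14 * card {c \<in> U. L c \<subseteq> N}"
      using I bound unfolding I_def by fastforce
  next
    fix s1 t1 assume "I s1 t1"
    then show "t1 \<le> t + 2 + 14 * card {c \<in> U. L c \<subseteq> N}" using bound unfolding I_def by fastforce
  qed (use that in simp)
  show ?thesis
    unfolding mark_def wp_simps
    by (rule loop) (use marks_start[OF q] cnt in \<open>simp add: I_def frame_set_reg frame_refl\<close>)
qed

end

subsection \<open>Finding the node to split\<close>

definition flag_step :: com where
  "flag_step = Load ''w'' ''touched'' (Reg ''i'') ;; Load ''h'' ''cnt'' (Reg ''w'') ;; Load ''e'' ''deg'' (Reg ''w'') ;;
      Cond (Eq (Reg ''h'') (Reg ''e'')) Skip
        (Load ''p'' ''par'' (Reg ''w'') ;; Store ''flag'' (Reg ''p'') (Reg ''x'') ;;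
         Load ''p'' ''par'' (Reg ''p'') ;; Store ''flag'' (Reg ''p'') (Reg ''x'')) ;;
      Incr ''i''"

definition flag_loop :: com where
  "flag_loop = Assign ''i'' (Const 0) ;; While (Less (Reg ''i'') (Reg ''tq''))
     flag_step"

lemma wp_flag_loop:
  assumes T: "touched_list s = T" and B: "B = {w \<in> set T. arr s ''cnt'' w \<noteq> arr s ''deg'' w}"
    and par: "par = arr s ''par''"
  shows "wp flag_loop (\<lambda>s' t'. frame {''i'', ''w'', ''h'', ''e'', ''p''} {''flag''} s s' \<and>
     arr s' ''flag'' = (\<lambda>p. if p \<in> par ` B \<union> (par \<circ> par) ` B then reg s ''x'' else arr s ''flag'' p) \<and>
     t' \<le> t + 2 + 10 * length T) s t"
proof -
  let ?R = "{''i'', ''w'', ''h'', ''e'', ''p''}" and ?A = "{''flag''}"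
  define C where "C i = {w \<in> set (take i T). arr s ''cnt'' w \<noteq> arr s ''deg'' w}" for i
  define I where "I s' t' \<longleftrightarrow> frame ?R ?A s s' \<and> reg s' ''i'' \<le> length T \<and>
     arr s' ''flag'' = (\<lambda>p. if p \<in> par ` C (reg s' ''i'') \<union> (par \<circ> par) ` C (reg s' ''i'')
       then reg s ''x'' else arr s ''flag'' p) \<and>
     t' \<le> t + 1 + 10 * reg s' ''i''" for s' t'
  have lenT: "length T = reg s ''tq''" using T by auto
  have loop: "wp (While (Less (Reg ''i'') (Reg ''tq'')) flag_step) (\<lambda>s' t'. frame ?R ?A s s' \<and>
     arr s' ''flag'' = (\<lambda>p. if p \<in> par ` B \<union> (par \<circ> par) ` B then reg s ''x'' else arr s ''flag'' p) \<and>
     t' \<le> t + 2 + 10 * length T) s1 t1" if "I s1 t1" for s1 t1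
  proof (rule wp_While[where I = I and T = "t + 1 + 10 * length T"])
    fix s1 t1 assume I: "I s1 t1" and b: "testval (Less (Reg ''i'') (Reg ''tq'')) s1"
    have fr: "frame ?R ?A s s1" and fl: "arr s1 ''flag'' = (\<lambda>p. if p \<in> par ` C (reg s1 ''i'') \<union> (par \<circ> par) ` C (reg s1 ''i'')
       then reg s ''x'' else arr s ''flag'' p)" and t1: "t1 \<le> t + 1 + 10 * reg s1 ''i''" using I unfolding I_def by auto
    have eq: "arr s1 ''par'' = par" "arr s1 ''deg'' = arr s ''deg''" "arr s1 ''cnt'' = arr s ''cnt''"
      "arr s1 ''touched'' = arr s ''touched''" "reg s1 ''x'' = reg s ''x''" "reg s1 ''tq'' = reg s ''tq''"
      using frameD(1,2)[OF fr] par by simp_all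
    have i: "reg s1 ''i'' < length T" using b eq lenT by simp
    then have w: "arr s ''touched'' (reg s1 ''i'') = T ! reg s1 ''i''" using T lenT by auto
    define w where "w = T ! reg s1 ''i''"
    have C: "C (Suc (reg s1 ''i'')) = (if arr s ''cnt'' w \<noteq> arr s ''deg'' w then insert w (C (reg s1 ''i'')) else C (reg s1 ''i''))"
      using i unfolding C_def w_def by (auto simp: take_Suc_conv_app_nth)
    show "wp flag_step I s1 (t1 + 1)"
      using fr t1 i by (simp add: flag_step_def wp_simps eq w w_def[symmetric] I_def frame_set_reg frame_set_arr C fl fun_eq_iff)
  next
    fix s1 t1 assume I: "I s1 t1" and b: "\<not> testval (Less (Reg ''i'') (Reg ''tq'')) s1"
    have "reg s1 ''tq'' = reg s ''tq''" using I frameD(1)[of ?R ?A s s1] unfolding I_def by simp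
    then have "reg s1 ''i'' = length T" using I b lenT unfolding I_def by simp
    moreover have "C (length T) = B" unfolding C_def B by simp
    ultimately show "frame ?R ?A s s1 \<and>
     arr s1 ''flag'' = (\<lambda>p. if p \<in> par ` B \<union> (par \<circ> par) ` B then reg s ''x'' else arr s ''flag'' p) \<and>
     t1 + 1 \<le> t + 2 + 10 * length T" using I unfolding I_def by auto
  qed (use that in \<open>auto simp: I_def\<close>)
  show ?thesis
    unfolding flag_loop_def wp_simps
    by (rule loop) (simp add: I_def C_def frame_set_reg frame_refl)
qed

text \<open>The counters are reset on the way, for the next vertex.  The flags need no reset: a flag
  counts only if it equals the number of the vertex that is being inserted.\<close>

definition find_step :: com where
  "find_step = Load ''w'' ''touched'' (Reg ''i'') ;; Load ''h'' ''cnt'' (Reg ''w'') ;; Load ''e'' ''deg'' (Reg ''w'') ;;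
      Cond (Eq (Reg ''h'') (Reg ''e'')) Skip
        (Load ''e'' ''flag'' (Reg ''w'') ;; Cond (Eq (Reg ''e'') (Reg ''x'')) Skip (Assign ''u'' (Reg ''w''))) ;;
      Store ''cnt'' (Reg ''w'') (Const 0) ;; Incr ''i''"

definition find_loop :: com where
  "find_loop = Assign ''u'' (Reg ''n'') ;; Assign ''i'' (Const 0) ;; While (Less (Reg ''i'') (Reg ''tq''))
     find_step"

lemma wp_find_loop:
  assumes T: "touched_list s = T" "distinct T"
    and B: "B = {w \<in> set T. arr s ''cnt'' w \<noteq> arr s ''deg'' w \<and> arr s ''flag'' w \<noteq> reg s ''x''}"
  shows "wp find_loop (\<lambda>s' t'. frame {''i'', ''w'', ''h'', ''e'', ''u''} {''cnt''} s s' \<and>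
     arr s' ''cnt'' = (\<lambda>p. if p \<in> set T then 0 else arr s ''cnt'' p) \<and>
     (reg s' ''u'' \<in> B \<or> B = {} \<and> reg s' ''u'' = reg s ''n'') \<and>
     t' \<le> t + 3 + 10 * length T) s t"
proof -
  let ?R = "{''i'', ''w'', ''h'', ''e'', ''u''}" and ?A = "{''cnt''}"
  define C where "C i = {w \<in> set (take i T). arr s ''cnt'' w \<noteq> arr s ''deg'' w \<and> arr s ''flag'' w \<noteq> reg s ''x''}" for i
  define I where "I s' t' \<longleftrightarrow> frame ?R ?A s s' \<and> reg s' ''i'' \<le> length T \<and>
     arr s' ''cnt'' = (\<lambda>p. if p \<in> set (take (reg s' ''i'') T) then 0 else arr s ''cnt'' p) \<and>
     (reg s' ''u'' \<in> C (reg s' ''i'') \<or> C (reg s' ''i'') = {} \<and> reg s' ''u'' = reg s ''n'') \<and>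
     t' \<le> t + 2 + 10 * reg s' ''i''" for s' t'
  have lenT: "length T = reg s ''tq''" using T by auto
  have loop: "wp (While (Less (Reg ''i'') (Reg ''tq'')) find_step) (\<lambda>s' t'. frame ?R ?A s s' \<and>
     arr s' ''cnt'' = (\<lambda>p. if p \<in> set T then 0 else arr s ''cnt'' p) \<and>
     (reg s' ''u'' \<in> B \<or> B = {} \<and> reg s' ''u'' = reg s ''n'') \<and>
     t' \<le> t + 3 + 10 * length T) s1 t1" if "I s1 t1" for s1 t1
  proof (rule wp_While[where I = I and T = "t + 2 + 10 * length T"])
    fix s1 t1 assume I: "I s1 t1" and b: "testval (Less (Reg ''i'') (Reg ''tq'')) s1"
    have fr: "frame ?R ?A s s1" and cn: "arr s1 ''cnt'' = (\<lambda>p. if p \<in> set (take (reg s1 ''i'') T) then 0 else arr s ''cnt'' p)"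
      and u: "reg s1 ''u'' \<in> C (reg s1 ''i'') \<or> C (reg s1 ''i'') = {} \<and> reg s1 ''u'' = reg s ''n''"
      and t1: "t1 \<le> t + 2 + 10 * reg s1 ''i''" using I unfolding I_def by auto
    have eq: "arr s1 ''flag'' = arr s ''flag''" "arr s1 ''deg'' = arr s ''deg''"
      "arr s1 ''touched'' = arr s ''touched''" "reg s1 ''x'' = reg s ''x''" "reg s1 ''tq'' = reg s ''tq''"
      using frameD(1,2)[OF fr] by simp_all
    have i: "reg s1 ''i'' < length T" using b eq lenT by simp
    then have w: "arr s ''touched'' (reg s1 ''i'') = T ! reg s1 ''i''" using T lenT by auto
    define w where "w = T ! reg s1 ''i''"
    have tk: "set (take (Suc (reg s1 ''i'')) T) = insert w (set (take (reg s1 ''i'') T))"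
      using i unfolding w_def by (auto simp: take_Suc_conv_app_nth)
    have "distinct (take (Suc (reg s1 ''i'')) T)" using T by simp
    then have wn: "w \<notin> set (take (reg s1 ''i'') T)" using i unfolding w_def by (simp add: take_Suc_conv_app_nth)
    have C: "C (Suc (reg s1 ''i'')) = (if arr s ''cnt'' w \<noteq> arr s ''deg'' w \<and> arr s ''flag'' w \<noteq> reg s ''x''
        then insert w (C (reg s1 ''i'')) else C (reg s1 ''i''))"
      unfolding C_def tk by auto
    show "wp find_step I s1 (t1 + 1)"
      using fr t1 i u wn by (auto simp: find_step_def wp_simps eq w w_def[symmetric] I_def frame_set_reg frame_set_arr C cn tk fun_eq_iff)
  next
    fix s1 t1 assume I: "I s1 t1" and b: "\<not> testval (Less (Reg ''i'') (Reg ''tq'')) s1"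
    have "reg s1 ''tq'' = reg s ''tq''" using I frameD(1)[of ?R ?A s s1] unfolding I_def by simp
    then have "reg s1 ''i'' = length T" using I b lenT unfolding I_def by simp
    moreover have "C (length T) = B" unfolding C_def B by simp
    ultimately show "frame ?R ?A s s1 \<and>
     arr s1 ''cnt'' = (\<lambda>p. if p \<in> set T then 0 else arr s ''cnt'' p) \<and>
     (reg s1 ''u'' \<in> B \<or> B = {} \<and> reg s1 ''u'' = reg s ''n'') \<and>
     t1 + 1 \<le> t + 3 + 10 * length T" using I unfolding I_def by auto
  qed (use that in \<open>auto simp: I_def\<close>)
  show ?thesis
    unfolding find_loop_def wp_simps
    by (rule loop) (simp add: I_def C_def frame_set_reg frame_refl)
qed

subsection \<open>Moving the full children\<close>

text \<open>The program tests \<open>par\<close> of the queued nodes, all of which are full, instead of searching the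
  children of \<open>u\<close>, which may be too many.\<close>

definition move_step :: com where
  "move_step = Load ''c'' ''queue'' (Reg ''i'') ;; Load ''p'' ''par'' (Reg ''c'') ;;
      Cond (Eq (Reg ''p'') (Reg ''u''))
        (link ''c'' ''v'' ;; Load ''e'' ''deg'' (Reg ''v'') ;; Incr ''e'' ;; Store ''deg'' (Reg ''v'') (Reg ''e'') ;;
         Load ''e'' ''deg'' (Reg ''u'') ;; Decr ''e'' ;; Store ''deg'' (Reg ''u'') (Reg ''e'')) Skip ;;
      Incr ''i''"

definition move_loop :: com where
  "move_loop = Assign ''i'' (Const 0) ;; While (Less (Reg ''i'') (Reg ''q''))
     move_step"

lemma frame_linked: "{''h'', ''cell''} \<subseteq> R \<Longrightarrow> {''par'', ''val'', ''next'', ''head''} \<subseteq> A \<Longrightarrow>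
    frame R A s (linked c p s') \<longleftrightarrow> frame R A s s'"
proof -
  assume "{''h'', ''cell''} \<subseteq> R" "{''par'', ''val'', ''next'', ''head''} \<subseteq> A"
  then have "x \<notin> R \<Longrightarrow> reg (linked c p s') x = reg s' x" "a \<notin> A \<Longrightarrow> arr (linked c p s') a = arr s' a" for x a
    by (auto simp: linked_def)
  then show ?thesis unfolding frame_def by simp
qed

lemma wp_move_loop:
  assumes Q: "queue s = Q" "distinct Q" and uv: "reg s ''u'' = u" "reg s ''v'' = v" "u \<noteq> v"
    and F: "F = {c \<in> set Q. arr s ''par'' c = u}" and st: "stacks s S ch"
  shows "wp move_loop (\<lambda>s' t'. frame {''i'', ''c'', ''p'', ''h'', ''e'', ''cell''} {''par'', ''val'', ''next'', ''head'', ''deg''} s s' \<and>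
     arr s' ''par'' = (\<lambda>c. if c \<in> F then v else arr s ''par'' c) \<and>
     arr s' ''deg'' = (arr s ''deg'')(v := arr s ''deg'' v + card F, u := arr s ''deg'' u - card F) \<and>
     (\<exists>cs. length cs = card F \<and> stacks s' S (ch(v := cs @ ch v))) \<and>
     t' \<le> t + 2 + 17 * length Q) s t"
proof -
  let ?R = "{''i'', ''c'', ''p'', ''h'', ''e'', ''cell''}" and ?A = "{''par'', ''val'', ''next'', ''head'', ''deg''}"
  define G where "G i = {c \<in> set (take i Q). arr s ''par'' c = u}" for i
  define I where "I s' t' \<longleftrightarrow> frame ?R ?A s s' \<and> reg s' ''i'' \<le> length Q \<and>
     arr s' ''par'' = (\<lambda>c. if c \<in> G (reg s' ''i'') then v else arr s ''par'' c) \<and>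
     arr s' ''deg'' = (arr s ''deg'')(v := arr s ''deg'' v + card (G (reg s' ''i'')), u := arr s ''deg'' u - card (G (reg s' ''i''))) \<and>
     (\<exists>cs. length cs = card (G (reg s' ''i'')) \<and> stacks s' S (ch(v := cs @ ch v))) \<and>
     t' \<le> t + 1 + 17 * reg s' ''i''" for s' t'
  have lenQ: "length Q = reg s ''q''" using Q by auto
  have loop: "wp (While (Less (Reg ''i'') (Reg ''q'')) move_step) (\<lambda>s' t'. frame ?R ?A s s' \<and>
     arr s' ''par'' = (\<lambda>c. if c \<in> F then v else arr s ''par'' c) \<and>
     arr s' ''deg'' = (arr s ''deg'')(v := arr s ''deg'' v + card F, u := arr s ''deg'' u - card F) \<and>
     (\<exists>cs. length cs = card F \<and> stacks s' S (ch(v := cs @ ch v))) \<and>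
     t' \<le> t + 2 + 17 * length Q) s1 t1" if "I s1 t1" for s1 t1
  proof (rule wp_While[where I = I and T = "t + 1 + 17 * length Q"])
    fix s1 t1 assume I: "I s1 t1" and b: "testval (Less (Reg ''i'') (Reg ''q'')) s1"
    let ?i = "reg s1 ''i''"
    have fr: "frame ?R ?A s s1" and pa: "arr s1 ''par'' = (\<lambda>c. if c \<in> G ?i then v else arr s ''par'' c)"
      and de: "arr s1 ''deg'' = (arr s ''deg'')(v := arr s ''deg'' v + card (G ?i), u := arr s ''deg'' u - card (G ?i))"
      and t1: "t1 \<le> t + 1 + 17 * ?i" using I unfolding I_def by auto
    obtain cs where cs: "length cs = card (G ?i)" "stacks s1 S (ch(v := cs @ ch v))"
      using I unfolding I_def by blast
    have eq: "arr s1 ''queue'' = arr s ''queue''" "reg s1 ''u'' = u" "reg s1 ''v'' = v" "reg s1 ''q'' = reg s ''q''"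
      using frameD(1,2)[OF fr] uv by simp_all
    have i: "?i < length Q" using b eq lenQ by simp
    then have c: "arr s ''queue'' ?i = Q ! ?i" using Q lenQ by auto
    define c where "c = Q ! ?i"
    have tk: "set (take (Suc ?i) Q) = insert c (set (take ?i Q))"
      using i unfolding c_def by (auto simp: take_Suc_conv_app_nth)
    have "distinct (take (Suc ?i) Q)" using Q by simp
    then have cn: "c \<notin> set (take ?i Q)" using i unfolding c_def by (simp add: take_Suc_conv_app_nth)
    then have cG: "c \<notin> G ?i" unfolding G_def by simp
    have finG: "finite (G ?i)" unfolding G_def by simp
    have G: "G (Suc ?i) = (if arr s ''par'' c = u then insert c (G ?i) else G ?i)"
      unfolding G_def tk by auto
    have pc: "arr s1 ''par'' c = arr s ''par'' c" using pa cG by simp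
    show "wp move_step I s1 (t1 + 1)"
    proof (cases "arr s ''par'' c = u")
      case False
      have "stacks (set_reg ''i'' (Suc ?i) (set_reg ''p'' (arr s ''par'' c) (set_reg ''c'' c s1))) S (ch(v := cs @ ch v))"
        using cs(2) by (subst stacks_cong[where s = s1]) simp_all
      then show ?thesis
        using False fr t1 i cs(1)
        by (auto simp: move_step_def wp_simps eq c c_def[symmetric] I_def frame_set_reg pc G pa de cG)
    next
      case True
      let ?s = "linked c v (set_reg ''p'' u (set_reg ''c'' c s1))"
      have "stacks (set_reg ''p'' u (set_reg ''c'' c s1)) S (ch(v := cs @ ch v))"
        using cs(2) by (subst stacks_cong[where s = s1]) simp_all
      then have "stacks ?s S (ch(v := (c # cs) @ ch v))"
        using stacks_linked[of _ S "ch(v := cs @ ch v)" c v] by simp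
      moreover have "length (c # cs) = card (G (Suc ?i))" using cs(1) G True cG finG by simp
      moreover have "frame ?R ?A s ?s" using fr by (simp add: frame_linked frame_set_reg)
      ultimately show ?thesis
        using True t1 i uv(3)
        apply (simp add: move_step_def wp_simps wp_link eq c c_def[symmetric] pc I_def frame_set_reg frame_set_arr)
        apply (intro conjI)
          apply (force simp: pa G)
         apply (force simp: de G cG finG)
        apply (rule exI[of _ "c # cs"])
        apply (subst stacks_cong[where s = ?s])
             apply simp_all
        done
    qed
  next
    fix s1 t1 assume I: "I s1 t1" and b: "\<not> testval (Less (Reg ''i'') (Reg ''q'')) s1"
    have "reg s1 ''q'' = reg s ''q''" using I frameD(1)[of ?R ?A s s1] unfolding I_def by simp
    then have "reg s1 ''i'' = length Q" using I b lenQ unfolding I_def by simp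
    moreover have "G (length Q) = F" unfolding G_def F by simp
    ultimately show "frame ?R ?A s s1 \<and>
     arr s1 ''par'' = (\<lambda>c. if c \<in> F then v else arr s ''par'' c) \<and>
     arr s1 ''deg'' = (arr s ''deg'')(v := arr s ''deg'' v + card F, u := arr s ''deg'' u - card F) \<and>
     (\<exists>cs. length cs = card F \<and> stacks s1 S (ch(v := cs @ ch v))) \<and>
     t1 + 1 \<le> t + 2 + 17 * length Q" using I unfolding I_def by auto
  qed (use that in \<open>auto simp: I_def\<close>)
  have "stacks (set_reg ''i'' 0 s) S ch" using st by (subst stacks_cong[where s = s]) simp_all
  then show ?thesis
    unfolding move_loop_def wp_simps
    by (intro loop) (use uv in \<open>auto simp: I_def G_def frame_set_reg frame_refl intro!: exI[of _ "[]"]\<close>)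
qed

definition scan_step :: com where
  "scan_step = Load ''z'' ''val'' (Reg ''h'') ;; Load ''p'' ''par'' (Reg ''z'') ;;
      Cond (Eq (Reg ''p'') (Reg ''a'')) (Assign ''g'' (Const 0)) (Load ''h'' ''next'' (Reg ''h''))"

definition scan :: com where
  "scan = Load ''h'' ''head'' (Reg ''a'') ;; Assign ''g'' (Const 1) ;; While (Eq (Reg ''g'') (Const 1))
     scan_step"

text \<open>The entries on the stack whose parent pointer leads elsewhere are stale.\<close>

lemma wp_scan:
  assumes st: "stacks s S ch" and a: "reg s ''a'' = a" and ex: "c \<in> set (ch a)" "arr s ''par'' c = a"
  shows "wp scan (\<lambda>s' t'. frame {''h'', ''g'', ''z'', ''p''} {} s s' \<and>
     arr s ''par'' (reg s' ''z'') = a \<and> t' \<le> t + 3 + 5 * length (ch a)) s t"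
proof -
  let ?R = "{''h'', ''g'', ''z'', ''p''}"
  define I where "I s' t' \<longleftrightarrow> frame ?R {} s s' \<and>
     (reg s' ''g'' = 1 \<and> (\<exists>cs. c \<in> set cs \<and> stack (arr s ''next'') (arr s ''val'') (reg s ''cell'') (reg s' ''h'') cs \<and>
        t' + 5 * length cs \<le> t + 2 + 5 * length (ch a))
     \<or> reg s' ''g'' = 0 \<and> arr s ''par'' (reg s' ''z'') = a \<and> t' \<le> t + 2 + 5 * length (ch a))" for s' t'
  have loop: "wp (While (Eq (Reg ''g'') (Const 1)) scan_step) (\<lambda>s' t'. frame ?R {} s s' \<and>
     arr s ''par'' (reg s' ''z'') = a \<and> t' \<le> t + 3 + 5 * length (ch a)) s1 t1" if "I s1 t1" for s1 t1
  proof (rule wp_While[where I = I and T = "t + 2 + 5 * length (ch a)"])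
    fix s1 t1 assume I: "I s1 t1" and b: "testval (Eq (Reg ''g'') (Const 1)) s1"
    then have fr: "frame ?R {} s s1" and g: "reg s1 ''g'' = 1" unfolding I_def by auto
    obtain cs where cs: "c \<in> set cs" "stack (arr s ''next'') (arr s ''val'') (reg s ''cell'') (reg s1 ''h'') cs"
        "t1 + 5 * length cs \<le> t + 2 + 5 * length (ch a)" using I g unfolding I_def by auto
    have eq: "arr s1 = arr s" "reg s1 ''a'' = a" using frameD(1,2)[OF fr] a by (auto simp: fun_eq_iff)
    obtain d ds where ds: "cs = d # ds" using cs(1) by (cases cs) auto
    have d: "arr s ''val'' (reg s1 ''h'') = d" using cs(2) ds by simp
    show "wp scan_step I s1 (t1 + 1)"
    proof (cases "arr s ''par'' d = a")
      case True
      then show ?thesis using cs(3) fr ds by (auto simp: scan_step_def wp_simps eq d I_def frame_set_reg)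
    next
      case False
      then have "c \<in> set ds" using cs(1) ds ex(2) by auto
      then show ?thesis using False cs ds fr g by (auto simp: scan_step_def wp_simps eq d I_def frame_set_reg intro!: exI[of _ ds])
    qed
  next
    fix s1 t1 assume I: "I s1 t1" and b: "\<not> testval (Eq (Reg ''g'') (Const 1)) s1"
    then show "frame ?R {} s s1 \<and> arr s ''par'' (reg s1 ''z'') = a \<and> t1 + 1 \<le> t + 3 + 5 * length (ch a)"
      unfolding I_def by auto
  qed (use that in \<open>auto simp: I_def\<close>)
  have "stack (arr s ''next'') (arr s ''val'') (reg s ''cell'') (arr s ''head'' a) (ch a)"
    using st unfolding stacks_def by blast
  then show ?thesis
    unfolding scan_def wp_simps
    by (intro loop) (use a ex in \<open>auto simp: I_def frame_set_reg frame_refl intro!: exI[of _ "ch a"]\<close>)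
qed

section \<open>Inserting a vertex\<close>

subsection \<open>Grafting\<close>

lemma stacks_set_reg: "y \<noteq> ''cell'' \<Longrightarrow> stacks (set_reg y k s) S ch \<longleftrightarrow> stacks s S ch"
  by (rule stacks_cong) simp_all

lemma stacks_set_arr:
  "a \<noteq> ''par'' \<Longrightarrow> a \<noteq> ''val'' \<Longrightarrow> a \<noteq> ''next'' \<Longrightarrow> a \<noteq> ''head'' \<Longrightarrow> stacks (set_arr a i k s) S ch \<longleftrightarrow> stacks s S ch"
  by (rule stacks_cong) simp_all

definition bump :: "vname \<Rightarrow> com" where
  "bump p = Load ''e'' ''deg'' (Reg p) ;; Incr ''e'' ;; Store ''deg'' (Reg p) (Reg ''e'')"

definition graft :: com where
  "graft = Load ''l'' ''lab'' (Reg ''z'') ;;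
     Cond (Eq (Reg ''l'') (Reg ''o'')) (Assign ''w'' (Reg ''z''))
       (Assign ''w'' (Reg ''new'') ;; Incr ''new'' ;; Store ''lab'' (Reg ''w'') (Reg ''o'') ;;
        Load ''p'' ''par'' (Reg ''z'') ;; link ''w'' ''p'' ;; link ''z'' ''w'' ;; Store ''deg'' (Reg ''w'') (Const 1)) ;;
     link ''x'' ''w'' ;; bump ''w''"

abbreviation tree_arrs :: "vname set" where
  "tree_arrs \<equiv> {''par'', ''val'', ''next'', ''head'', ''deg'', ''lab''}"

lemma wp_graft_here:
  assumes st: "stacks s S ch" and l: "arr s ''lab'' z = reg s ''o''" and z: "reg s ''z'' = z" and x: "reg s ''x'' = x"
    and Q: "\<And>s' t'. frame {''l'', ''w'', ''p'', ''h'', ''cell'', ''e'', ''new''} tree_arrs s s' \<Longrightarrow> reg s' ''new'' = reg s ''new'' \<Longrightarrow>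
      arr s' ''par'' = (arr s ''par'')(x := z) \<Longrightarrow> arr s' ''lab'' = arr s ''lab'' \<Longrightarrow>
      arr s' ''deg'' = (arr s ''deg'')(z := Suc (arr s ''deg'' z)) \<Longrightarrow> stacks s' S (ch(z := x # ch z)) \<Longrightarrow>
      t' \<le> t + 12 \<Longrightarrow> Q s' t'"
  shows "wp graft Q s t"
  using l
  by (simp add: graft_def bump_def wp_simps wp_link z x, intro Q)
    (simp_all add: frame_set_reg frame_set_arr frame_linked frame_refl stacks_set_reg stacks_set_arr stacks_linked st z x)

lemma wp_graft_new:
  assumes st: "stacks s S ch" and l: "arr s ''lab'' z \<noteq> reg s ''o''" and z: "reg s ''z'' = z" and x: "reg s ''x'' = x"
    and w: "reg s ''new'' = w" "w \<noteq> z" "\<And>c. arr s ''par'' c \<noteq> w" and p: "arr s ''par'' z = p"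
    and Q: "\<And>s' t'. frame {''l'', ''w'', ''p'', ''h'', ''cell'', ''e'', ''new''} tree_arrs s s' \<Longrightarrow> reg s' ''new'' = Suc w \<Longrightarrow>
      arr s' ''par'' = (arr s ''par'')(w := p, z := w, x := w) \<Longrightarrow> arr s' ''lab'' = (arr s ''lab'')(w := reg s ''o'') \<Longrightarrow>
      arr s' ''deg'' = (arr s ''deg'')(w := 2) \<Longrightarrow> stacks s' S (ch(p := w # ch p, w := [x, z])) \<Longrightarrow>
      t' \<le> t + 30 \<Longrightarrow> Q s' t'"
  shows "wp graft Q s t"
proof -
  have pw: "p \<noteq> w" using w p by blast
  let ?s = "set_reg ''p'' p (set_arr ''lab'' w (reg s ''o'') (set_reg ''new'' (Suc w) (set_reg ''w'' w
     (set_reg ''l'' (arr s ''lab'' z) s))))"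
  have "stacks ?s S (ch(w := []))"
    using stacks_new[OF st w(3)] by (simp add: stacks_set_reg stacks_set_arr)
  then have "stacks (linked w p ?s) S (ch(w := [], p := w # ch p))"
    using stacks_linked[of ?s S "ch(w := [])" w p] pw by simp
  then have "stacks (linked z w (linked w p ?s)) S (ch(w := [z], p := w # ch p))"
    using stacks_linked[of "linked w p ?s" S "ch(w := [], p := w # ch p)" z w] pw by (simp add: fun_upd_twist)
  then have "stacks (set_arr ''deg'' w 1 (linked z w (linked w p ?s))) S (ch(w := [z], p := w # ch p))"
    by (simp add: stacks_set_arr)
  then have "stacks (linked x w (set_arr ''deg'' w 1 (linked z w (linked w p ?s)))) S (ch(p := w # ch p, w := [x, z]))"
    using stacks_linked[of "set_arr ''deg'' w 1 (linked z w (linked w p ?s))" S "ch(w := [z], p := w # ch p)" x w] pw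
    by (simp add: fun_upd_twist)
  note st' = this
  show ?thesis
    apply (simp add: graft_def bump_def wp_simps wp_link z x w(1) w(2) p l)
    apply (rule Q)
    subgoal by (simp add: frame_set_reg frame_set_arr frame_linked frame_refl)
    subgoal by simp
    subgoal by simp
    subgoal by simp
    subgoal by (simp add: numeral_2_eq_2)
    subgoal using st' by (simp add: stacks_set_reg stacks_set_arr)
    subgoal by simp
    done
qed

text \<open>The memory agrees with the tree.  Node numbers are the vertices below \<open>S\<close>, the super-root \<open>S\<close>, and the
  numbers of inner nodes from \<open>S + 1\<close> on, below the register \<open>new\<close>.\<close>

definition store :: "state \<Rightarrow> nat \<Rightarrow> nat \<Rightarrow> nat set \<Rightarrow> nat set \<Rightarrow> nat \<Rightarrow> (nat \<Rightarrow> nat list) \<Rightarrow> bool" where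
  "store s S x X U r ch \<longleftrightarrow> reg s ''n'' = S \<and> reg s ''x'' = x \<and> stacks s S ch \<and> ch S \<noteq> [] \<and> hd (ch S) = r \<and>
     (\<forall>p\<in>U - X. arr s ''deg'' p = card (kids (arr s ''par'') p)) \<and> arr s ''deg'' S = 2 \<and> arr s ''par'' S = S \<and>
     U \<subseteq> X \<union> {S<..<reg s ''new''} \<and> S < reg s ''new'' \<and>
     (\<forall>c. arr s ''par'' c = 0 \<or> S \<le> arr s ''par'' c \<and> arr s ''par'' c < reg s ''new'') \<and>
     (\<forall>c<S. arr s ''lab'' c = 0)"

text \<open>The credit for searching stacks: each entry that is pushed pays once for being passed by \<open>scan\<close>.\<close>

definition potential :: "nat set \<Rightarrow> (nat \<Rightarrow> nat list) \<Rightarrow> nat" where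
  "potential U ch = (\<Sum>p\<in>U. length (ch p))"

lemma potential_push:
  assumes "finite U" shows "potential U (ch(p := c # ch p)) \<le> Suc (potential U ch)"
proof (cases "p \<in> U")
  case True
  then have "potential U (ch(p := c # ch p)) = Suc (length (ch p)) + (\<Sum>q\<in>U - {p}. length (ch q))"
    unfolding potential_def using assms by (simp add: sum.remove)
  then show ?thesis unfolding potential_def using assms True by (simp add: sum.remove)
next
  case False
  then have "potential U (ch(p := c # ch p)) = potential U ch"
    unfolding potential_def by (intro sum.cong) auto
  then show ?thesis by simp
qed

lemma potential_new: "finite U \<Longrightarrow> v \<notin> U \<Longrightarrow> potential (insert v U) (ch(v := cs)) = length cs + potential U ch"
proof -
  assume "finite U" "v \<notin> U"
  moreover have "(\<Sum>p\<in>U. length ((ch(v := cs)) p)) = potential U ch"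
    unfolding potential_def using \<open>v \<notin> U\<close> by (intro sum.cong) auto
  ultimately show ?thesis unfolding potential_def by simp
qed

lemma potential_remove: "finite U \<Longrightarrow> a \<in> U \<Longrightarrow> potential U ch = length (ch a) + potential (U - {a}) ch"
  unfolding potential_def by (rule sum.remove)

lemma storeD:
  assumes "store s S x X U r ch"
  shows "reg s ''n'' = S" "reg s ''x'' = x" "stacks s S ch" "ch S \<noteq> []" "hd (ch S) = r"
    "\<And>p. p \<in> U - X \<Longrightarrow> arr s ''deg'' p = card (kids (arr s ''par'') p)" "arr s ''deg'' S = 2" "arr s ''par'' S = S"
    "U \<subseteq> X \<union> {S<..<reg s ''new''}" "S < reg s ''new''"
    "\<And>c. arr s ''par'' c = 0 \<or> S \<le> arr s ''par'' c \<and> arr s ''par'' c < reg s ''new''"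
    "\<And>c. c < S \<Longrightarrow> arr s ''lab'' c = 0"
  using assms unfolding store_def by blast+

lemma store_fresh:
  assumes "store s S x X U r ch" "\<And>v. v \<in> X \<Longrightarrow> v < S"
  shows "reg s ''new'' \<notin> U" "reg s ''new'' \<noteq> S" "arr s ''par'' c \<noteq> reg s ''new''"
  using storeD(9,10)[OF assms(1)] storeD(11)[OF assms(1), of c] assms(2)[of "reg s ''new''"] by auto

lemma store_clear:
  assumes "store s S x X U r ch" "\<And>c. arr s ''par'' c \<noteq> v" "v \<noteq> S"
  shows "store s S x X U r (ch(v := []))"
  using assms stacks_new[of s S ch v] unfolding store_def by simp

lemma potential_clear: "v \<notin> U \<Longrightarrow> potential U (ch(v := cs)) = potential U ch"
  unfolding potential_def by (intro sum.cong) auto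

context graftable
begin

lemma wp_graft:
  assumes st0: "store s S x X U r ch0" and par: "arr s ''par'' = par" and lab: "arr s ''lab'' = lab"
    and z: "reg s ''z'' = z" and op: "reg s ''o'' = oper"
    and two: "z \<in> X \<or> two_kids par z" and X: "X = {..<x}" "0 < x" "x < S"
  shows "wp graft (\<lambda>s' t'. frame {''l'', ''w'', ''p'', ''h'', ''cell'', ''e'', ''new''} tree_arrs s s' \<and>
     (\<exists>U' L' r' ch'. cotree E (insert x X) S U' (arr s' ''par'') (arr s' ''lab'') L' r' \<and>
        store s' S x (insert x X) U' r' ch' \<and> t' + 5 * potential U' ch' \<le> t + 50 + 5 * potential U ch0)) s t"
proof -
  \<comment> \<open>\<open>x\<close> becomes a node, so its stack, unused so far, starts to count for the potential.\<close>
  define ch where "ch = ch0(x := [])"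
  have xU: "x \<notin> U" using storeD(9)[OF st0] X by auto
  have xS: "x \<noteq> S" using X by simp
  have px: "par c \<noteq> x" for c using storeD(11)[OF st0, of c] X par by auto
  have st: "store s S x X U r ch" unfolding ch_def
    by (rule store_clear[OF st0 _ xS]) (use px par in simp)
  have pot: "potential U ch0 = potential U ch" unfolding ch_def using xU by (simp add: potential_clear)
  have chx: "ch x = []" unfolding ch_def by simp
  note sD = storeD[OF st]
  have zU: "z \<in> U" by (rule z_in)
  have XS: "v < S" if "v \<in> X" for v using that X by simp
  have kfin: "finite (kids par p)" if "p \<in> U - X" for p using kids_sub[OF that] finU finite_subset by blast
  have xk: "x \<notin> kids par p" if "p \<in> U - X" for p using kid[of x] that xU by auto
  have labX: "lab v = 0" if "v \<in> X" for v using sD(12)[OF XS[OF that]] lab by simp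
  show ?thesis
  proof (cases "lab z = oper")
    case True
    have zX: "z \<in> U - X" using labX[of z] True oper zU by auto
    have alt_z: "lab z \<noteq> lab (par z)" if "z \<noteq> r" using oper_ne[OF that] True by simp
    show ?thesis
    proof (rule wp_graft_here[OF sD(3) _ z sD(2)], goal_cases)
      case 1
      show ?case using True lab op by simp
    next
      case (2 s' t')
      have regs: "reg s' ''n'' = S" "reg s' ''x'' = x" using frameD(1)[OF 2(1)] sD by simp_all
      note new = 2(2) and eqs = 2(3-5)[unfolded par lab]
      have "cotree E (insert x X) S (insert x U) (arr s' ''par'') (arr s' ''lab'')
          (\<lambda>c. if c = x then {x} else if c \<in> Z then insert x (L c) else L c) r"
        unfolding eqs by (rule graft_here[OF zX True xU xS px alt_z])
      moreover have "store s' S x (insert x X) (insert x U) r (ch(z := x # ch z))"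
        unfolding store_def regs new
      proof (intro conjI ballI allI impI)
        have zS: "z \<noteq> S" using zU SU by blast
        then show "(ch(z := x # ch z)) S \<noteq> []" "hd ((ch(z := x # ch z)) S) = r" using sD by auto
        show "stacks s' S (ch(z := x # ch z))" by fact
        show "arr s' ''deg'' S = 2" "arr s' ''par'' S = S" using eqs sD par zS xS by auto
        show "insert x U \<subseteq> insert x X \<union> {S<..<reg s ''new''}" "S < reg s ''new''" using sD by auto
        show "arr s' ''lab'' c = 0" if "c < S" for c using sD(12)[OF that] eqs lab by simp
        have zb: "z < reg s ''new''" "S < z" using sD(9,10) zX by auto
        show "arr s' ''par'' c = 0 \<or> S \<le> arr s' ''par'' c \<and> arr s' ''par'' c < reg s ''new''" for c
          using sD(11)[of c] eqs par zb by auto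
        fix p assume "p \<in> insert x U - insert x X"
        then have p: "p \<in> U - X" by blast
        show "arr s' ''deg'' p = card (kids (arr s' ''par'') p)"
        proof (cases "p = z")
          case True
          then have "kids (arr s' ''par'') p = insert x (kids par p)" using eqs by auto
          then show ?thesis using True eqs sD(6)[OF p] par xk[OF p] kfin[OF p] by simp
        next
          case False
          then have "kids (arr s' ''par'') p = kids par p" using eqs xk[OF p] by auto
          then show ?thesis using False eqs sD(6)[OF p] par by simp
        qed
      qed simp_all
      moreover have "potential (insert x U) (ch(z := x # ch z)) \<le> Suc (potential U ch)"
      proof -
        have "(ch(z := x # ch z))(x := []) = ch(z := x # ch z)" using chx xU zU by auto
        then show ?thesis
          using potential_new[OF finU xU, of "ch(z := x # ch z)" "[]"] potential_push[OF finU, of ch z x] by simp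
      qed
      ultimately show ?case using 2(1,7) pot
        by (intro conjI exI[of _ "insert x U"] exI[of _ r] exI[of _ "ch(z := x # ch z)"]
            exI[of _ "\<lambda>c. if c = x then {x} else if c \<in> Z then insert x (L c) else L c"]) simp_all
    qed
  next
    case False
    define w where "w = reg s ''new''"
    have w: "w \<notin> U" "w \<noteq> S" "\<And>c. par c \<noteq> w" using store_fresh[OF st XS] par unfolding w_def by auto
    have wx: "w \<noteq> x" using sD(10) X unfolding w_def by simp
    have wz: "w \<noteq> z" using w zU by blast
    define p where "p = par z"
    have pw: "p \<noteq> w" and pz: "p \<noteq> x" using w px unfolding p_def by auto
    have xz: "x \<noteq> z" using xU zU by blast
    have pr: "p = S \<longleftrightarrow> z = r" using parU[OF zU] rootS SU unfolding p_def by (cases "z = r") auto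
    show ?thesis
    proof (rule wp_graft_new[OF sD(3) _ z sD(2) w_def[symmetric] wz _ p_def[symmetric, folded par]], goal_cases)
      case 1
      show ?case using False lab op by simp
    next
      case (2 c)
      show ?case using w par by simp
    next
      case (3 s' t')
      have regs: "reg s' ''n'' = S" "reg s' ''x'' = x" using frameD(1)[OF 3(1)] sD by simp_all
      note new = 3(2) and eqs = 3(3-5)[unfolded par lab op]
      let ?r = "if z = r then w else r" and ?U = "insert x (insert w U)" and ?ch = "ch(p := w # ch p, w := [x, z])"
      have "cotree E (insert x X) S ?U (arr s' ''par'') (arr s' ''lab'')
        (\<lambda>c. if c = x then {x} else if c \<in> insert w (Z - {z}) then insert x ((L(w := L z)) c) else (L(w := L z)) c) ?r"
        unfolding eqs p_def by (rule graft_new[OF two False xU xS px w wx])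
      moreover have "store s' S x (insert x X) ?U ?r ?ch"
        unfolding store_def regs new
      proof (intro conjI ballI allI impI)
        show "?ch S \<noteq> []" "hd (?ch S) = ?r" using sD w(2) pr by auto
        show "stacks s' S ?ch" by fact
        have zS: "z \<noteq> S" using zU SU by blast
        then show "arr s' ''deg'' S = 2" "arr s' ''par'' S = S" using eqs sD par xS w(2) by auto
        show "?U \<subseteq> insert x X \<union> {S<..<Suc w}" "S < Suc w" using sD unfolding w_def by auto
        show "arr s' ''lab'' c = 0" if "c < S" for c using sD(12)[OF that] sD(10) that eqs lab unfolding w_def by simp
        have pb: "p = 0 \<or> S \<le> p \<and> p < w" using sD(11)[of z] par unfolding p_def w_def by simp
        have Sw: "S < w" using sD(10) unfolding w_def .
        show "arr s' ''par'' c = 0 \<or> S \<le> arr s' ''par'' c \<and> arr s' ''par'' c < Suc w" for c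
          using sD(11)[of c, folded w_def] eqs par pb Sw by auto
        fix q assume q: "q \<in> ?U - insert x X"
        show "arr s' ''deg'' q = card (kids (arr s' ''par'') q)"
        proof (cases "q = w")
          case True
          then have "kids (arr s' ''par'') q = {x, z}" using eqs w(3) pw wz wx by auto
          then show ?thesis using True eqs xz by simp
        next
          case qw: False
          then have qU: "q \<in> U - X" using q by blast
          show ?thesis
          proof (cases "q = p")
            case True
            then have "kids (arr s' ''par'') q = insert w (kids par q - {z})"
              using eqs qw wz wx xz xk[OF qU] by auto
            moreover have "w \<notin> kids par q" using kid[of w] w(1) qU by auto
            moreover have "z \<in> kids par q" using True p_def by simp
            ultimately have "card (kids (arr s' ''par'') q) = card (kids par q)"
              using kfin[OF qU] card.remove[of "kids par q" z] by simp
            then show ?thesis using eqs qw sD(6)[OF qU] par by simp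
          next
            case False
            then have "z \<notin> kids par q" unfolding p_def by auto
            moreover have "w \<notin> kids par q" using kid[of w] w(1) qU by auto
            ultimately have "kids (arr s' ''par'') q = kids par q" using False eqs xk[OF qU] qw by auto
            then show ?thesis using qw eqs sD(6)[OF qU] par by simp
          qed
        qed
      qed simp_all
      moreover have "potential ?U ?ch \<le> 3 + potential U ch"
      proof -
        have "?ch(x := []) = ?ch" using chx pz wx by auto
        then have "potential ?U ?ch = potential (insert w U) ?ch"
          using potential_new[of "insert w U" x ?ch "[]"] finU xU wx by simp
        also have "\<dots> = 2 + potential U (ch(p := w # ch p))" using potential_new[OF finU w(1)] by simp
        finally show ?thesis using potential_push[OF finU, of ch p w] by simp
      qed
      ultimately show ?case using 3(1,7) pot
        by (intro conjI exI[of _ ?U] exI[of _ ?r] exI[of _ ?ch]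
            exI[of _ "\<lambda>c. if c = x then {x} else if c \<in> insert w (Z - {z}) then insert x ((L(w := L z)) c) else (L(w := L z)) c"]) simp_all
    qed
  qed
qed

end

text \<open>When \<open>a\<close> is left with one child, that child is looked for on the stack of \<open>a\<close>.  Afterwards \<open>a\<close> is no
  node any more, so its stack drops out of the potential.\<close>

definition unwrap :: com where
  "unwrap = Assign ''z'' (Reg ''a'') ;; Load ''e'' ''deg'' (Reg ''a'') ;;
     Cond (Eq (Reg ''e'') (Const 1)) (scan ;; Store ''par'' (Reg ''a'') (Const 0) ;; link ''z'' ''b'') Skip"

context graftable
begin

lemma wp_unwrap:
  assumes st: "store s S x X U r ch" and par: "arr s ''par'' = par" and lb: "arr s ''lab'' = lab"
    and a: "reg s ''a'' = z" and b: "reg s ''b'' = par z"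
    and z: "z \<in> U - X" "z \<noteq> r" "lab z = lab (par z)" "par z \<noteq> z" and X0: "0 \<in> X"
  shows "wp unwrap (\<lambda>s' t'. frame {''z'', ''e'', ''h'', ''g'', ''p'', ''cell''} tree_arrs s s' \<and>
     (\<exists>U' ch' Z'. graftable E X S U' (arr s' ''par'') (arr s' ''lab'') L r (reg s' ''z'') x oper Z' \<and>
        store s' S x X U' r ch' \<and> (reg s' ''z'' \<in> X \<or> two_kids (arr s' ''par'') (reg s' ''z'')) \<and>
        t' + 5 * potential U' ch' \<le> t + 30 + 5 * potential U ch)) s t"
proof -
  note sD = storeD[OF st]
  have fin: "finite (kids par p)" if "p \<in> U - X" for p using kids_sub[OF that] finU finite_subset by blast
  have pz: "par z \<in> U - X" by (rule parU) (use z in auto)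
  have dz: "arr s ''deg'' z = card (kids par z)" using sD(6)[OF z(1)] par by simp
  let ?s1 = "set_reg ''e'' (arr s ''deg'' z) (set_reg ''z'' z s)"
  show ?thesis
  proof (cases "arr s ''deg'' z = 1")
    case False
    have "two_kids par z"
    proof -
      obtain c where c: "par c = z" using kids_ne[OF z(1)] by blast
      have "kids par z \<noteq> {c}" using False dz by auto
      then obtain c' where "par c' = z" "c' \<noteq> c" using c by blast
      then show ?thesis using c unfolding two_kids_def by blast
    qed
    moreover have "store ?s1 S x X U r ch"
      using st unfolding store_def by (simp add: stacks_set_reg)
    moreover have "graftable E X S U par lab L r z x oper Z" by unfold_locales
    ultimately show ?thesis using False par lb a
      by (simp add: unwrap_def wp_simps frame_set_reg frame_refl)
        (intro exI[of _ U] exI[of _ ch] conjI exI[of _ Z]; simp)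
  next
    case True
    then obtain y where y: "kids par z = {y}" using dz by (metis card_1_singletonE)
    have py: "par y = z" using y by blast
    have yz: "y \<noteq> z" using py z by auto
    have yU: "y \<in> U" using kid[of y] py z by simp
    have yr: "y \<noteq> r" using py rootS SU z by auto
    have laby: "lab y \<noteq> lab z \<or> y \<in> X" using alt'[of y] yU yr yz py by auto
    have z0: "z \<noteq> 0" "z \<noteq> S"
    proof -
      show "z \<noteq> 0" proof assume "z = 0" then show False using z(1) X0 by simp qed
      show "z \<noteq> S" proof assume "z = S" then show False using z(1) SU by simp qed
    qed
    have ych: "y \<in> set (ch z)"
    proof -
      have "par y = 0 \<or> par y = S \<or> y \<in> set (ch (par y))"
        using sD(3) unfolding stacks_def par by blast
      then show ?thesis using py z0 by simp
    qed
    have g: "graftable E X S (U - {z}) (par(z := 0, y := par z)) lab L r y x oper (insert y (Z - {z}))"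
      by (rule unwrap_graftable) (use z y laby yz X0 in auto)
    have st1: "stacks ?s1 S ch" using sD(3) by (simp add: stacks_set_reg)
    let ?R = "{''h'', ''g'', ''z'', ''p''}"
    let ?ch = "ch(par z := y # ch (par z))"
    have "wp scan (wp (Store ''par'' (Reg ''a'') (Const 0) ;; link ''z'' ''b'')
       (\<lambda>s' t'. frame {''z'', ''e'', ''h'', ''g'', ''p'', ''cell''} tree_arrs s s' \<and>
     (\<exists>U' ch' Z'. graftable E X S U' (arr s' ''par'') (arr s' ''lab'') L r (reg s' ''z'') x oper Z' \<and>
        store s' S x X U' r ch' \<and> (reg s' ''z'' \<in> X \<or> two_kids (arr s' ''par'') (reg s' ''z'')) \<and>
        t' + 5 * potential U' ch' \<le> t + 30 + 5 * potential U ch))) ?s1 (t + 3)"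
    proof (rule wp_mono[OF wp_scan[OF st1 _ ych]], goal_cases)
      case (3 s2 t2)
      then have fr: "frame ?R {} ?s1 s2" and "par (reg s2 ''z'') = z" and t2: "t2 \<le> t + 3 + 3 + 5 * length (ch z)"
        using par by simp_all
      then have z2: "reg s2 ''z'' = y" using y by blast
      have eq: "arr s2 = arr s" "reg s2 ''a'' = z" "reg s2 ''b'' = par z" "reg s2 ''n'' = S" "reg s2 ''x'' = x"
        "reg s2 ''new'' = reg s ''new''" "reg s2 ''cell'' = reg s ''cell''"
        using frameD(1,2)[OF fr] a b sD by (auto simp: fun_eq_iff)
      let ?s3 = "linked y (par z) (set_arr ''par'' z 0 s2)"
      have fr2: "frame {''z'', ''e'', ''h'', ''g'', ''p'', ''cell''} {} s s2"
        by (rule frame_trans[OF _ fr, of "{''e'', ''z''}" "{}"]) (auto simp: frame_set_reg frame_refl)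
      then have fr3: "frame {''z'', ''e'', ''h'', ''g'', ''p'', ''cell''} tree_arrs s ?s3"
        using frame_trans[OF fr2 frame_refl[of "{}" "{}"], of "{''z'', ''e'', ''h'', ''g'', ''p'', ''cell''}" tree_arrs]
        by (simp add: frame_linked frame_set_arr)
      have "stacks s2 S ch" using sD(3) eq by (subst stacks_cong[of s2 s]) simp_all
      then have "stacks ?s3 S ?ch" by (intro stacks_linked stacks_unlink)
      moreover have "par z \<noteq> S" using pz SU by auto
      moreover have par3: "arr ?s3 ''par'' = par(z := 0, y := par z)" using eq par by simp
      ultimately have "store ?s3 S x X (U - {z}) r ?ch"
        unfolding store_def
      proof (intro conjI ballI allI impI)
        fix p assume p: "p \<in> U - {z} - X"
        then have pU: "p \<in> U - X" by blast
        have p0: "p \<noteq> 0" using p X0 by (cases "p = 0") auto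
        have "card (kids (par(z := 0, y := par z)) p) = card (kids par p)"
        proof (cases "p = par z")
          case True
          then have k: "kids (par(z := 0, y := par z)) p = insert y (kids par p - {z})" using yz p0 py by auto
          have "y \<notin> kids par p" using py p by auto
          moreover have "z \<in> kids par p" using True by simp
          ultimately show ?thesis unfolding k using fin[OF pU] card.remove[of "kids par p" z] by simp
        next
          case False
          then have k: "kids (par(z := 0, y := par z)) p = kids par p" using p0 py p by auto
          show ?thesis unfolding k ..
        qed
        then show "arr ?s3 ''deg'' p = card (kids (arr ?s3 ''par'') p)"
          unfolding par3 using eq sD(6)[OF pU] par by simp
      next
        have Sz: "S < par z" "par z < reg s ''new''" using sD(9) pz by auto
        have bound: "(par(z := 0, y := par z)) c = 0 \<or> S \<le> (par(z := 0, y := par z)) c \<and> (par(z := 0, y := par z)) c < reg s ''new''" for c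
          using sD(11)[of c] Sz par by simp
        have new: "reg ?s3 ''new'' = reg s ''new''" using eq by simp
        show "arr ?s3 ''par'' c = 0 \<or> S \<le> arr ?s3 ''par'' c \<and> arr ?s3 ''par'' c < reg ?s3 ''new''" for c
          unfolding par3 new by (rule bound)
        have "y \<noteq> S" using yU SU by blast
        then show "arr ?s3 ''par'' S = S" unfolding par3 using sD(8) par z0 by simp
      qed (use eq sD in auto)
      moreover have "two_kids (arr ?s3 ''par'') y" if yX: "y \<notin> X"
      proof -
        obtain c c' where c: "par c = y" "par c' = y" "c \<noteq> c'"
          using two'[of y] yU yz yX unfolding two_kids_def by blast
        have "y \<notin> Z" using branchD(5)[OF zZ, of y] yr py by blast
        then have "par z \<noteq> y" using branchD(1,4)[OF zZ] z(2) by metis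
        then have "(par(z := 0, y := par z)) d = y" if "par d = y" for d
          using that py yz by (cases "d = z"; cases "d = y") auto
        then show ?thesis unfolding par3 using c unfolding two_kids_def by blast
      qed
      moreover have "potential (U - {z}) ?ch + length (ch z) \<le> potential U ch + 1"
        using potential_push[of "U - {z}" ch "par z" y] finU potential_remove[OF finU, of z ch] z by simp
      ultimately show ?case using fr3 z2 g t2 par3 lb
        by (simp add: wp_simps wp_link eq)
          (intro exI[of _ "U - {z}"] exI[of _ ?ch] conjI exI[of _ "insert y (Z - {z})"]; auto)
    qed (use a par py in simp_all)
    then show ?thesis using True a by (simp add: unwrap_def wp_simps numeral_eq_Suc)
  qed
qed

end

subsection \<open>Splitting a mixed node\<close>

text \<open>After the full children have moved from \<open>u\<close> to \<open>v\<close>, register \<open>a\<close> gets the part that \<open>x\<close> belongs to, and \<open>b\<close>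
  the part that keeps or takes the place of \<open>u\<close>.\<close>

definition regroup :: com where
  "regroup = Cond (Eq (Reg ''l'') (Const 1))
      (Assign ''a'' (Reg ''v'') ;; Assign ''b'' (Reg ''u'') ;; Assign ''o'' (Const 2))
      (Assign ''a'' (Reg ''u'') ;; Assign ''b'' (Reg ''v'') ;; Assign ''o'' (Const 1) ;;
       Load ''p'' ''par'' (Reg ''u'') ;; link ''v'' ''p'') ;;
     link ''a'' ''b'' ;; bump ''b''"

definition split_node :: com where
  "split_node = Assign ''v'' (Reg ''new'') ;; Incr ''new'' ;; Store ''deg'' (Reg ''v'') (Const 0) ;;
     Load ''l'' ''lab'' (Reg ''u'') ;; Store ''lab'' (Reg ''v'') (Reg ''l'') ;; move_loop ;; regroup"

abbreviation split_regs :: "vname set" where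
  "split_regs \<equiv> {''i'', ''c'', ''p'', ''h'', ''e'', ''cell'', ''v'', ''new'', ''l'', ''a'', ''b'', ''o''}"

lemma wp_split_node:
  assumes Q: "queue s = Q" "distinct Q" and u: "reg s ''u'' = u" and v: "reg s ''new'' = v" "u \<noteq> v"
    and pv: "\<And>c. arr s ''par'' c \<noteq> v" and vQ: "v \<notin> set Q" and uQ: "arr s ''par'' u \<noteq> u"
    and F: "F = {c \<in> set Q. arr s ''par'' c = u}" and st: "stacks s S ch" and p: "p = arr s ''par'' u"
    and union: "\<And>s' t' cs. arr s ''lab'' u = 1 \<Longrightarrow> frame split_regs tree_arrs s s' \<Longrightarrow> reg s' ''new'' = Suc v \<Longrightarrow>
      arr s' ''par'' = (\<lambda>c. if c \<in> F then v else if c = v then u else arr s ''par'' c) \<Longrightarrow>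
      arr s' ''lab'' = (arr s ''lab'')(v := arr s ''lab'' u) \<Longrightarrow>
      arr s' ''deg'' = (arr s ''deg'')(v := card F, u := Suc (arr s ''deg'' u - card F)) \<Longrightarrow>
      length cs = card F \<Longrightarrow> stacks s' S (ch(v := cs, u := v # ch u)) \<Longrightarrow>
      reg s' ''a'' = v \<Longrightarrow> reg s' ''b'' = u \<Longrightarrow> reg s' ''o'' = 2 \<Longrightarrow> t' \<le> t + 40 + 17 * length Q \<Longrightarrow> R s' t'"
    and join: "\<And>s' t' cs. arr s ''lab'' u \<noteq> 1 \<Longrightarrow> frame split_regs tree_arrs s s' \<Longrightarrow> reg s' ''new'' = Suc v \<Longrightarrow>
      arr s' ''par'' = (\<lambda>c. if c \<in> F then v else ((arr s ''par'')(v := p, u := v)) c) \<Longrightarrow>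
      arr s' ''lab'' = (arr s ''lab'')(v := arr s ''lab'' u) \<Longrightarrow>
      arr s' ''deg'' = (arr s ''deg'')(v := Suc (card F), u := arr s ''deg'' u - card F) \<Longrightarrow>
      length cs = card F \<Longrightarrow> stacks s' S (ch(p := v # ch p, v := u # cs)) \<Longrightarrow>
      reg s' ''a'' = u \<Longrightarrow> reg s' ''b'' = v \<Longrightarrow> reg s' ''o'' = 1 \<Longrightarrow> t' \<le> t + 40 + 17 * length Q \<Longrightarrow> R s' t'"
  shows "wp split_node R s t"
proof -
  define s1 where "s1 = set_arr ''lab'' v (arr s ''lab'' u) (set_reg ''l'' (arr s ''lab'' u)
    (set_arr ''deg'' v 0 (set_reg ''new'' (Suc v) (set_reg ''v'' v s))))"
  let ?R = "{''i'', ''c'', ''p'', ''h'', ''e'', ''cell''}" and ?A = "{''par'', ''val'', ''next'', ''head'', ''deg''}"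
  have fr1: "frame {''v'', ''new'', ''l''} {''deg'', ''lab''} s s1"
    unfolding s1_def by (simp add: frame_set_reg frame_set_arr frame_refl)
  have s1: "queue s1 = Q" "reg s1 ''u'' = u" "reg s1 ''v'' = v" "arr s1 ''par'' = arr s ''par''"
    "arr s1 ''deg'' = (arr s ''deg'')(v := 0)" "arr s1 ''lab'' = (arr s ''lab'')(v := arr s ''lab'' u)"
    "reg s1 ''l'' = arr s ''lab'' u" "reg s1 ''new'' = Suc v"
    unfolding s1_def using Q u v by simp_all
  have st1: "stacks s1 S (ch(v := []))"
    unfolding s1_def using stacks_new[OF st pv] by (simp add: stacks_set_reg stacks_set_arr)
  have vF: "v \<notin> F" and uF: "u \<notin> F" using F vQ uQ by auto
  have pu: "p \<noteq> v" "p \<noteq> u" using p pv uQ by auto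
  have "wp move_loop (wp regroup R) s1 (t + 5)"
  proof (rule wp_mono[OF wp_move_loop[OF s1(1) Q(2) s1(2,3) v(2) F[folded s1(4)] st1]])
    fix s2 t2
    assume "frame ?R ?A s1 s2 \<and>
     arr s2 ''par'' = (\<lambda>c. if c \<in> F then v else arr s1 ''par'' c) \<and>
     arr s2 ''deg'' = (arr s1 ''deg'')(v := arr s1 ''deg'' v + card F, u := arr s1 ''deg'' u - card F) \<and>
     (\<exists>cs. length cs = card F \<and> stacks s2 S ((ch(v := []))(v := cs @ (ch(v := [])) v))) \<and>
     t2 \<le> t + 5 + 2 + 17 * length Q"
    note H = this[unfolded s1(4,5)]
    have fr2: "frame ?R ?A s1 s2" and par2: "arr s2 ''par'' = (\<lambda>c. if c \<in> F then v else arr s ''par'' c)"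
      and t2: "t2 \<le> t + 7 + 17 * length Q" using H by auto
    have deg2: "arr s2 ''deg'' = (arr s ''deg'')(v := card F, u := arr s ''deg'' u - card F)"
      using H v(2) by simp
    obtain cs where cs: "length cs = card F" "stacks s2 S (ch(v := cs))" using H by auto
    have regs: "reg s2 ''u'' = u" "reg s2 ''v'' = v" "reg s2 ''l'' = arr s ''lab'' u" "reg s2 ''new'' = Suc v"
      "arr s2 ''lab'' = (arr s ''lab'')(v := arr s ''lab'' u)"
      using frameD(1,2)[OF fr2] s1 by simp_all
    have fr: "frame split_regs tree_arrs s s2" by (rule frame_trans[OF fr1 fr2]) auto
    have puF: "arr s2 ''par'' u = p" using par2 uF p by simp
    show "wp regroup R s2 t2"
    proof (cases "arr s ''lab'' u = 1")
      case True
      let ?s = "set_reg ''o'' 2 (set_reg ''b'' u (set_reg ''a'' v s2))"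
      have "stacks ?s S (ch(v := cs))" using cs by (simp add: stacks_set_reg)
      then have "stacks (linked v u ?s) S (ch(v := cs, u := v # ch u))"
        using stacks_linked[of ?s S "ch(v := cs)" v u] v(2) by simp
      note st3 = this
      show ?thesis
        using True
        apply (simp add: regroup_def bump_def wp_simps wp_link regs)
        apply (rule union[where cs = cs])
        subgoal by simp
        subgoal using fr by (simp add: frame_set_reg frame_set_arr frame_linked)
        subgoal by (simp add: regs)
        subgoal using vF by (auto simp: par2)
        subgoal by (simp add: regs)
        subgoal by (simp add: deg2)
        subgoal by (simp add: cs)
        subgoal using st3 by (simp add: stacks_set_reg stacks_set_arr)
        subgoal by simp
        subgoal by simp
        subgoal by simp
        subgoal using t2 by simp
        done
    next
      case False
      let ?s = "set_reg ''p'' p (set_reg ''o'' 1 (set_reg ''b'' v (set_reg ''a'' u s2)))"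
      have "stacks ?s S (ch(v := cs))" using cs by (simp add: stacks_set_reg)
      then have "stacks (linked v p ?s) S (ch(v := cs, p := v # ch p))"
        using stacks_linked[of ?s S "ch(v := cs)" v p] pu by simp
      then have "stacks (linked u v (linked v p ?s)) S (ch(p := v # ch p, v := u # cs))"
        using stacks_linked[of "linked v p ?s" S "ch(v := cs, p := v # ch p)" u v] pu by (simp add: fun_upd_twist)
      note st3 = this
      show ?thesis
        using False
        apply (simp add: regroup_def bump_def wp_simps wp_link regs puF)
        apply (rule join[where cs = cs])
        subgoal by simp
        subgoal using fr by (simp add: frame_set_reg frame_set_arr frame_linked)
        subgoal by (simp add: regs)
        subgoal using vF uF by (auto simp: par2)
        subgoal by (simp add: regs)
        subgoal using v(2) by (auto simp: deg2)
        subgoal by (simp add: cs)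
        subgoal using st3 by (simp add: stacks_set_reg stacks_set_arr)
        subgoal by simp
        subgoal by simp
        subgoal by simp
        subgoal using t2 by simp
        done
    qed
  qed
  then show ?thesis
    by (simp add: split_node_def wp_simps u v s1_def numeral_eq_Suc)
qed

context cotree_insert
begin

lemma wp_split:
  assumes st: "store s S x X U r ch0" and par: "arr s ''par'' = par" and lb: "arr s ''lab'' = lab"
    and Q: "distinct (queue s)" "set (queue s) = {c \<in> U. L c \<subseteq> nbrs}"
    and u: "reg s ''u'' = u" "u \<in> U - X" "mixed E x (L u)"
    and bot: "\<And>c. par c = u \<Longrightarrow> \<not> mixed E x (L c)"
    and X: "\<And>v. v \<in> X \<Longrightarrow> v < S" "0 \<in> X"
  shows "wp (split_node ;; unwrap) (\<lambda>s' t'. frame (split_regs \<union> {''z'', ''g''}) tree_arrs s s' \<and>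
     (\<exists>U' L' r' ch' Z'. graftable E X S U' (arr s' ''par'') (arr s' ''lab'') L' r' (reg s' ''z'') x (reg s' ''o'') Z' \<and>
        store s' S x X U' r' ch' \<and> (reg s' ''z'' \<in> X \<or> two_kids (arr s' ''par'') (reg s' ''z'')) \<and>
        t' + 5 * potential U' ch' \<le> t + 90 + 22 * length (queue s) + 5 * potential U ch0)) s t"
    (is "wp _ ?post s t")
proof -
  define v where "v = reg s ''new''"
  define ch where "ch = ch0(v := [])"
  have v: "v \<notin> U" "v \<noteq> S" "\<And>c. par c \<noteq> v" using store_fresh[OF st X(1)] par unfolding v_def by auto
  have st: "store s S x X U r ch" unfolding ch_def
    by (rule store_clear[OF st]) (use v par in auto)
  have pot: "potential U ch = potential U ch0" unfolding ch_def using v by (simp add: potential_clear)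
  note sD = storeD[OF st]
  have uU: "u \<in> U" and uS: "u \<noteq> S" and uv: "u \<noteq> v" using u(2) SU v by auto
  define p where "p = par u"
  have pu: "p \<noteq> u" and pv: "p \<noteq> v" using par_ne[OF uU] v unfolding p_def by auto
  have pS: "p = S \<longleftrightarrow> u = r" using parU[OF uU] rootS SU unfolding p_def by (cases "u = r") auto
  define F where "F = {c. par c = u \<and> L c \<subseteq> nbrs}"
  have FU: "F \<subseteq> U" using kids_sub[OF u(2)] unfolding F_def by blast
  have F: "F = {c \<in> set (queue s). arr s ''par'' c = u}" using FU unfolding F_def Q par by blast
  have kfin: "finite (kids par p)" if "p \<in> U - X" for p using kids_sub[OF that] finU finite_subset by blast
  have Fk: "F \<subseteq> kids par u" unfolding F_def by blast
  then have finF: "finite F" using kfin[OF u(2)] finite_subset by blast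
  have cF: "card F \<le> card (kids par u)" by (rule card_mono[OF kfin[OF u(2)] Fk])
  have "card F \<le> card (set (queue s))" by (rule card_mono) (use F in auto)
  then have cFQ: "card F \<le> length (queue s)" using card_length[of "queue s"] by linarith
  have vF: "v \<notin> F" and uF: "u \<notin> F" using FU v Fk pu unfolding p_def by auto
  have cdiff: "card (kids par u - F) = card (kids par u) - card F" by (rule card_Diff_subset[OF finF Fk])
  have vQ: "v \<notin> set (queue s)" using Q v by auto
  have new: "S < v" "u < v" "S < u" using sD(9,10) u(2) unfolding v_def by auto
  have vX: "v \<notin> X" using X(1)[of v] new by auto
  have pb: "p = 0 \<or> S \<le> p \<and> p < v" using sD(11)[of u] par unfolding p_def v_def by simp
  have old: "par c = 0 \<or> S \<le> par c \<and> par c < v" for c using sD(11)[of c] par unfolding v_def by simp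
  have vk: "v \<notin> kids par q" if "q \<in> U - X" for q using kid[of v] v(1) that by auto
  show ?thesis
    unfolding wp_Seq
  proof (rule wp_split_node[OF refl Q(1) u(1) v_def[symmetric] uv _ vQ _ F sD(3) p_def[folded par]], goal_cases)
    case (1 c)
    show ?case using v par by simp
  next
    case 2
    show ?case using pu par unfolding p_def by simp
  next
    case (3 s1 t1 cs)
    then have lu: "lab u = 1" using lb by simp
    note fr = 3(2) and new1 = 3(3) and cs = 3(7)
    note par1 = 3(4)[unfolded par] and lab1 = 3(5)[unfolded lb] and deg1 = 3(6)
    let ?par = "\<lambda>c. if c \<in> F then v else if c = v then u else par c" and ?lab = "lab(v := lab u)"
    let ?ch = "ch(v := cs, u := v # ch u)" and ?U = "insert v U"
    interpret g: graftable E X S ?U ?par ?lab "L(v := \<Union>c\<in>F. L c)" r v x 2 "insert v (ancestors u)"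
      by (rule graftable_split_union[OF u(2,3) bot F_def lu v])
    have regs: "reg s1 ''n'' = S" "reg s1 ''x'' = x" using frameD(1)[OF fr] sD by simp_all
    have store1: "store s1 S x X ?U r ?ch"
      unfolding store_def regs new1
    proof (intro conjI ballI allI impI)
      show "stacks s1 S ?ch" by fact
      show "?ch S \<noteq> []" "hd (?ch S) = r" using sD v(2) uS by auto
      show "arr s1 ''deg'' S = 2" using deg1 sD v(2) uS by simp
      have "S \<notin> F" using FU SU by blast
      then show "arr s1 ''par'' S = S" using par1 sD par v(2) by simp
      show "?U \<subseteq> X \<union> {S<..<Suc v}" "S < Suc v" using sD new unfolding v_def by auto
      show "arr s1 ''par'' c = 0 \<or> S \<le> arr s1 ''par'' c \<and> arr s1 ''par'' c < Suc v" for c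
        using old[of c] new unfolding par1 by auto
      show "arr s1 ''lab'' c = 0" if "c < S" for c using sD(12)[OF that] lab1 lb that new by simp
      fix q assume q: "q \<in> ?U - X"
      show "arr s1 ''deg'' q = card (kids (arr s1 ''par'') q)"
      proof (cases "q = v")
        case True
        then have "kids (arr s1 ''par'') q = F" unfolding par1 using uv v(3) by auto
        then show ?thesis using True deg1 uv by simp
      next
        case qv: False
        then have qU: "q \<in> U - X" using q by blast
        show ?thesis
        proof (cases "q = u")
          case True
          then have "kids (arr s1 ''par'') q = insert v (kids par u - F)" unfolding par1 using uv vF vk[OF u(2)] by auto
          then show ?thesis using True deg1 cdiff kfin[OF u(2)] vk[OF u(2)] sD(6)[OF u(2)] par by simp
        next
          case False
          then have "kids (arr s1 ''par'') q = kids par q" unfolding par1 using qv Fk vk[OF qU] by auto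
          then show ?thesis using False qv deg1 sD(6)[OF qU] par by simp
        qed
      qed
    qed simp_all
    have pot1: "potential ?U ?ch \<le> card F + 1 + potential U ch"
    proof -
      have "?ch = (ch(u := v # ch u))(v := cs)" using uv by (simp add: fun_upd_twist)
      then have "potential ?U ?ch = length cs + potential U (ch(u := v # ch u))"
        using potential_new[OF finU v(1)] by simp
      then show ?thesis using cs potential_push[OF finU, of ch u v] by simp
    qed
    have g: "wp unwrap (\<lambda>s' t'. frame {''z'', ''e'', ''h'', ''g'', ''p'', ''cell''} tree_arrs s1 s' \<and>
     (\<exists>U' ch' Z'. graftable E X S U' (arr s' ''par'') (arr s' ''lab'') (L(v := \<Union>c\<in>F. L c)) r (reg s' ''z'') x 2 Z' \<and>
        store s' S x X U' r ch' \<and> (reg s' ''z'' \<in> X \<or> two_kids (arr s' ''par'') (reg s' ''z'')) \<and>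
        t' + 5 * potential U' ch' \<le> t1 + 30 + 5 * potential ?U ?ch)) s1 t1"
      by (rule g.wp_unwrap[OF store1 par1 lab1]) (use 3 vX v rootU X vF uv in auto)
    show ?case
    proof (rule wp_mono[OF g], elim conjE exE, goal_cases)
      case (1 s2 t2 U2 ch2 Z2)
      have o2: "reg s2 ''o'' = 2" using frameD(1)[OF 1(1)] 3(11) by simp
      have "frame (split_regs \<union> {''z'', ''g''}) tree_arrs s s2"
        by (rule frame_trans[OF fr 1(1)]) auto
      moreover have "t2 + 5 * potential U2 ch2 \<le> t + 90 + 22 * length (queue s) + 5 * potential U ch0"
        using 1(5) 3(12) pot1 cFQ pot by simp
      ultimately show ?case using 1(2,3,4) unfolding o2 by blast
    qed
  next
    case (4 s1 t1 cs)
    then have lu: "lab u = 2" using lb lab[OF u(2)] by auto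
    note fr = 4(2) and new1 = 4(3) and cs = 4(7)
    note par1 = 4(4)[unfolded par] and lab1 = 4(5)[unfolded lb] and deg1 = 4(6)
    let ?par = "\<lambda>c. if c \<in> F then v else (par(v := p, u := v)) c" and ?lab = "lab(v := lab u)"
    let ?ch = "ch(p := v # ch p, v := u # cs)" and ?U = "insert v U" and ?r = "if u = r then v else r"
    interpret g: graftable E X S ?U ?par ?lab "L(v := L u, u := \<Union>c\<in>kids par u - F. L c)" ?r u x 1 "insert v (ancestors u)"
      unfolding p_def by (rule graftable_split_join[OF u(2,3) bot F_def lu v])
    have regs: "reg s1 ''n'' = S" "reg s1 ''x'' = x" using frameD(1)[OF fr] sD by simp_all
    have paru: "?par u = v" using uF by simp
    have store1: "store s1 S x X ?U ?r ?ch"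
      unfolding store_def regs new1
    proof (intro conjI ballI allI impI)
      show "stacks s1 S ?ch" by fact
      show "?ch S \<noteq> []" "hd (?ch S) = ?r" using sD v(2) pS by auto
      show "arr s1 ''deg'' S = 2" using deg1 sD v(2) uS by simp
      have "S \<notin> F" using FU SU by blast
      then show "arr s1 ''par'' S = S" using par1 sD par v(2) uS by simp
      show "?U \<subseteq> X \<union> {S<..<Suc v}" "S < Suc v" using sD new unfolding v_def by auto
      show "arr s1 ''par'' c = 0 \<or> S \<le> arr s1 ''par'' c \<and> arr s1 ''par'' c < Suc v" for c
        using old[of c] new pb unfolding par1 by auto
      show "arr s1 ''lab'' c = 0" if "c < S" for c using sD(12)[OF that] lab1 lb that new by simp
      fix q assume q: "q \<in> ?U - X"
      show "arr s1 ''deg'' q = card (kids (arr s1 ''par'') q)"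
      proof (cases "q = v")
        case True
        then have "kids (arr s1 ''par'') q = insert u F" unfolding par1 using uv v(3) pv by auto
        then show ?thesis using True deg1 uv uF finF by simp
      next
        case qv: False
        then have qU: "q \<in> U - X" using q by blast
        show ?thesis
        proof (cases "q = u")
          case True
          then have "kids (arr s1 ''par'') q = kids par u - F" unfolding par1 using uv pu vk[OF u(2)] p_def by auto
          then show ?thesis using True deg1 cdiff sD(6)[OF u(2)] par by simp
        next
          case qu: False
          show ?thesis
          proof (cases "q = p")
            case True
            then have "kids (arr s1 ''par'') q = insert v (kids par q - {u})"
              unfolding par1 using qv qu Fk vF vk[OF qU] p_def uv by auto
            moreover have "u \<in> kids par q" using True p_def by simp
            ultimately have "card (kids (arr s1 ''par'') q) = card (kids par q)"
              using kfin[OF qU] vk[OF qU] card.remove[of "kids par q" u] by simp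
            then show ?thesis using deg1 qv qu sD(6)[OF qU] par by simp
          next
            case False
            then have "kids (arr s1 ''par'') q = kids par q" unfolding par1 using qv qu Fk vk[OF qU] p_def by auto
            then show ?thesis using qu qv deg1 sD(6)[OF qU] par by simp
          qed
        qed
      qed
    qed simp_all
    have pot1: "potential ?U ?ch \<le> card F + 2 + potential U ch"
      using potential_new[OF finU v(1), of "ch(p := v # ch p)" "u # cs"] cs potential_push[OF finU, of ch p v] by simp
    have lv: "?lab u = ?lab (?par u)" using paru uv by simp
    have ur: "u \<noteq> ?r" using uv by auto
    have g: "wp unwrap (\<lambda>s' t'. frame {''z'', ''e'', ''h'', ''g'', ''p'', ''cell''} tree_arrs s1 s' \<and>
     (\<exists>U' ch' Z'. graftable E X S U' (arr s' ''par'') (arr s' ''lab'') (L(v := L u, u := \<Union>c\<in>kids par u - F. L c)) ?r (reg s' ''z'') x 1 Z' \<and>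
        store s' S x X U' ?r ch' \<and> (reg s' ''z'' \<in> X \<or> two_kids (arr s' ''par'') (reg s' ''z'')) \<and>
        t' + 5 * potential U' ch' \<le> t1 + 30 + 5 * potential ?U ?ch)) s1 t1"
      by (rule g.wp_unwrap[OF store1 par1 lab1 4(9) _ _ ur lv]) (use 4(10) paru u(2) uv X in auto)
    show ?case
    proof (rule wp_mono[OF g], elim conjE exE, goal_cases)
      case (1 s2 t2 U2 ch2 Z2)
      have o2: "reg s2 ''o'' = 1" using frameD(1)[OF 1(1)] 4(11) by simp
      have "frame (split_regs \<union> {''z'', ''g''}) tree_arrs s s2"
        by (rule frame_trans[OF fr 1(1)]) auto
      moreover have "t2 + 5 * potential U2 ch2 \<le> t + 90 + 22 * length (queue s) + 5 * potential U ch0"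
        using 1(5) 4(12) pot1 cFQ pot by simp
      ultimately show ?case using 1(2,3,4) unfolding o2 by blast
    qed
  qed
qed

abbreviation locate_regs :: "vname set" where
  "locate_regs \<equiv> {''q'', ''i'', ''h'', ''e'', ''c'', ''p'', ''tq'', ''w'', ''u''}"

text \<open>If the whole graph is not mixed, the register \<open>u\<close> keeps its default, the super-root: then \<open>x\<close> is
  adjacent to none or to all of the earlier vertices.\<close>

lemma wp_locate:
  assumes st: "store s S x X U r ch" and par: "arr s ''par'' = par"
    and flag: "\<And>p. arr s ''flag'' p < x" and cnt: "arr s ''cnt'' = (\<lambda>_. 0)"
    and off: "arr s ''off'' x = a" "arr s ''off'' (Suc x) = a + length ys"
    and adj: "\<And>j. j < length ys \<Longrightarrow> arr s ''adj'' (a + j) = ys ! j"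
    and ys: "distinct ys" "set ys \<inter> {..<x} = nbrs"
  shows "wp (collect ;; mark ;; flag_loop ;; find_loop)
    (\<lambda>s' t'. frame locate_regs {''queue'', ''cnt'', ''touched'', ''flag''} s s' \<and>
       distinct (queue s') \<and> set (queue s') = {c \<in> U. L c \<subseteq> nbrs} \<and> arr s' ''cnt'' = (\<lambda>_. 0) \<and>
       (\<forall>p. arr s' ''flag'' p < Suc x) \<and>
       (reg s' ''u'' \<in> touched - flagged \<and> mixed E x X \<or> reg s' ''u'' = S \<and> \<not> mixed E x X) \<and>
       t' \<le> t + 20 + 80 * length ys) s t"
proof -
  note sD = storeD[OF st]
  let ?F = "{c \<in> U. L c \<subseteq> nbrs}"
  let ?A = "{''queue'', ''cnt'', ''touched'', ''flag''}"
  have finX: "finite X" using XU finU finite_subset by blast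
  have nl: "card nbrs \<le> length ys"
    using ys(2) by (metis card_length card_mono finite_set inf_le1 le_trans)
  have cF: "card ?F \<le> 2 * length ys" using card_full[of nbrs] nl by auto
  show ?thesis
    unfolding wp_Seq
  proof (rule wp_mono[OF wp_collect[where a = a and ys = ys]], goal_cases)
    case (4 s1 t1)
    then have fr1: "frame {''q'', ''i'', ''h'', ''e'', ''c''} {''queue''} s s1"
      and q1: "queue s1 = filter (\<lambda>y. y < x) ys" and t1: "t1 \<le> t + 6 + 6 * length ys" using sD by auto
    have a1: "arr s1 ''par'' = par" "arr s1 ''deg'' = arr s ''deg''" "arr s1 ''cnt'' = (\<lambda>_. 0)"
      "arr s1 ''flag'' = arr s ''flag''" "reg s1 ''x'' = x" "reg s1 ''n'' = S"
      using frameD(1,2)[OF fr1] par cnt sD by simp_all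
    have q1': "distinct (queue s1)" "set (queue s1) = nbrs" unfolding q1 using ys by auto
    show ?case
    proof (rule wp_mono[OF wp_mark[OF a1(1) _ _ a1(3) q1']], goal_cases)
      case (4 s2 t2)
      then have fr2: "frame mark_regs mark_arrs s1 s2"
        and m: "marks nbrs (queue s2) (touched_list s2) (arr s2 ''cnt'') (length (queue s2))"
        and t2: "t2 \<le> t1 + 3 + 14 * card ?F" by auto
      note me = marks_end[OF m]
      have dist: "distinct (queue s2)" "distinct (touched_list s2)" using m by (auto simp: marks_def)
      have lenT: "length (touched_list s2) \<le> 2 * length ys"
      proof -
        have "length (touched_list s2) = card (set (touched_list s2))" using dist distinct_card by metis
        also have "\<dots> \<le> card ?F" unfolding me(3) by (rule card_image_le) (use finU in simp)
        finally show ?thesis using cF by simp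
      qed
      have a2: "arr s2 ''par'' = par" "arr s2 ''deg'' = arr s ''deg''" "arr s2 ''flag'' = arr s ''flag''"
        "reg s2 ''x'' = x" "reg s2 ''n'' = S"
        using frameD(1,2)[OF fr2] a1 by simp_all
      define B where "B = {w \<in> set (touched_list s2). arr s2 ''cnt'' w \<noteq> arr s2 ''deg'' w}"
      define fl where "fl = par ` B \<union> (par \<circ> par) ` B"
      show ?case
      proof (rule wp_mono[OF wp_flag_loop[OF refl B_def a2(1)[symmetric]]], goal_cases)
        case (1 s3 t3)
        then have fr3: "frame {''i'', ''w'', ''h'', ''e'', ''p''} {''flag''} s2 s3"
          and fl3: "arr s3 ''flag'' = (\<lambda>p. if p \<in> fl then x else arr s ''flag'' p)"
          and t3: "t3 \<le> t2 + 2 + 10 * length (touched_list s2)" unfolding fl_def using a2 by auto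
        have a3: "touched_list s3 = touched_list s2" "arr s3 ''cnt'' = arr s2 ''cnt''" "arr s3 ''deg'' = arr s ''deg''"
          "reg s3 ''x'' = x" "reg s3 ''n'' = S" "queue s3 = queue s2"
          using frameD(1,2)[OF fr3] a2 by simp_all
        have B3: "{w \<in> set (touched_list s2). arr s3 ''cnt'' w \<noteq> arr s3 ''deg'' w \<and> arr s3 ''flag'' w \<noteq> reg s3 ''x''} = B - fl"
        proof -
          have "(if w \<in> fl then x else arr s ''flag'' w) \<noteq> x \<longleftrightarrow> w \<notin> fl" for w using flag[of w] by auto
          then show ?thesis unfolding a3 fl3 B_def a2 by blast
        qed
        have BU: "w \<in> B \<longleftrightarrow> w \<in> touched" if "w \<noteq> S" for w
        proof
          assume w: "w \<in> B"
          then obtain c where c: "c \<in> ?F" "w = par c" unfolding B_def me(3) by blast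
          then have wU: "w \<in> U - X" using parU[of c] rootS that by auto
          have "\<not> L w \<subseteq> nbrs"
          proof
            assume "L w \<subseteq> nbrs"
            then have "L d \<subseteq> nbrs" "d \<in> U" if "par d = w" for d
              using inner[OF wU] kid[of d] wU that by auto
            then have "{c \<in> ?F. par c = w} = kids par w" by blast
            then show False using w sD(6)[OF wU] par unfolding B_def me(2) a2 by simp
          qed
          then show "w \<in> touched" using c wU by blast
        next
          assume w: "w \<in> touched"
          then have wU: "w \<in> U - X" using touched_inner by blast
          obtain c where c: "c \<in> ?F" "par c = w" using w by blast
          have "\<exists>d. par d = w \<and> d \<notin> ?F"
            using w inner[OF wU] by blast
          then obtain d where d: "par d = w" "d \<notin> ?F" by blast
          have "{c \<in> ?F. par c = w} \<subset> kids par w" using d by blast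
          then have "card {c \<in> ?F. par c = w} < card (kids par w)"
            using kids_sub[OF wU] finU finite_subset by (metis (no_types, lifting) psubset_card_mono)
          then show "w \<in> B" using c sD(6)[OF wU] par unfolding B_def me(2,3) a2 by auto
        qed
        have SB: "X \<subseteq> nbrs" if "S \<in> B"
        proof -
          obtain c where c: "c \<in> ?F" "S = par c" using \<open>S \<in> B\<close> unfolding B_def me(3) by blast
          then have "c = r" using parU[of c] SU by blast
          then show ?thesis using c rootL by blast
        qed
        show ?case
        proof (rule wp_mono[OF wp_find_loop[OF a3(1) dist(2) B3[symmetric]]], goal_cases)
          case (1 s4 t4)
          then have fr4: "frame {''i'', ''w'', ''h'', ''e'', ''u''} {''cnt''} s3 s4"
            and cnt4: "arr s4 ''cnt'' = (\<lambda>p. if p \<in> set (touched_list s2) then 0 else arr s3 ''cnt'' p)"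
            and u4: "reg s4 ''u'' \<in> B - fl \<or> B - fl = {} \<and> reg s4 ''u'' = S"
            and t4: "t4 \<le> t3 + 3 + 10 * length (touched_list s2)" unfolding a3 by auto
          have a4: "queue s4 = queue s2" "arr s4 ''flag'' = arr s3 ''flag''"
            using frameD(1,2)[OF fr4] a3 by simp_all
          have "frame {''q'', ''i'', ''h'', ''e'', ''c'', ''p'', ''tq''} {''queue'', ''cnt'', ''touched''} s s2"
            by (rule frame_trans[OF fr1 fr2]) auto
          from frame_trans[OF this fr3, of "locate_regs" "?A"]
          have "frame locate_regs ?A s s3" by auto
          from frame_trans[OF this fr4, of "locate_regs" "?A"]
          have "frame locate_regs ?A s s4" by auto
          moreover have "arr s4 ''cnt'' = (\<lambda>_. 0)"
          proof
            fix p show "arr s4 ''cnt'' p = 0"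
              unfolding cnt4 a3 me(2) me(3) by (auto simp: card_eq_0_iff)
          qed
          moreover have "arr s4 ''flag'' p < Suc x" for p
            unfolding a4 fl3 using flag[of p] by simp
          moreover have "reg s4 ''u'' \<in> touched - flagged \<and> mixed E x X \<or> reg s4 ''u'' = S \<and> \<not> mixed E x X"
          proof (cases "mixed E x X")
            case True
            then have "S \<notin> B" using SB unfolding mixed_def by blast
            moreover have "S \<notin> touched" using SU by blast
            ultimately have "w \<in> B \<longleftrightarrow> w \<in> touched" for w
              by (cases "w = S") (blast, rule BU)
            then have "B = touched" by (rule set_eqI)
            then have "B - fl = touched - flagged" unfolding fl_def by blast
            moreover have "touched - flagged \<noteq> {}"
              by (rule exists_unflagged[OF True]) (use sD par in simp)
            ultimately show ?thesis using u4 True by auto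
          next
            case False
            have "touched = {}"
            proof (rule ccontr)
              assume "touched \<noteq> {}"
              then obtain p where "p \<in> touched" by blast
              then have "mixed E x (L p)" "L p \<subseteq> X" using touched_inner LX by blast+
              then show False using False unfolding mixed_def by blast
            qed
            then have "B \<subseteq> {S}" using BU by blast
            then show ?thesis using u4 False by blast
          qed
          moreover have "t4 \<le> t + 20 + 80 * length ys"
            using t1 t2 t3 t4 lenT cF by linarith
          ultimately show ?case using dist me(1) a4 by simp
        qed
      qed
    qed (use sD par a1 in auto)
  qed (use off adj sD in auto)
qed

end

text \<open>The queue is empty if and only if \<open>x\<close> has no neighbour in the tree.\<close>

definition root_case :: com where
  "root_case = Load ''h'' ''head'' (Reg ''n'') ;; Load ''z'' ''val'' (Reg ''h'') ;;
     Cond (Eq (Reg ''q'') (Const 0)) (Assign ''o'' (Const 1)) (Assign ''o'' (Const 2))"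

definition insert_vertex :: com where
  "insert_vertex = (collect ;; mark ;; flag_loop ;; find_loop) ;;
     Cond (Eq (Reg ''u'') (Reg ''n'')) root_case (split_node ;; unwrap) ;; graft ;; Incr ''x''"

abbreviation insert_regs :: "vname set" where
  "insert_regs \<equiv> {''q'', ''i'', ''h'', ''e'', ''c'', ''p'', ''tq'', ''w'', ''u'', ''cell'', ''v'', ''new'', ''l'', ''a'', ''b'', ''o'', ''z'', ''g'', ''x''}"

abbreviation insert_arrs :: "vname set" where
  "insert_arrs \<equiv> {''queue'', ''cnt'', ''touched'', ''flag'', ''par'', ''val'', ''next'', ''head'', ''deg'', ''lab''}"

lemma store_frame:
  assumes st: "store s S x X U r ch" and fr: "frame R A s s'"
    and R: "''n'' \<notin> R" "''x'' \<notin> R" "''cell'' \<notin> R" "''new'' \<notin> R"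
    and A: "''par'' \<notin> A" "''val'' \<notin> A" "''next'' \<notin> A" "''head'' \<notin> A" "''deg'' \<notin> A" "''lab'' \<notin> A"
  shows "store s' S x X U r ch"
proof -
  have "stacks s' S ch \<longleftrightarrow> stacks s S ch"
    by (rule stacks_cong) (use frameD[OF fr] R A in simp_all)
  then show ?thesis using st frameD(1,2)[OF fr] R A unfolding store_def by simp
qed

context cotree_insert
begin

lemma wp_insert_vertex:
  assumes st: "store s S x X U r ch" and par: "arr s ''par'' = par" and lb: "arr s ''lab'' = lab"
    and flag: "\<And>p. arr s ''flag'' p < x" and cnt: "arr s ''cnt'' = (\<lambda>_. 0)"
    and off: "arr s ''off'' x = a" "arr s ''off'' (Suc x) = a + length ys"
    and adj: "\<And>j. j < length ys \<Longrightarrow> arr s ''adj'' (a + j) = ys ! j"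
    and ys: "distinct ys" "set ys \<inter> {..<x} = nbrs"
    and X: "X = {..<x}" "0 < x" "x < S"
  shows "wp insert_vertex (\<lambda>s' t'. frame insert_regs insert_arrs s s' \<and>
     (\<exists>U' L' r' ch'. cotree E {..<Suc x} S U' (arr s' ''par'') (arr s' ''lab'') L' r' \<and>
        store s' S (Suc x) {..<Suc x} U' r' ch' \<and>
        t' + 5 * potential U' ch' \<le> t + 200 + 130 * length ys + 5 * potential U ch) \<and>
     (\<forall>p. arr s' ''flag'' p < Suc x) \<and> arr s' ''cnt'' = (\<lambda>_. 0)) s t"
    (is "wp _ ?post s t")
proof -
  have X0: "0 \<in> X" and XS: "\<And>v. v \<in> X \<Longrightarrow> v < S" using X by auto
  let ?rest = "wp graft (wp (Incr ''x'') ?post)"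
  have graft: "?rest s2 t2"
    if fr2: "frame (insert_regs - {''x''}) insert_arrs s s2" and c2: "arr s2 ''cnt'' = (\<lambda>_. 0)"
      and f2: "\<forall>p. arr s2 ''flag'' p < Suc x"
      and g: "graftable E X S U2 (arr s2 ''par'') (arr s2 ''lab'') L2 r2 (reg s2 ''z'') x (reg s2 ''o'') Z2"
      and st2: "store s2 S x X U2 r2 ch2" and two: "reg s2 ''z'' \<in> X \<or> two_kids (arr s2 ''par'') (reg s2 ''z'')"
      and t2: "t2 + 5 * potential U2 ch2 \<le> t + 140 + 130 * length ys + 5 * potential U ch" for s2 t2 U2 L2 r2 Z2 ch2
  proof -
    interpret g: graftable E X S U2 "arr s2 ''par''" "arr s2 ''lab''" L2 r2 "reg s2 ''z''" x "reg s2 ''o''" Z2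
      by (rule g)
    show ?thesis
    proof (rule wp_mono[OF g.wp_graft[OF st2 refl refl refl refl two X]], elim conjE exE, goal_cases)
      case (1 s3 t3 U' L' r' ch')
      let ?s = "set_reg ''x'' (Suc x) s3"
      have x3: "reg s3 ''x'' = x" using 1(3) unfolding store_def by simp
      have e: "insert x X = {..<Suc x}" using X by (simp add: lessThan_Suc)
      have "frame insert_regs insert_arrs s s3" by (rule frame_trans[OF fr2 1(1)]) auto
      then have "frame insert_regs insert_arrs s ?s" by (simp add: frame_set_reg)
      moreover have "store ?s S (Suc x) {..<Suc x} U' r' ch'"
        using 1(3) unfolding e store_def by (simp add: stacks_set_reg)
      moreover have "arr ?s ''flag'' = arr s2 ''flag''" "arr ?s ''cnt'' = arr s2 ''cnt''"
        using frameD(2)[OF 1(1)] by simp_all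
      moreover have "t3 + 1 + 5 * potential U' ch' \<le> t + 200 + 130 * length ys + 5 * potential U ch"
        using 1(4) t2 by simp
      moreover have "cotree E {..<Suc x} S U' (arr ?s ''par'') (arr ?s ''lab'') L' r'"
        using 1(2) unfolding e by simp
      ultimately show ?case using x3 c2 f2
        by (simp only: wp_atomic) (simp, blast)
    qed
  qed
  show ?thesis
    unfolding insert_vertex_def wp_Seq[of "collect ;; mark ;; flag_loop ;; find_loop"]
  proof (rule wp_mono[OF wp_locate[OF st par flag cnt off adj ys]], goal_cases)
    case (2 s1 t1)
    then have fr1: "frame locate_regs {''queue'', ''cnt'', ''touched'', ''flag''} s s1"
      and Q: "distinct (queue s1)" "set (queue s1) = {c \<in> U. L c \<subseteq> nbrs}" and c1: "arr s1 ''cnt'' = (\<lambda>_. 0)"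
      and f1: "\<forall>p. arr s1 ''flag'' p < Suc x"
      and u1: "reg s1 ''u'' \<in> touched - flagged \<and> mixed E x X \<or> reg s1 ''u'' = S \<and> \<not> mixed E x X"
      and t1: "t1 \<le> t + 20 + 80 * length ys" by blast+
    have st1: "store s1 S x X U r ch" by (rule store_frame[OF st fr1]) auto
    have a1: "arr s1 ''par'' = par" "arr s1 ''lab'' = lab" using frameD(2)[OF fr1] par lb by simp_all
    note sD = storeD[OF st1]
    have lenQ: "length (queue s1) \<le> 2 * length ys"
    proof -
      have "card nbrs \<le> length ys"
        using ys(2) by (metis card_length card_mono finite_set inf_le1 le_trans)
      moreover have "length (queue s1) = card {c \<in> U. L c \<subseteq> nbrs}" 
        unfolding Q(2)[symmetric] using Q(1) by (rule distinct_card[symmetric])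
      ultimately show ?thesis using card_full[of nbrs] by auto
    qed
    show ?case
    proof (cases "mixed E x X")
      case True
      define u where "u = reg s1 ''u''"
      have u: "u \<in> touched - flagged" using u1 True unfolding mixed_def u_def by blast
      have uU: "u \<in> U - X" and um: "mixed E x (L u)" using touched_inner u by blast+
      have uS: "u \<noteq> S" using uU SU by auto
      have "wp (split_node ;; unwrap) ?rest s1 (t1 + 1)"
      proof (rule wp_mono[OF wp_split[OF st1 a1 Q u_def[symmetric] uU um unflagged_bottom[OF u] XS X0]], goal_cases)
        case (3 s2 t2)
        then obtain U2 L2 r2 ch2 Z2 where fr2: "frame (split_regs \<union> {''z'', ''g''}) tree_arrs s1 s2"
          and g2: "graftable E X S U2 (arr s2 ''par'') (arr s2 ''lab'') L2 r2 (reg s2 ''z'') x (reg s2 ''o'') Z2"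
            "store s2 S x X U2 r2 ch2" "reg s2 ''z'' \<in> X \<or> two_kids (arr s2 ''par'') (reg s2 ''z'')"
            "t2 + 5 * potential U2 ch2 \<le> t1 + 1 + 90 + 22 * length (queue s1) + 5 * potential U ch"
          by blast
        show ?case
        proof (rule graft[OF _ _ _ g2(1,2,3)])
          show "frame (insert_regs - {''x''}) insert_arrs s s2" by (rule frame_trans[OF fr1 fr2]) auto
          show "arr s2 ''cnt'' = (\<lambda>_. 0)" "\<forall>p. arr s2 ''flag'' p < Suc x" using frameD(2)[OF fr2] c1 f1 by simp_all
          show "t2 + 5 * potential U2 ch2 \<le> t + 140 + 130 * length ys + 5 * potential U ch"
            using g2(4) t1 lenQ by linarith
        qed
      qed auto
      then show ?thesis using uS sD(1) unfolding wp_Seq wp_Cond u_def by simp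
    next
      case False
      then have uS: "reg s1 ''u'' = S" using u1 by blast
      obtain cs where chS: "ch S = r # cs" using sD(4,5) by (cases "ch S") auto
      have "stack (arr s1 ''next'') (arr s1 ''val'') (reg s1 ''cell'') (arr s1 ''head'' S) (ch S)"
        using sD(3) unfolding stacks_def by blast
      then have val: "arr s1 ''val'' (arr s1 ''head'' S) = r" unfolding chS by simp
      define oper where "oper = (if reg s1 ''q'' = 0 then 1 else 2 :: nat)"
      define s2 where "s2 = set_reg ''o'' oper (set_reg ''z'' r (set_reg ''h'' (arr s1 ''head'' S) s1))"
      have q: "reg s1 ''q'' = 0 \<longleftrightarrow> {c \<in> U. L c \<subseteq> nbrs} = {}"
        unfolding Q(2)[symmetric] by auto
      have edges: "{a, x} \<in> E \<longleftrightarrow> oper = 2" if "a \<in> X" for a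
      proof (cases "reg s1 ''q'' = 0")
        case True
        then have "a \<notin> nbrs" using q leaf[OF that] XU that by auto
        then show ?thesis using True that unfolding oper_def by simp
      next
        case q0: False
        then have "{c \<in> U. L c \<subseteq> nbrs} \<noteq> {}" by (simp only: q not_False_eq_True)
        then obtain c where c: "c \<in> U" "L c \<subseteq> nbrs" by auto
        obtain b where "b \<in> L c" using Lne[OF c(1)] by auto
        then have "b \<in> X" "{b, x} \<in> E" using c(2) by auto
        then show ?thesis using False that q0 unfolding oper_def mixed_def by auto
      qed
      have g: "graftable E X S U par lab L r r x oper {r}"
        by (rule graftable_root) (use edges in \<open>auto simp: oper_def\<close>)
      have fr2: "frame (insert_regs - {''x''}) insert_arrs s s2"
        unfolding s2_def by (simp add: frame_set_reg) (rule frame_trans[OF fr1 frame_refl[of "{}" "{}"]]; auto)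
      have st2: "store s2 S x X U r ch"
        using st1 unfolding store_def s2_def by (simp add: stacks_set_reg)
      have two: "r \<in> X \<or> two_kids par r" using two rootU by blast
      have "?rest s2 (t1 + 5)"
        by (rule graft[OF fr2 _ _ _ st2]) (use c1 f1 a1 g two t1 in \<open>simp_all add: s2_def\<close>)
      then have "wp root_case ?rest s1 (t1 + 1)"
        by (simp add: root_case_def wp_simps sD val s2_def oper_def numeral_eq_Suc split: if_splits)
      then show ?thesis using uS sD(1) unfolding wp_Seq wp_Cond by simp
    qed
  qed
qed

end

subsection \<open>Building the cotree\<close>

text \<open>The tree of the vertex \<open>0\<close>.  The register \<open>n\<close> is used as the super-root.\<close>

definition init :: com where
  "init = Assign ''x'' (Const 1) ;; Assign ''new'' (Reg ''n'') ;; Incr ''new'' ;;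
     Store ''par'' (Reg ''n'') (Reg ''n'') ;; Store ''deg'' (Reg ''n'') (Const 2) ;;
     Assign ''c'' (Const 0) ;; Assign ''p'' (Reg ''n'') ;; link ''c'' ''p''"

definition build :: com where
  "build = init ;; While (Less (Reg ''x'') (Reg ''n'')) insert_vertex"

lemma concat_nth_block:
  assumes "x < length adj" "j < length (adj ! x)"
  shows "length (concat (take x adj)) + j < length (concat adj)"
    "concat adj ! (length (concat (take x adj)) + j) = adj ! x ! j"
proof -
  have "adj = take x adj @ adj ! x # drop (Suc x) adj" using assms(1) by (rule id_take_nth_drop)
  then have e: "concat adj = concat (take x adj) @ adj ! x @ concat (drop (Suc x) adj)"
    by (metis concat.simps(2) concat_append)
  show "length (concat (take x adj)) + j < length (concat adj)"
    "concat adj ! (length (concat (take x adj)) + j) = adj ! x ! j"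
    unfolding e using assms(2) by (simp_all add: nth_append)
qed

lemma wp_build:
  assumes G: "cograph V E" and adj: "adjacency_lists V E adj"
  shows "wp build (\<lambda>s t. \<exists>U L r ch. cotree E V (length adj) U (arr s ''par'') (arr s ''lab'') L r \<and>
     store s (length adj) (length adj) V U r ch \<and> arr s ''cnt'' = (\<lambda>_. 0) \<and> parr s = (\<lambda>_ _. 0) \<and>
     t \<le> 20 + (\<Sum>y<length adj. 201 + 130 * length (adj ! y))) (input_state adj) 0"
proof -
  define n where "n = length adj"
  define s0 where "s0 = input_state adj"
  have V: "V = {..<n}" and nb: "\<And>v. v < n \<Longrightarrow> distinct (adj ! v) \<and> set (adj ! v) = {u. {u, v} \<in> E}"
    using adj unfolding adjacency_lists_def n_def by auto
  have P4: "P4_free V E" by (rule cograph_P4_free[OF G])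
  have "V \<noteq> {}" using G by (induction rule: cograph.induct) auto
  then have n0: "0 < n" using V by auto
  define T where "T x = (\<Sum>y<x. 201 + 130 * length (adj ! y))" for x
  have Tmono: "T x \<le> T n" if "x \<le> n" for x unfolding T_def using that by (intro sum_mono2) auto
  \<comment> \<open>The factor \<open>5\<close> is the cost of an iteration of \<open>scan\<close>, the work that an entry of a stack may cause later.\<close>
  define I where "I s t \<longleftrightarrow> (\<exists>x U L r ch. 0 < x \<and> x \<le> n \<and> cotree E {..<x} n U (arr s ''par'') (arr s ''lab'') L r \<and>
     store s n x {..<x} U r ch \<and> arr s ''cnt'' = (\<lambda>_. 0) \<and> (\<forall>p. arr s ''flag'' p < x) \<and>
     arr s ''off'' = arr s0 ''off'' \<and> arr s ''adj'' = arr s0 ''adj'' \<and> parr s = (\<lambda>_ _. 0) \<and>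
     t + 5 * potential U ch \<le> 19 + T x)" for s t
  have loop: "wp (While (Less (Reg ''x'') (Reg ''n'')) insert_vertex)
     (\<lambda>s t. \<exists>U L r ch. cotree E V n U (arr s ''par'') (arr s ''lab'') L r \<and>
     store s n n V U r ch \<and> arr s ''cnt'' = (\<lambda>_. 0) \<and> parr s = (\<lambda>_ _. 0) \<and> t \<le> 20 + T n) s t" if "I s t" for s t
  proof (rule wp_While[where I = I and T = "19 + T n"])
    fix s t assume "I s t" and b: "testval (Less (Reg ''x'') (Reg ''n'')) s"
    then obtain x U L r ch where x: "0 < x" "x \<le> n" and c: "cotree E {..<x} n U (arr s ''par'') (arr s ''lab'') L r"
      and st: "store s n x {..<x} U r ch" and cnt: "arr s ''cnt'' = (\<lambda>_. 0)" and flag: "\<forall>p. arr s ''flag'' p < x"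
      and inp: "arr s ''off'' = arr s0 ''off''" "arr s ''adj'' = arr s0 ''adj''" and parr: "parr s = (\<lambda>_ _. 0)"
      and t: "t + 5 * potential U ch \<le> 19 + T x" unfolding I_def by blast
    have xn: "x < n" using b storeD(1,2)[OF st] by simp
    interpret c: cotree E "{..<x}" n U "arr s ''par''" "arr s ''lab''" L r by (rule c)
    interpret ci: cotree_insert E "{..<x}" n U "arr s ''par''" "arr s ''lab''" L r V x
      by unfold_locales (use P4 V xn in auto)
    let ?a = "length (concat (take x adj))"
    have tk: "take (Suc x) adj = take x adj @ [adj ! x]" using xn unfolding n_def by (simp add: take_Suc_conv_app_nth)
    have off: "arr s ''off'' x = ?a" "arr s ''off'' (Suc x) = ?a + length (adj ! x)"
      unfolding inp s0_def input_state_def using xn tk by (simp_all add: n_def)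
    have cells: "arr s ''adj'' (?a + j) = adj ! x ! j" if "j < length (adj ! x)" for j
      unfolding inp s0_def input_state_def using concat_nth_block[of x adj j] xn that by (simp add: n_def)
    have ys: "distinct (adj ! x)" "set (adj ! x) \<inter> {..<x} = ci.nbrs" using nb[OF xn] by auto
    show "wp insert_vertex I s (t + 1)"
    proof (rule wp_mono[OF ci.wp_insert_vertex[OF st refl refl _ cnt off cells ys refl x(1) xn]], goal_cases)
      case (3 s' t')
      then obtain U' L' r' ch' where fr: "frame insert_regs insert_arrs s s'"
        and *: "cotree E {..<Suc x} n U' (arr s' ''par'') (arr s' ''lab'') L' r'" "store s' n (Suc x) {..<Suc x} U' r' ch'"
        "t' + 5 * potential U' ch' \<le> t + 1 + 200 + 130 * length (adj ! x) + 5 * potential U ch"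
        "\<forall>p. arr s' ''flag'' p < Suc x" "arr s' ''cnt'' = (\<lambda>_. 0)" by blast
      have "t' + 5 * potential U' ch' \<le> 19 + T (Suc x)" using *(3) t unfolding T_def by simp
      moreover have "arr s' ''off'' = arr s0 ''off''" "arr s' ''adj'' = arr s0 ''adj''" "parr s' = (\<lambda>_ _. 0)"
        using frameD(2,4)[OF fr] inp parr by simp_all
      moreover have "0 < Suc x" "Suc x \<le> n" using xn by auto
      ultimately show ?case unfolding I_def using * by blast
    qed (use flag in auto)
  next
    fix s t assume "I s t" and b: "\<not> testval (Less (Reg ''x'') (Reg ''n'')) s"
    then obtain x U L r ch where x: "0 < x" "x \<le> n" and c: "cotree E {..<x} n U (arr s ''par'') (arr s ''lab'') L r"
      and st: "store s n x {..<x} U r ch" and cnt: "arr s ''cnt'' = (\<lambda>_. 0)" and parr: "parr s = (\<lambda>_ _. 0)"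
      and t: "t + 5 * potential U ch \<le> 19 + T x" unfolding I_def by blast
    have "x = n" using b x storeD(1,2)[OF st] by simp
    then have "t + 1 \<le> 20 + T n" using t by simp
    then show "\<exists>U L r ch. cotree E V n U (arr s ''par'') (arr s ''lab'') L r \<and>
     store s n n V U r ch \<and> arr s ''cnt'' = (\<lambda>_. 0) \<and> parr s = (\<lambda>_ _. 0) \<and> t + 1 \<le> 20 + T n"
      using c st cnt parr \<open>x = n\<close> V by blast
  next
    fix s t assume "I s t"
    then obtain x U ch where "x \<le> n" "t + 5 * potential U ch \<le> 19 + T x" unfolding I_def by blast
    then show "t \<le> 19 + T n" using Tmono[of x] by simp
  qed (rule that)
  let ?s1 = "set_reg ''p'' n (set_reg ''c'' 0 (set_arr ''deg'' n 2 (set_arr ''par'' n n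
    (set_reg ''new'' (Suc n) (set_reg ''new'' n (set_reg ''x'' 1 s0))))))"
  have n: "reg s0 ''n'' = n" unfolding s0_def input_state_def n_def by simp
  have za: "arr s0 a i = 0" if "a \<noteq> ''off''" "a \<noteq> ''adj''" for a i using that unfolding s0_def input_state_def by simp
  have par1: "arr (linked 0 n ?s1) ''par'' = (\<lambda>_. 0)(n := n, 0 := n)" using za by (simp add: fun_eq_iff)
  have "stacks ?s1 n (\<lambda>_. [])" using za unfolding stacks_def by simp
  then have st1: "stacks (linked 0 n ?s1) n ((\<lambda>_. [])(n := [0]))" using stacks_linked[of ?s1 n "\<lambda>_. []" 0 n] by simp
  have "cotree E {..<Suc 0} n {0} (arr (linked 0 n ?s1) ''par'') (arr (linked 0 n ?s1) ''lab'') (\<lambda>_. {0}) 0"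
    unfolding par1 by unfold_locales (use n0 in \<open>auto split: if_splits\<close>)
  moreover have "store (linked 0 n ?s1) n (Suc 0) {..<Suc 0} {0} 0 ((\<lambda>_. [])(n := [0]))"
    unfolding store_def par1 using st1 n za n0 by simp
  moreover have "potential {0} ((\<lambda>_. [])(n := [0])) = 0" unfolding potential_def using n0 by simp
  moreover have "parr s0 = (\<lambda>_ _. 0)" unfolding s0_def input_state_def by simp
  ultimately have "I (linked 0 n ?s1) 13"
    unfolding I_def using n0 za
    by (intro exI[of _ "Suc 0"] exI[of _ "{0}"] exI[of _ "\<lambda>_. {0}"] exI[of _ 0] exI[of _ "(\<lambda>_. [])(n := [0])"])
      (simp add: fun_eq_iff)
  from loop[OF this] show ?thesis
    unfolding build_def s0_def[symmetric] n_def[symmetric] T_def[symmetric]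
    by (simp add: init_def wp_simps wp_link n)
qed

section \<open>Evaluating the cotree\<close>

definition combine_union :: com where
  "combine_union = PMult ''T'' ''A1'' ''A2'' ;; PAdd ''A2'' ''A2'' ''A1'' ;; PAdd ''A2'' ''A2'' ''T'' ;;
     PMult ''T'' ''I1'' ''I2'' ;; PAdd ''I2'' ''I2'' ''I1'' ;; PAdd ''I2'' ''I2'' ''T''"

definition combine_join :: com where
  "combine_join = PAdd ''A2'' ''A2'' ''A1'' ;; PMult ''T'' ''N1'' ''I2'' ;; PAdd ''A2'' ''A2'' ''T'' ;;
     PMult ''T'' ''N2'' ''I1'' ;; PAdd ''A2'' ''A2'' ''T'' ;;
     PMult ''T'' ''N1'' ''N2'' ;; PSmult ''T'' (-1) ''T'' ;; PAdd ''A2'' ''A2'' ''T'' ;; PAdd ''I2'' ''I2'' ''I1''"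

definition combine :: com where
  "combine = Load ''c'' ''queue'' (Reg ''i'') ;; Load ''p'' ''par'' (Reg ''c'') ;; Load ''l'' ''lab'' (Reg ''p'') ;;
     PLoad ''A1'' ''acyclic'' (Reg ''c'') ;; PLoad ''I1'' ''indep'' (Reg ''c'') ;; PLoad ''N1'' ''single'' (Reg ''c'') ;;
     PLoad ''A2'' ''acyclic'' (Reg ''p'') ;; PLoad ''I2'' ''indep'' (Reg ''p'') ;; PLoad ''N2'' ''single'' (Reg ''p'') ;;
     Cond (Eq (Reg ''l'') (Const 2)) combine_join combine_union ;; PAdd ''N2'' ''N2'' ''N1'' ;;
     PStore ''acyclic'' (Reg ''p'') ''A2'' ;; PStore ''indep'' (Reg ''p'') ''I2'' ;; PStore ''single'' (Reg ''p'') ''N2''"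

definition leaf_step :: com where
  "leaf_step = Store ''queue'' (Reg ''i'') (Reg ''i'') ;; PStore ''acyclic'' (Reg ''i'') ''T'' ;;
      PStore ''indep'' (Reg ''i'') ''T'' ;; PStore ''single'' (Reg ''i'') ''T'' ;; Incr ''i''"

definition leaves :: com where
  "leaves = PVar ''T'' ;; Assign ''i'' (Const 0) ;; While (Less (Reg ''i'') (Reg ''n''))
     leaf_step"

text \<open>Marking with all vertices queued visits every node after its children, so the
  polynomials of a node are complete when they are merged into those of its parent.  Inner nodes
  start with \<open>0\<close>, the polynomials of the empty graph.  The final \<open>1\<close> counts the empty set.\<close>

definition evaluate :: com where
  "evaluate = leaves ;; Assign ''q'' (Reg ''n'') ;; Assign ''tq'' (Const 0) ;; Assign ''i'' (Const 0) ;;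
     While (Less (Reg ''i'') (Reg ''q'')) (combine ;; mark_step) ;;
     PLoad ''result'' ''acyclic'' (Reg ''n'') ;; PConst ''T'' 1 ;; PAdd ''result'' ''result'' ''T''"

definition polys_at :: "state \<Rightarrow> nat \<Rightarrow> int poly \<times> int poly \<times> int poly" where
  "polys_at s p = (parr s ''acyclic'' p, parr s ''indep'' p, parr s ''single'' p)"

definition polys :: "nat set set \<Rightarrow> nat set \<Rightarrow> int poly \<times> int poly \<times> int poly" where
  "polys E A = (acyc_poly E A, indep_poly E A, single_poly A)"

fun merge :: "bool \<Rightarrow> int poly \<times> int poly \<times> int poly \<Rightarrow> int poly \<times> int poly \<times> int poly \<Rightarrow> int poly \<times> int poly \<times> int poly" where
  "merge j (a, i, n) (a', i', n') =
     (if j then (a' + a + n * i' + n' * i - n * n', i' + i, n' + n)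
      else (a' + a + a * a', i' + i + i * i', n' + n))"

lemma wp_combine:
  assumes c: "c = arr s ''queue'' (reg s ''i'')" and p: "p = arr s ''par'' c"
    and Q: "\<And>s' t'. (\<And>y. y \<notin> {''c'', ''p'', ''l''} \<Longrightarrow> reg s' y = reg s y) \<Longrightarrow> arr s' = arr s \<Longrightarrow>
      (\<And>q. polys_at s' q = (if q = p then merge (arr s ''lab'' p = 2) (polys_at s c) (polys_at s p) else polys_at s q)) \<Longrightarrow>
      t' \<le> t + 23 \<Longrightarrow> Q s' t'"
  shows "wp combine Q s t"
proof (cases "arr s ''lab'' p = 2")
  case True
  show ?thesis
    using True
    apply (simp add: combine_def combine_join_def combine_union_def wp_simps c[symmetric] p[symmetric])
    apply (rule Q)
    subgoal by simp
    subgoal by (simp add: fun_eq_iff)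
    subgoal by (simp add: polys_at_def algebra_simps)
    subgoal by simp
    done
next
  case False
  show ?thesis
    using False
    apply (simp add: combine_def combine_join_def combine_union_def wp_simps c[symmetric] p[symmetric])
    apply (rule Q)
    subgoal by simp
    subgoal by (simp add: fun_eq_iff)
    subgoal by (simp add: polys_at_def algebra_simps)
    subgoal by simp
    done
qed

lemma polys_of_empty: "polys E {} = (0, 0, 0)"
  by (simp add: polys_def polys_empty)

lemma merge_polys:
  assumes fin: "finite A" "finite B" and dis: "A \<inter> B = {}"
    and e: "\<And>a b. a \<in> A \<Longrightarrow> b \<in> B \<Longrightarrow> {a, b} \<in> E \<longleftrightarrow> j" and loop: "\<And>a. {a} \<notin> E"
  shows "merge j (polys E A) (polys E B) = polys E (B \<union> A)"
proof (cases j)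
  case True
  then show ?thesis
    using polys_join[OF fin dis _ loop] single_poly_Un[OF fin dis] e
    by (simp add: polys_def Un_commute[of B A] algebra_simps)
next
  case False
  then show ?thesis
    using polys_union[OF fin dis] single_poly_Un[OF fin dis] e
    by (simp add: polys_def Un_commute[of B A] algebra_simps)
qed

lemma wp_leaves:
  assumes n: "reg s ''n'' = n" and par: "parr s = (\<lambda>_ _. 0)"
  shows "wp leaves (\<lambda>s' t'. (\<forall>y. y \<noteq> ''i'' \<longrightarrow> reg s' y = reg s y) \<and> (\<forall>a. a \<noteq> ''queue'' \<longrightarrow> arr s' a = arr s a) \<and>
     map (arr s' ''queue'') [0..<n] = [0..<n] \<and>
     (\<forall>q. polys_at s' q = (if q < n then ([:0, 1:], [:0, 1:], [:0, 1:]) else (0, 0, 0))) \<and> t' \<le> t + 3 + 6 * n) s t"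
proof -
  define I where "I s' t' \<longleftrightarrow> preg s' ''T'' = [:0, 1:] \<and> (\<forall>y. y \<noteq> ''i'' \<longrightarrow> reg s' y = reg s y) \<and> (\<forall>a. a \<noteq> ''queue'' \<longrightarrow> arr s' a = arr s a) \<and>
     reg s' ''i'' \<le> n \<and> map (arr s' ''queue'') [0..<reg s' ''i''] = [0..<reg s' ''i''] \<and>
     (\<forall>q. polys_at s' q = (if q < reg s' ''i'' then ([:0, 1:], [:0, 1:], [:0, 1:]) else (0, 0, 0))) \<and> t' \<le> t + 2 + 6 * reg s' ''i''" for s' t'
  have loop: "wp (While (Less (Reg ''i'') (Reg ''n''))
     leaf_step)
     (\<lambda>s' t'. (\<forall>y. y \<noteq> ''i'' \<longrightarrow> reg s' y = reg s y) \<and> (\<forall>a. a \<noteq> ''queue'' \<longrightarrow> arr s' a = arr s a) \<and>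
     map (arr s' ''queue'') [0..<n] = [0..<n] \<and>
     (\<forall>q. polys_at s' q = (if q < n then ([:0, 1:], [:0, 1:], [:0, 1:]) else (0, 0, 0))) \<and> t' \<le> t + 3 + 6 * n) s1 t1"
    if "I s1 t1" for s1 t1
  proof (rule wp_While[where I = I and T = "t + 2 + 6 * n"])
    fix s1 t1 assume I: "I s1 t1" and b: "testval (Less (Reg ''i'') (Reg ''n'')) s1"
    have "reg s1 ''n'' = n" using I n unfolding I_def by simp
    then have i: "reg s1 ''i'' < n" using b by simp
    have len: "map (arr s1 ''queue'') [0..<reg s1 ''i''] = [0..<reg s1 ''i'']" using I unfolding I_def by blast
    show "wp leaf_step I s1 (t1 + 1)"
    proof -
      have po: "polys_at s1 q = (if q < reg s1 ''i'' then ([:0, 1:], [:0, 1:], [:0, 1:]) else (0, 0, 0))" for q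
        using I unfolding I_def by blast
      have "parr s1 ''acyclic'' q = (if q < reg s1 ''i'' then [:0, 1:] else 0)"
        "parr s1 ''indep'' q = (if q < reg s1 ''i'' then [:0, 1:] else 0)"
        "parr s1 ''single'' q = (if q < reg s1 ''i'' then [:0, 1:] else 0)" for q
        using po[of q] unfolding polys_at_def by (simp_all split: if_splits)
      moreover have "preg s1 ''T'' = [:0, 1:]" "\<forall>y. y \<noteq> ''i'' \<longrightarrow> reg s1 y = reg s y" "\<forall>a. a \<noteq> ''queue'' \<longrightarrow> arr s1 a = arr s a"
        "t1 \<le> t + 2 + 6 * reg s1 ''i''" using I unfolding I_def by blast+
      ultimately show ?thesis
        using i len unfolding I_def polys_at_def by (simp add: leaf_step_def wp_simps less_Suc_eq)
    qed
  next
    fix s1 t1 assume I: "I s1 t1" and b: "\<not> testval (Less (Reg ''i'') (Reg ''n'')) s1"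
    have "reg s1 ''n'' = n" using I n unfolding I_def by simp
    then have "reg s1 ''i'' = n" using b I unfolding I_def by simp
    then show "(\<forall>y. y \<noteq> ''i'' \<longrightarrow> reg s1 y = reg s y) \<and> (\<forall>a. a \<noteq> ''queue'' \<longrightarrow> arr s1 a = arr s a) \<and>
     map (arr s1 ''queue'') [0..<n] = [0..<n] \<and>
     (\<forall>q. polys_at s1 q = (if q < n then ([:0, 1:], [:0, 1:], [:0, 1:]) else (0, 0, 0))) \<and> t1 + 1 \<le> t + 3 + 6 * n"
      using I unfolding I_def by auto
  qed (use that in \<open>auto simp: I_def\<close>)
  show ?thesis
    unfolding leaves_def wp_Seq wp_atomic
    by (rule loop) (simp add: I_def polys_at_def par)
qed

context cotree
begin

lemma wp_evaluate:
  assumes st: "store s S x X U r ch" and par: "arr s ''par'' = par" and lb: "arr s ''lab'' = lab"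
    and cnt: "arr s ''cnt'' = (\<lambda>_. 0)" and parr: "parr s = (\<lambda>_ _. 0)"
    and X: "X = {..<S}" and loopfree: "\<And>a. {a} \<notin> E"
  shows "wp evaluate (\<lambda>s' t'. preg s' ''result'' = 1 + acyc_poly E X \<and> t' \<le> t + 20 + 100 * S) s t"
proof -
  note sD = storeD[OF st]
  have finX: "finite X" using X by simp
  have full: "{c \<in> U. L c \<subseteq> X} = U" using LX by blast
  have cU: "card U \<le> 2 * S" using card_full[of X] X unfolding full by simp
  have Lfin: "finite (L c)" if "c \<in> U" for c using finL that .
  \<comment> \<open>the leaves accounted for at \<open>p\<close> once the nodes in \<open>P\<close> have been processed\<close>
  define D where "D P p = (if p \<in> X then {p} else \<Union>c\<in>{c \<in> P. par c = p}. L c)" for P p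
  define I where "I s' t' \<longleftrightarrow> reg s' ''n'' = S \<and> arr s' ''par'' = par \<and> arr s' ''lab'' = lab \<and> arr s' ''deg'' = arr s ''deg'' \<and>
     marks X (queue s') (touched_list s') (arr s' ''cnt'') (reg s' ''i'') \<and>
     (\<forall>p. polys_at s' p = polys E (D (set (take (reg s' ''i'') (queue s'))) p)) \<and>
     t' \<le> t + 6 + 6 * S + 38 * reg s' ''i''" for s' t'
  have bound: "i \<le> card U" if "marks X Q T cnt i" for Q T cnt i
  proof -
    have "i \<le> card (set Q)" "set Q \<subseteq> U"
      using that unfolding marks_def full by (auto simp: distinct_card)
    then show ?thesis using card_mono[of U "set Q"] finU by simp
  qed
  let ?post = "\<lambda>s' t'. preg s' ''result'' = 1 + acyc_poly E X \<and> t' \<le> t + 20 + 100 * S"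
  let ?end = "PLoad ''result'' ''acyclic'' (Reg ''n'') ;; PConst ''T'' 1 ;; PAdd ''result'' ''result'' ''T''"
  have loop: "wp (While (Less (Reg ''i'') (Reg ''q'')) (combine ;; mark_step)) (wp ?end ?post) s1 t1" if "I s1 t1" for s1 t1
  proof (rule wp_While[where I = I and T = "t + 6 + 6 * S + 38 * card U"])
    fix s1 t1 assume I: "I s1 t1" and b: "testval (Less (Reg ''i'') (Reg ''q'')) s1"
    define Q where "Q = queue s1"
    define i where "i = reg s1 ''i''"
    define P where "P = set (take i Q)"
    have n1: "reg s1 ''n'' = S" and a1: "arr s1 ''par'' = par" "arr s1 ''lab'' = lab" "arr s1 ''deg'' = arr s ''deg''"
      and m: "marks X Q (touched_list s1) (arr s1 ''cnt'') i"
      and po: "\<And>p. polys_at s1 p = polys E (D P p)"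
      and t1: "t1 \<le> t + 6 + 6 * S + 38 * i" using I unfolding I_def Q_def i_def P_def by auto
    have i: "i < length Q" using b unfolding Q_def i_def by simp
    define c where "c = Q ! i"
    define p where "p = par c"
    have c: "arr s1 ''queue'' (reg s1 ''i'') = c" using i unfolding c_def Q_def i_def by simp
    have dQ: "distinct Q" and QU: "set Q \<subseteq> U" and down: "\<And>p. p \<in> set Q - X \<Longrightarrow> kids par p \<subseteq> P"
      using m unfolding marks_def full P_def by auto
    have cQ: "c \<in> set Q" using i unfolding c_def by simp
    then have cU: "c \<in> U" using QU by blast
    have tk: "take (Suc i) Q = take i Q @ [c]" using i unfolding c_def by (simp add: take_Suc_conv_app_nth)
    have "distinct (take (Suc i) Q)" using dQ by simp
    then have cP: "c \<notin> P" unfolding tk P_def by simp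
    have PU: "P \<subseteq> U" using QU set_take_subset[of i Q] unfolding P_def by blast
    have Dc: "D P c = L c"
    proof (cases "c \<in> X")
      case True
      then show ?thesis using leaf unfolding D_def by simp
    next
      case False
      then have "{d \<in> P. par d = c} = kids par c" using down cQ by blast
      then show ?thesis using False inner[of c] cU unfolding D_def by simp
    qed
    have pX: "p \<notin> X" using parU[OF cU] rootS SU XU unfolding p_def by (cases "c = r") auto
    have Dp: "D (insert c P) p = D P p \<union> L c"
      using pX unfolding D_def p_def by auto
    have Dq: "D (insert c P) q = D P q" if "q \<noteq> p" for q
    proof -
      have "{d \<in> insert c P. par d = q} = {d \<in> P. par d = q}" using that unfolding p_def by auto
      then show ?thesis unfolding D_def by simp
    qed
    have finP: "finite {d \<in> P. par d = q}" for q using finite_subset[OF PU finU] by simp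
    have finD: "finite (D P p)"
      unfolding D_def using finP Lfin PU by (auto intro!: finite_UN_I)
    \<comment> \<open>If \<open>c\<close> is the root, the label of the super-root does not matter: merging with \<open>0\<close> has the same result
      for both operations.\<close>
    have merge: "merge (lab p = 2) (polys E (D P c)) (polys E (D P p)) = polys E (D (insert c P) p)"
    proof (cases "c = r")
      case True
      have "{d \<in> P. par d = p} = {}"
      proof -
        have "d = r" if "d \<in> P" "par d = p" for d
        proof (rule ccontr)
          assume "d \<noteq> r"
          then have "par d \<in> U" using parU[of d] PU \<open>d \<in> P\<close> by blast
          then show False using that(2) True rootS SU unfolding p_def by simp
        qed
        then show ?thesis using cP True by blast
      qed
      then have "(\<Union>d\<in>{d \<in> P. par d = p}. L d) = {}" by (simp only: UN_empty)
      then have "D P p = {}" using pX unfolding D_def by (simp only: if_False)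
      then show ?thesis unfolding Dp by (cases "polys E (D P c)") (simp add: polys_of_empty Dc)
    next
      case False
      then have pU: "p \<in> U - X" using parU[OF cU] unfolding p_def by blast
      show ?thesis
        unfolding Dc Dp
      proof (rule merge_polys[OF Lfin[OF cU] finD _ _ loopfree])
        have d: "d \<noteq> c" if "d \<in> P" for d using that cP by blast
        show "L c \<inter> D P p = {}"
          using disj[of c] pU d pX unfolding D_def p_def by auto
        show "{a, b} \<in> E \<longleftrightarrow> lab p = 2" if "a \<in> L c" "b \<in> D P p" for a b
        proof -
          obtain d where "d \<in> P" "par d = p" "b \<in> L d" using \<open>b \<in> D P p\<close> pX unfolding D_def by auto
          then show ?thesis using edge[of c d a b] d[of d] pU \<open>a \<in> L c\<close> unfolding p_def by auto
        qed
      qed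
    qed
    show "wp (combine ;; mark_step) I s1 (t1 + 1)"
      unfolding wp_Seq
    proof (rule wp_combine[OF c[symmetric] p_def[folded a1(1)]])
      fix s2 t2 assume r2: "\<And>y. y \<notin> {''c'', ''p'', ''l''} \<Longrightarrow> reg s2 y = reg s1 y" and a2: "arr s2 = arr s1"
        and p2: "\<And>q. polys_at s2 q = (if q = p then merge (arr s1 ''lab'' p = 2) (polys_at s1 c) (polys_at s1 p) else polys_at s1 q)"
        and t2: "t2 \<le> t1 + 1 + 23"
      have q2: "queue s2 = Q" "touched_list s2 = touched_list s1" "reg s2 ''i'' = i" "reg s2 ''n'' = S"
        using r2 a2 n1 unfolding Q_def i_def by simp_all
      have p3: "polys_at s2 q = polys E (D (insert c P) q)" for q
        unfolding p2 a1 po using merge Dq[of q] by simp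
      show "wp mark_step I s2 t2"
      proof (rule wp_mark_step[where p = p])
        show "p = arr s2 ''par'' (arr s2 ''queue'' (reg s2 ''i''))"
          using c q2(3) a2 a1 unfolding i_def p_def by simp
      next
        fix s3 t3 assume fr: "frame mark_regs mark_arrs s2 s3"
          and q3: "queue s3 = (if Suc (arr s2 ''cnt'' p) = arr s2 ''deg'' p then queue s2 @ [p] else queue s2)"
          and tq3: "touched_list s3 = (if arr s2 ''cnt'' p = 0 then touched_list s2 @ [p] else touched_list s2)"
          and c3: "arr s3 ''cnt'' = (arr s2 ''cnt'')(p := Suc (arr s2 ''cnt'' p))"
          and i3: "reg s3 ''i'' = Suc (reg s2 ''i'')" and t3: "t3 \<le> t2 + 13"
        have "marks X (queue s3) (touched_list s3) (arr s3 ''cnt'') (Suc i)"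
          unfolding q3 tq3 c3 q2 unfolding a2 a1
          by (rule marks_step[OF m i c_def p_def]) (use sD par in auto)
        moreover have "arr s3 ''par'' = par" "arr s3 ''lab'' = lab" "arr s3 ''deg'' = arr s ''deg''" "reg s3 ''n'' = S"
          using frameD(1,2)[OF fr] a2 a1 q2 by simp_all
        moreover have "polys_at s3 q = polys E (D (set (take (Suc i) (queue s3))) q)" for q
        proof -
          have "polys_at s3 q = polys_at s2 q" using frameD(4)[OF fr] unfolding polys_at_def by simp
          moreover have "set (take (Suc i) (queue s3)) = insert c P"
            using i tk unfolding q3 q2 P_def by simp
          ultimately show ?thesis using p3 by simp
        qed
        ultimately show "I s3 t3" unfolding I_def i3 q2 using t1 t2 t3 by simp
      qed
    qed
  next
    fix s1 t1 assume I: "I s1 t1" and b: "\<not> testval (Less (Reg ''i'') (Reg ''q'')) s1"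
    have m: "marks X (queue s1) (touched_list s1) (arr s1 ''cnt'') (reg s1 ''i'')" using I unfolding I_def by blast
    have i: "reg s1 ''i'' = length (queue s1)" using b m unfolding marks_def by simp
    have Q: "set (queue s1) = U" using marks_end(1)[OF m[unfolded i]] full by simp
    have SX: "S \<notin> X" using SU XU by blast
    have "c = r" if "c \<in> U" "par c = S" for c using parU[of c] SU that by blast
    then have "{c \<in> U. par c = S} = {r}" using rootS rootU by blast
    then have "D U S = X" using SX rootL unfolding D_def by simp
    then have "polys_at s1 S = polys E X" using I i Q unfolding I_def by simp
    then have "parr s1 ''acyclic'' S = acyc_poly E X" unfolding polys_at_def polys_def by simp
    moreover have "reg s1 ''n'' = S" "t1 \<le> t + 6 + 6 * S + 38 * card U"
      using I bound[OF m] unfolding I_def by auto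
    ultimately show "wp ?end ?post s1 (t1 + 1)"
      using cU by (simp add: wp_simps one_pCons)
  next
    fix s1 t1 assume I: "I s1 t1"
    then show "t1 \<le> t + 6 + 6 * S + 38 * card U" using bound unfolding I_def by fastforce
  qed (rule that)
  show ?thesis
    unfolding evaluate_def wp_Seq[of leaves]
  proof (rule wp_mono[OF wp_leaves[OF sD(1) parr]], goal_cases)
    case (1 s1 t1)
    then have r1: "\<And>y. y \<noteq> ''i'' \<Longrightarrow> reg s1 y = reg s y" and a1: "\<And>a. a \<noteq> ''queue'' \<Longrightarrow> arr s1 a = arr s a"
      and q1: "map (arr s1 ''queue'') [0..<S] = [0..<S]"
      and p1: "\<And>q. polys_at s1 q = (if q < S then ([:0, 1:], [:0, 1:], [:0, 1:]) else (0, 0, 0))"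
      and t1: "t1 \<le> t + 3 + 6 * S" by auto
    let ?s = "set_reg ''i'' 0 (set_reg ''tq'' 0 (set_reg ''q'' S s1))"
    have "marks X [0..<S] [] (\<lambda>_. 0) 0" by (rule marks_start) (use X in auto)
    then have "marks X (queue ?s) (touched_list ?s) (arr ?s ''cnt'') 0" using q1 a1 cnt by simp
    moreover have "polys_at ?s p = polys E (D {} p)" for p
    proof -
      have "polys_at ?s p = polys_at s1 p" unfolding polys_at_def by simp
      then show ?thesis using p1[of p] polys_singleton[OF loopfree, of p] X
        by (simp add: D_def polys_empty polys_def)
    qed
    ultimately have "I ?s (t1 + 3)" unfolding I_def using r1 a1 sD par lb t1 by simp
    from loop[OF this] show ?case using r1 sD(1) by (simp add: wp_Seq wp_atomic numeral_eq_Suc)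
  qed
qed

end

text \<open>Each edge is counted at its two ends.\<close>

lemma sum_degrees:
  assumes G: "simple_graph V E" and adj: "adjacency_lists V E adj"
  shows "(\<Sum>v<length adj. length (adj ! v)) = 2 * card E"
proof -
  have V: "V = {..<length adj}" and nb: "\<And>v. v \<in> V \<Longrightarrow> distinct (adj ! v) \<and> set (adj ! v) = {u. {u, v} \<in> E}"
    using adj unfolding adjacency_lists_def by auto
  have finV: "finite V" using G by (simp add: simple_graph_def)
  have E: "e \<subseteq> V" "card e = 2" if "e \<in> E" for e using G that by (auto simp: simple_graph_def)
  have finE: "finite E" by (rule finite_subset[of E "Pow V"]) (use E finV in auto)
  have "length (adj ! v) = (\<Sum>e\<in>E. if v \<in> e then 1 else 0)" if v: "v \<in> V" for v
  proof -
    have "length (adj ! v) = card {u. {u, v} \<in> E}" using nb[OF v] distinct_card by metis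
    also have "\<dots> = card {e \<in> E. v \<in> e}"
    proof (rule bij_betw_same_card[of "\<lambda>u. {u, v}"], rule bij_betw_imageI)
      show "inj_on (\<lambda>u. {u, v}) {u. {u, v} \<in> E}" by (auto intro!: inj_onI simp: doubleton_eq_iff)
      show "(\<lambda>u. {u, v}) ` {u. {u, v} \<in> E} = {e \<in> E. v \<in> e}"
      proof (intro equalityI subsetI)
        fix e assume e: "e \<in> {e \<in> E. v \<in> e}"
        then obtain a b where "e = {a, b}" using E(2)[of e] by (auto simp: card_2_iff)
        then have "e = {a, v} \<or> e = {b, v}" using e by auto
        then show "e \<in> (\<lambda>u. {u, v}) ` {u. {u, v} \<in> E}" using e by auto
      qed auto
    qed
    also have "\<dots> = (\<Sum>e\<in>E. if v \<in> e then 1 else 0)"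
      using finE by (simp add: sum.If_cases Int_def)
    finally show ?thesis .
  qed
  then have "(\<Sum>v\<in>V. length (adj ! v)) = (\<Sum>v\<in>V. \<Sum>e\<in>E. if v \<in> e then 1 else 0)" by simp
  also have "\<dots> = (\<Sum>e\<in>E. \<Sum>v\<in>V. if v \<in> e then 1 else 0)" by (rule sum.swap)
  also have "\<dots> = (\<Sum>e\<in>E. 2)"
  proof (rule sum.cong[OF refl])
    fix e assume "e \<in> E"
    then have "(\<Sum>v\<in>V. if v \<in> e then 1 else 0) = card e"
      using E(1)[of e] finV by (simp add: sum.If_cases Int_absorb1)
    then show "(\<Sum>v\<in>V. if v \<in> e then 1 else 0) = (2::nat)" using E(2)[OF \<open>e \<in> E\<close>] by simp
  qed
  finally show ?thesis unfolding V by simp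
qed

section \<open>The theorem\<close>

text \<open>Building the tree costs a constant for every vertex and for every entry of the adjacency lists, of which
  there are two for each edge; evaluating it costs a constant for every node.\<close>

theorem theorem1p4:
  "\<exists>(P :: com) (c :: nat). \<forall>(V :: nat set) (E :: nat set set) (adj :: nat list list).
     cograph V E \<and> adjacency_lists V E adj \<longrightarrow>
       (\<exists>t s. exec P (input_state adj) t s \<and> output_poly s = acyclic_poly V E \<and>
          t \<le> c * graph_size V E)"
proof (rule exI[of _ "build ;; evaluate"], rule exI[of _ 400], intro allI impI, elim conjE)
  fix V E adj assume G: "cograph V E" and adj: "adjacency_lists V E adj"
  let ?n = "length adj"
  have sg: "simple_graph V E" by (rule cograph_imp_simple_graph[OF G])
  have V: "V = {..<?n}" using adj by (simp add: adjacency_lists_def)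
  have "V \<noteq> {}" using G by (induction rule: cograph.induct) auto
  then have n0: "0 < ?n" using V by auto
  have loopfree: "{a} \<notin> E" for a
  proof
    assume "{a} \<in> E"
    then have "card {a} = 2" using sg unfolding simple_graph_def by blast
    then show False by simp
  qed
  have "wp (build ;; evaluate) (\<lambda>s t. output_poly s = acyclic_poly V E \<and> t \<le> 400 * graph_size V E) (input_state adj) 0"
    unfolding wp_Seq
  proof (rule wp_mono[OF wp_build[OF G adj]], elim exE conjE, goal_cases)
    case (1 s t U L r ch)
    note c = 1(1) and st = 1(2) and cnt = 1(3) and parr = 1(4) and t = 1(5)
    interpret c: cotree E V ?n U "arr s ''par''" "arr s ''lab''" L r by (rule c)
    have sum: "(\<Sum>y<?n. 201 + 130 * length (adj ! y)) = 201 * ?n + 130 * (2 * card E)"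
      unfolding sum.distrib sum_distrib_left[symmetric] sum_degrees[OF sg adj] by simp
    have "card V = ?n" by (subst V) simp
    then have "graph_size V E = ?n + card E" unfolding graph_size_def by simp
    moreover have "t + 20 + 100 * k \<le> 400 * (k + m)" if k: "t \<le> 20 + (201 * k + 130 * (2 * m))" "0 < k" for k m :: nat
    proof -
      obtain j where "k = Suc j" using k(2) by (cases k) auto
      then show ?thesis using k(1) by simp
    qed
    from this[OF t[unfolded sum] n0] have "t + 20 + 100 * ?n \<le> 400 * (?n + card E)" .
    ultimately have t': "t + 20 + 100 * ?n \<le> 400 * graph_size V E" by simp
    show ?case
      by (rule wp_mono[OF c.wp_evaluate[OF st refl refl cnt parr V loopfree]])
        (use t' in \<open>auto simp: output_poly_def acyclic_poly_eq[OF sg]\<close>)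
  qed
  then show "\<exists>t s. exec (build ;; evaluate) (input_state adj) t s \<and> output_poly s = acyclic_poly V E \<and>
      t \<le> 400 * graph_size V E"
    unfolding wp_def by simp
qed

end
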